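(* Let $e>1$ be a fixed integer. (1) Let $\epsilon(x)$ be a real-valued function tending to $0$ (arbitrarily slowly) as $x\to\infty$. Then $\operatorname{ord}^*(e,n)\ge n^{1/2+\epsilon(n)}$ for all but $o_\epsilon(x)$ integers $n\le x$, as $x\to\infty$. (2) There is a positive constant $\gamma_1$ such that for a positive proportion of the positive integers $n$ we have $\gcd(e,n)=1$ and $\operatorname{ord}(e,n)\ge n^{1/2+\gamma_1}$.
   Context: For an integer $e>1$ and a positive integer $n$ coprime to $e$, $\operatorname{ord}(e,n)$ is the least positive integer $k$ with $e^k\equiv 1 \pmod n$. For an arbitrary positive integer $n$, $n_{(e)}$ denotes the largest divisor of $n$ coprime to $e$, and $\operatorname{ord}^*(e,n)=\operatorname{ord}(e,n_{(e)})$. "Arbitrarily slowly" means that no rate of decay is imposed on $\epsilon$. "A positive proportion of the positive integers" means that the number of such $n\le x$ is $\gg x$ for all sufficiently large $x$. *)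

theory Defs
  imports Complex_Main "HOL-Number_Theory.Number_Theory" "HOL-Library.Landau_Symbols"
begin

text \<open>
  The library writes \<open>ord n e\<close>, modulus first, for the least positive \<open>k\<close> with
  \<open>[e ^ k = 1] (mod n)\<close>, and sets it to \<open>0\<close> if \<open>e\<close> and \<open>n\<close> are not coprime.
  The definitions below take the base \<open>e\<close> first and are meant for \<open>n > 0\<close>.
\<close>

definition coprime_part :: "nat \<Rightarrow> nat \<Rightarrow> nat" where
  "coprime_part e n = Max {d. d dvd n \<and> coprime d e}"

definition ord_star :: "nat \<Rightarrow> nat \<Rightarrow> nat" where
  "ord_star e n = ord (coprime_part e n) e"

text \<open>The number of positive integers \<open>n \<le> x\<close> with property \<open>P\<close>, for real \<open>x\<close>.\<close>

definition count_upto :: "(nat \<Rightarrow> bool) \<Rightarrow> real \<Rightarrow> nat" where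
  "count_upto P x = card {n. 0 < n \<and> real n \<le> x \<and> P n}"

definition almost_all :: "(nat \<Rightarrow> bool) \<Rightarrow> bool" where
  "almost_all P \<longleftrightarrow> (\<lambda>x. real (count_upto (\<lambda>n. \<not> P n) x)) \<in> o(\<lambda>x. x)"

definition positive_proportion :: "(nat \<Rightarrow> bool) \<Rightarrow> bool" where
  "positive_proportion P \<longleftrightarrow> (\<lambda>x. real (count_upto P x)) \<in> \<Omega>(\<lambda>x. x)"

end

theory Submission
  imports Defs "HOL-Real_Asymp.Real_Asymp" "HOL-Computational_Algebra.Squarefree" "HOL-Analysis.Summation_Tests"
begin

text \<open>
  Both parts follow from one statement: for every \<open>\<eta> > 0\<close> there is \<open>\<delta> > 0\<close> such that
  \<open>ord* (e, n) < n powr (1/2 + \<delta>)\<close> for at most \<open>\<eta> x\<close> integers \<open>n \<le> x\<close>. For part (2) one takes \<open>\<eta>\<close>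
  smaller than the density of the integers \<open>n \<equiv> 1 (mod e)\<close>, so no result on large prime factors of
  \<open>p - 1\<close> is needed.

  For almost all \<open>n\<close> the numbers \<open>p - 1\<close> with \<open>p\<close> a large prime factor of \<open>n\<close> have only small common
  factors, so the order is almost the product of the \<open>ord (e, p)\<close>. As \<open>e ^ k - 1\<close> has \<open>O(k)\<close> prime
  factors, \<open>ord (e, p) > p powr (1/2 - \<kappa>)\<close> for most \<open>p\<close>. To gain a power one has to show that few
  primes \<open>p \<le> X\<close> have \<open>ord (e, p) \<le> X powr (1/2 + \<delta>)\<close>. For most such primes \<open>p - 1\<close> is a product of two
  factors of size about \<open>X powr (1/2)\<close>. Let \<open>L = ln (1/\<delta>)\<close>. Usually \<open>p - 1\<close> has at most \<open>7/5 L\<close> prime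
  factors above \<open>X powr \<delta>\<close>, so one of the two factors has at most \<open>7/10 L\<close> of them. As in the
  multiplication table problem such divisors are rare, by a power of \<open>\<delta>\<close>, and this absorbs the
  constants lost in the upper bound sieve.
\<close>

section \<open>Selberg's sieve and primes in progressions\<close>

text \<open>Why the cutoff \<open>7/5 L\<close>: an integer near X has on average about L prime
  factors above X^\<delta>, and the window for the two factors of p - 1 covers a proportion of order
  \<delta> = exp (- L) of the logarithmic scale. With k such prime factors one expects about 2^k
  \<delta> divisors in the window, which is small as long as k < L / ln 2. Yet the mean of 2^k is of
  order exp L, coming from integers with about 2 L such factors, so an untruncated first moment
  gains nothing. The cutoff must lie between 1 and 1 / ln 2 = 1.44... times L. It cannot be imposed
  inside the sieve, as p - 1 itself is too large a modulus; passing to the factor with at most half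
  of the primes turns it into a condition on a single divisor of size about X^(1/2), which the sieve
  can handle. The sieve bounds primes in a progression only up to a constant factor. This constant,
  like those in the theorems of Mertens, must not depend on \<delta>: only then does a saving of
  \<delta>^(1/100) suffice once \<delta> is small.\<close>

lemma sum_minus_one_power_interval:
  assumes "finite G"
  shows "(\<Sum>A | F \<subseteq> A \<and> A \<subseteq> G. (-1::real) ^ card A) = (if F = G then (-1) ^ card F else 0)"
proof (cases "F \<subseteq> G")
  case True
  have fin: "finite F" "finite (G - F)"
    using True assms finite_subset by auto
  have "(\<Sum>A | F \<subseteq> A \<and> A \<subseteq> G. (-1::real) ^ card A) = (\<Sum>B\<in>Pow (G - F). (-1) ^ card (F \<union> B))"
    by (rule sum.reindex_bij_witness[of _ "\<lambda>B. F \<union> B" "\<lambda>A. A - F"])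
       (use True in \<open>auto simp: Un_absorb1\<close>)
  also have "\<dots> = (\<Sum>B\<in>Pow (G - F). (-1) ^ card F * (-1) ^ card B)"
  proof (rule sum.cong)
    fix B assume "B \<in> Pow (G - F)"
    hence "card (F \<union> B) = card F + card B"
      using fin by (intro card_Un_disjoint) (auto intro: finite_subset)
    thus "(-1::real) ^ card (F \<union> B) = (-1) ^ card F * (-1) ^ card B"
      by (simp add: power_add)
  qed simp
  also have "\<dots> = (-1) ^ card F * (\<Prod>x\<in>G - F. 1 - (1::real))"
    by (subst prod_diff_conv_sum[OF fin(2)]) (simp add: sum_distrib_left)
  also have "\<dots> = (if F = G then (-1) ^ card F else 0)"
  proof (cases "F = G")
    case False
    hence "G - F \<noteq> {}" using True by auto
    hence "card (G - F) > 0" using fin by (simp add: card_gt_0_iff)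
    thus ?thesis using False by (simp add: power_0_left)
  qed auto
  finally show ?thesis .
next
  case False
  hence *: "{A. F \<subseteq> A \<and> A \<subseteq> G} = {}" by auto
  have "F \<noteq> G" using False by auto
  thus ?thesis by (simp only: * sum.empty if_False)
qed

lemma prod_primes_dvd_iff:
  fixes n :: nat
  assumes "finite A" "\<And>q. q \<in> A \<Longrightarrow> prime q"
  shows "\<Prod>A dvd n \<longleftrightarrow> (\<forall>q\<in>A. q dvd n)"
  using assms
proof (induction A)
  case (insert q A)
  have "coprime q (\<Prod>A)"
    using insert by (intro prod_coprime_right primes_coprime) auto
  thus ?case using insert by (auto intro: divides_mult)
qed auto

lemma prod_primes_eq_imp_eq:
  fixes A B :: "nat set"
  assumes "finite A" "finite B" "\<And>q. q \<in> A \<union> B \<Longrightarrow> prime q" "\<Prod>A = \<Prod>B"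
  shows "A = B"
proof -
  have "q \<in> B" if "q \<in> A" "finite A" "finite B" "\<And>q. q \<in> A \<union> B \<Longrightarrow> prime q" "\<Prod>A = \<Prod>B" for q and A B :: "nat set"
  proof -
    have "q dvd \<Prod>B" using that by (metis dvd_prodI)
    moreover have "prime q" using that by auto
    ultimately have "\<exists>r\<in>B. q dvd r"
      using that(3) prime_dvd_prod_iff[of B q "\<lambda>x. x"] by simp
    then obtain r where "r \<in> B" "q dvd r" by blast
    thus ?thesis using that primes_dvd_imp_eq[of q r] by auto
  qed
  thus ?thesis using assms by (metis Un_commute subsetI subset_antisym)
qed

text \<open>
  In Selberg's sieve the squarefree divisors of the sifting range are represented by their sets of
  prime factors, so that the Moebius function becomes \<open>(-1) ^ card A\<close>.
\<close>

lemma selberg_sieve: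
  fixes P :: "nat set" and S :: "'a set" and H :: "'a \<Rightarrow> nat set" and D :: nat and Y :: real
  defines "R \<equiv> {A. A \<subseteq> P \<and> \<Prod>A \<le> D}"
  defines "V \<equiv> (\<Sum>A\<in>R. 1 / (\<Prod>q\<in>A. real q - 1))"
  assumes P: "finite P" "\<And>q. q \<in> P \<Longrightarrow> prime q"
  assumes S: "finite S" and D: "D > 0"
  assumes count: "\<And>A. A \<subseteq> P \<Longrightarrow> \<bar>real (card {m\<in>S. A \<subseteq> H m}) - Y / real (\<Prod>A)\<bar> \<le> 1"
  shows "real (card {m\<in>S. H m \<inter> P = {}}) \<le> Y / V + real D ^ 4" and "V \<ge> 1"
proof -
  define g :: "nat set \<Rightarrow> real" where "g F = 1 / (\<Prod>q\<in>F. real q - 1)" for F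
  define h :: "nat set \<Rightarrow> real" where "h F = (\<Prod>q\<in>F. real q - 1)" for F
  \<comment> \<open>Selberg's optimal weights \<lambda>_d = \<mu>(d) d / V * (sum of 1 / \<phi>(m)
    over the multiples m of d in the range), multiplied by V so that \<open>\<rho> {} = V\<close>.
    On squarefree numbers \<open>h\<close> is \<phi> and \<open>g\<close> is 1 / \<phi>.\<close>
  define \<rho> :: "nat set \<Rightarrow> real" where "\<rho> A = (-1) ^ card A * real (\<Prod>A) * (\<Sum>F | F \<in> R \<and> A \<subseteq> F. g F)" for A
  have finR: "finite R" unfolding R_def using P by (auto intro: finite_subset[of _ "Pow P"])
  have R_fin: "finite A" "A \<subseteq> P" if "A \<in> R" for A using that P finite_subset by (auto simp: R_def)
  have gt1: "real q > 1" if "q \<in> P" for q using P(2)[OF that] prime_gt_1_nat by fastforce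
  have hpos: "h F > 0" if "F \<in> R" for F
    using that gt1 unfolding h_def R_def by (intro prod_pos) auto
  have gh: "g F = 1 / h F" for F by (simp add: g_def h_def)
  have gpos: "g F > 0" if "F \<in> R" for F using hpos[OF that] by (simp add: gh)
  have prodpos: "real (\<Prod>A) > 0" if "A \<in> R" for A
    unfolding of_nat_prod using R_fin[OF that] gt1 by (intro prod_pos) force
  have down: "A \<in> R" if "A \<subseteq> F" "F \<in> R" for A F
  proof -
    have "\<Prod>A dvd \<Prod>F" by (rule prod_dvd_prod_subset) (use that R_fin in auto)
    moreover have "\<Prod>F > 0" using prodpos[OF that(2)] by (simp only: of_nat_0_less_iff)
    ultimately have "\<Prod>A \<le> \<Prod>F" by (rule dvd_imp_le)
    thus ?thesis using that by (auto simp: R_def)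
  qed
  have emR: "{} \<in> R" using D by (auto simp: R_def)
  have V_eq: "V = (\<Sum>A\<in>R. g A)" by (simp add: V_def g_def)
  show V1: "V \<ge> 1"
  proof -
    have "g {} \<le> V" unfolding V_eq by (rule member_le_sum) (use emR finR gpos in \<open>auto intro: less_imp_le\<close>)
    thus ?thesis by (simp add: g_def)
  qed
  \<comment> \<open>Cruder than the sharp bound 1 for the absolute value of \<lambda>_d. It makes
    the remainder D^4 instead of D^2, which is harmless because D will be a very small power of
    X.\<close>
  have rho_le: "\<bar>\<rho> A\<bar> \<le> real (\<Prod>A) * V" for A
  proof -
    have "(\<Sum>F | F \<in> R \<and> A \<subseteq> F. g F) \<le> V" unfolding V_eq
      by (rule sum_mono2) (use finR gpos in \<open>auto intro: less_imp_le\<close>)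
    moreover have "(\<Sum>F | F \<in> R \<and> A \<subseteq> F. g F) \<ge> 0" by (rule sum_nonneg) (use gpos in \<open>auto intro: less_imp_le\<close>)
    moreover have "\<bar>\<rho> A\<bar> = real (\<Prod>A) * \<bar>\<Sum>F | F \<in> R \<and> A \<subseteq> F. g F\<bar>"
      unfolding \<rho>_def abs_mult power_abs by (simp del: of_nat_prod)
    ultimately show ?thesis by (simp add: mult_left_mono del: of_nat_prod)
  qed
  have rho_empty: "\<rho> {} = V" by (simp add: \<rho>_def V_eq)
  define I where "I A m = (if A \<subseteq> H m then 1 else 0 :: real)" for A m

  have "(\<Sum>A\<in>R. real (\<Prod>A)) \<le> real D ^ 2"
  proof -
    have "card R \<le> card {1..D}"
    proof (rule card_inj_on_le)
      show "inj_on \<Prod> R"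
      proof (rule inj_onI)
        fix A B assume "A \<in> R" "B \<in> R" "\<Prod>A = \<Prod>B"
        thus "A = B" using R_fin P by (intro prod_primes_eq_imp_eq) blast+
      qed
      show "\<Prod> ` R \<subseteq> {1..D}"
      proof (rule image_subsetI)
        fix A assume "A \<in> R"
        thus "\<Prod>A \<in> {1..D}" using prodpos[of A] by (simp add: R_def Suc_le_eq del: of_nat_prod)
      qed
    qed auto
    hence cR: "card R \<le> D" by simp
    have "(\<Sum>A\<in>R. real (\<Prod>A)) \<le> (\<Sum>A\<in>R. real D)"
      by (rule sum_mono) (auto simp: R_def simp del: of_nat_prod)
    also have "\<dots> \<le> real D * real D" using cR by (simp add: mult_right_mono)
    finally show ?thesis by (simp add: power2_eq_square)
  qed
  hence rho_sum: "(\<Sum>A\<in>R. \<bar>\<rho> A\<bar>) \<le> V * real D ^ 2"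
  proof -
    have "(\<Sum>A\<in>R. \<bar>\<rho> A\<bar>) \<le> (\<Sum>A\<in>R. real (\<Prod>A)) * V"
      unfolding sum_distrib_right by (rule sum_mono) (rule rho_le)
    also have "\<dots> \<le> real D ^ 2 * V"
      using V1 \<open>(\<Sum>A\<in>R. real (\<Prod>A)) \<le> real D ^ 2\<close> by (intro mult_right_mono) auto
    finally show ?thesis by (simp add: mult.commute)
  qed

  \<comment> \<open>If \<open>H m\<close> avoids P, only \<open>A = {}\<close> contributes to the
    inner sum, so its square is \<open>V ^ 2\<close>; the other m are added for free because their
    terms are squares.\<close>
  have lower: "real (card {m\<in>S. H m \<inter> P = {}}) * V ^ 2 \<le> (\<Sum>m\<in>S. (\<Sum>A\<in>R. I A m * \<rho> A) ^ 2)"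
  proof -
    have "real (card {m\<in>S. H m \<inter> P = {}}) * V ^ 2 = (\<Sum>m | m \<in> S \<and> H m \<inter> P = {}. V ^ 2)" by simp
    also have "\<dots> = (\<Sum>m | m \<in> S \<and> H m \<inter> P = {}. (\<Sum>A\<in>R. I A m * \<rho> A) ^ 2)"
    proof (rule sum.cong)
      fix m assume m: "m \<in> {m \<in> S. H m \<inter> P = {}}"
      have "(\<Sum>A\<in>R. I A m * \<rho> A) = (\<Sum>A\<in>{{}}. I A m * \<rho> A)"
        by (rule sum.mono_neutral_right) (use emR finR R_fin m in \<open>auto simp: I_def, blast\<close>)
      also have "\<dots> = V" by (simp add: I_def rho_empty)
      finally show "V ^ 2 = (\<Sum>A\<in>R. I A m * \<rho> A) ^ 2" by simp
    qed simp
    also have "\<dots> \<le> (\<Sum>m\<in>S. (\<Sum>A\<in>R. I A m * \<rho> A) ^ 2)"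
      by (rule sum_mono2) (use S in auto)
    finally show ?thesis .
  qed
  have "(\<Sum>m\<in>S. (\<Sum>A\<in>R. I A m * \<rho> A) ^ 2) = (\<Sum>m\<in>S. \<Sum>A\<in>R. \<Sum>B\<in>R. \<rho> A * \<rho> B * I (A \<union> B) m)"
    unfolding power2_eq_square sum_product
    by (intro sum.cong refl) (auto simp: I_def)
  also have "\<dots> = (\<Sum>A\<in>R. \<Sum>m\<in>S. \<Sum>B\<in>R. \<rho> A * \<rho> B * I (A \<union> B) m)"
    by (rule sum.swap)
  also have "\<dots> = (\<Sum>A\<in>R. \<Sum>B\<in>R. \<rho> A * \<rho> B * (\<Sum>m\<in>S. I (A \<union> B) m))"
    unfolding sum_distrib_left by (intro sum.cong refl sum.swap)
  also have "\<dots> \<le> (\<Sum>A\<in>R. \<Sum>B\<in>R. Y * (\<rho> A * \<rho> B / real (\<Prod>(A \<union> B))) + \<bar>\<rho> A\<bar> * \<bar>\<rho> B\<bar>)"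
  proof (intro sum_mono)
    fix A B assume AB: "A \<in> R" "B \<in> R"
    have "(\<Sum>m\<in>S. I (A \<union> B) m) = real (card {m\<in>S. A \<union> B \<subseteq> H m})"
      unfolding I_def using S by (simp add: sum.If_cases Int_def)
    moreover have "\<bar>real (card {m\<in>S. A \<union> B \<subseteq> H m}) - Y / real (\<Prod>(A \<union> B))\<bar> \<le> 1"
      by (rule count) (use AB R_fin in auto)
    ultimately have "\<bar>(\<Sum>m\<in>S. I (A \<union> B) m) - Y / real (\<Prod>(A \<union> B))\<bar> \<le> 1" by simp
    hence "\<bar>\<rho> A * \<rho> B\<bar> * \<bar>(\<Sum>m\<in>S. I (A \<union> B) m) - Y / real (\<Prod>(A \<union> B))\<bar> \<le> \<bar>\<rho> A * \<rho> B\<bar> * 1"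
      by (intro mult_left_mono) auto
    hence "(\<rho> A * \<rho> B) * ((\<Sum>m\<in>S. I (A \<union> B) m) - Y / real (\<Prod>(A \<union> B))) \<le> \<bar>\<rho> A * \<rho> B\<bar>"
      unfolding abs_mult[symmetric] by linarith
    thus "\<rho> A * \<rho> B * (\<Sum>m\<in>S. I (A \<union> B) m) \<le> Y * (\<rho> A * \<rho> B / real (\<Prod>(A \<union> B))) + \<bar>\<rho> A\<bar> * \<bar>\<rho> B\<bar>"
      by (simp add: right_diff_distrib abs_mult mult_ac del: of_nat_prod)
  qed
  also have "\<dots> = Y * (\<Sum>A\<in>R. \<Sum>B\<in>R. \<rho> A * \<rho> B / real (\<Prod>(A \<union> B))) + (\<Sum>A\<in>R. \<bar>\<rho> A\<bar>) ^ 2"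
  proof -
    have "(\<Sum>A\<in>R. \<bar>\<rho> A\<bar>) ^ 2 = (\<Sum>A\<in>R. \<Sum>B\<in>R. \<bar>\<rho> A\<bar> * \<bar>\<rho> B\<bar>)"
      by (simp only: power2_eq_square sum_product)
    thus ?thesis by (simp only: sum.distrib sum_distrib_left)
  qed
  \<comment> \<open>The quadratic form is diagonalised by writing gcd(a, b) as the sum of \<phi>(d)
    over the common divisors d: it becomes the sum of
    \<open>h F * (\<Sum>A\<in>R. t F A) ^ 2\<close>. For the chosen weights the inner sum is
    \<open>g F\<close> up to sign, so each term is \<open>h F * g F ^ 2 = g F\<close>.\<close>
  also have "(\<Sum>A\<in>R. \<Sum>B\<in>R. \<rho> A * \<rho> B / real (\<Prod>(A \<union> B))) = V"
  proof -
    define t where "t F A = (if F \<subseteq> A then \<rho> A / real (\<Prod>A) else 0)" for F A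
    have "(\<Sum>A\<in>R. \<Sum>B\<in>R. \<rho> A * \<rho> B / real (\<Prod>(A \<union> B))) = (\<Sum>A\<in>R. \<Sum>B\<in>R. \<Sum>F\<in>R. h F * (t F A * t F B))"
    proof (intro sum.cong refl)
      fix A B assume AB: "A \<in> R" "B \<in> R"
      have fin: "finite A" "finite B" using AB R_fin by auto
      have "\<Prod>(A \<union> B) * \<Prod>(A \<inter> B) = \<Prod>A * \<Prod>B" by (rule prod.union_inter[OF fin])
      hence "real (\<Prod>(A \<union> B)) * real (\<Prod>(A \<inter> B)) = real (\<Prod>A) * real (\<Prod>B)"
        by (metis of_nat_mult)
      moreover have "real (\<Prod>(A \<inter> B)) > 0" by (rule prodpos) (rule down[OF _ AB(1)], auto)
      moreover have "real (\<Prod>A) > 0" "real (\<Prod>B) > 0" using prodpos AB by auto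
      moreover have "real (\<Prod>(A \<union> B)) > 0"
        unfolding of_nat_prod using AB R_fin gt1 by (intro prod_pos) force
      ultimately have 1: "1 / real (\<Prod>(A \<union> B)) = real (\<Prod>(A \<inter> B)) / (real (\<Prod>A) * real (\<Prod>B))"
        by (simp add: field_simps del: of_nat_prod)
      have "real (\<Prod>(A \<inter> B)) = (\<Prod>q\<in>A\<inter>B. (real q - 1) + 1)" by simp
      also have "\<dots> = (\<Sum>F\<in>Pow (A \<inter> B). h F)"
        by (subst prod_add) (use fin in \<open>auto simp: h_def\<close>)
      also have "\<dots> = (\<Sum>F\<in>R. if F \<subseteq> A \<and> F \<subseteq> B then h F else 0)"
        by (rule sum.mono_neutral_cong_left) (use finR down AB in auto)
      finally have 2: "real (\<Prod>(A \<inter> B)) = \<dots>" .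
      have "\<rho> A * \<rho> B / real (\<Prod>(A \<union> B)) = (\<rho> A / real (\<Prod>A)) * (\<rho> B / real (\<Prod>B)) * real (\<Prod>(A \<inter> B))"
        using arg_cong[OF 1, of "\<lambda>x. \<rho> A * \<rho> B * x"] by (simp del: of_nat_prod)
      also have "\<dots> = (\<Sum>F\<in>R. h F * (t F A * t F B))"
        unfolding 2 sum_distrib_left by (intro sum.cong refl) (auto simp: t_def)
      finally show "\<rho> A * \<rho> B / real (\<Prod>(A \<union> B)) = (\<Sum>F\<in>R. h F * (t F A * t F B))" .
    qed
    also have "\<dots> = (\<Sum>A\<in>R. \<Sum>F\<in>R. \<Sum>B\<in>R. h F * (t F A * t F B))"
      by (intro sum.cong refl sum.swap)
    also have "\<dots> = (\<Sum>F\<in>R. \<Sum>A\<in>R. \<Sum>B\<in>R. h F * (t F A * t F B))"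
      by (rule sum.swap)
    also have "\<dots> = (\<Sum>F\<in>R. h F * (\<Sum>A\<in>R. t F A) ^ 2)"
      by (simp only: power2_eq_square sum_product) (simp only: sum_distrib_left)
    also have "\<dots> = (\<Sum>F\<in>R. g F)"
    proof (rule sum.cong)
      fix F assume F: "F \<in> R"
      \<comment> \<open>Moebius inversion on the Boolean lattice: after exchanging the sums, the
        sets A between F and G contribute an alternating sum that vanishes unless G = F.\<close>
      have "(\<Sum>A\<in>R. t F A) = (\<Sum>A\<in>R. \<Sum>G\<in>R. if F \<subseteq> A \<and> A \<subseteq> G then (-1) ^ card A * g G else 0)"
      proof (rule sum.cong)
        fix A assume A: "A \<in> R"
        have "(\<Sum>G | G \<in> R \<and> A \<subseteq> G. g G) = (\<Sum>G\<in>R. if A \<subseteq> G then g G else 0)"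
          using finR by (simp add: sum.inter_filter)
        moreover have "(\<Sum>G\<in>R. if F \<subseteq> A \<and> A \<subseteq> G then (-1) ^ card A * g G else 0) =
            (if F \<subseteq> A then (-1) ^ card A * (\<Sum>G\<in>R. if A \<subseteq> G then g G else 0) else 0)"
          by (auto simp: sum_distrib_left intro!: sum.cong)
        ultimately show "t F A = (\<Sum>G\<in>R. if F \<subseteq> A \<and> A \<subseteq> G then (-1) ^ card A * g G else 0)"
          using prodpos[OF A] by (simp add: t_def \<rho>_def del: of_nat_prod)
      qed simp
      also have "\<dots> = (\<Sum>G\<in>R. \<Sum>A\<in>R. if F \<subseteq> A \<and> A \<subseteq> G then (-1) ^ card A * g G else 0)"
        by (rule sum.swap)
      also have "\<dots> = (\<Sum>G\<in>R. g G * (\<Sum>A | F \<subseteq> A \<and> A \<subseteq> G. (-1) ^ card A))"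
      proof (rule sum.cong)
        fix G assume G: "G \<in> R"
        have "(\<Sum>A\<in>R. if F \<subseteq> A \<and> A \<subseteq> G then (-1) ^ card A * g G else 0) =
              (\<Sum>A | F \<subseteq> A \<and> A \<subseteq> G. (-1) ^ card A * g G)"
          by (rule sum.mono_neutral_cong_right) (use finR down G in auto)
        thus "(\<Sum>A\<in>R. if F \<subseteq> A \<and> A \<subseteq> G then (-1) ^ card A * g G else 0) = g G * (\<Sum>A | F \<subseteq> A \<and> A \<subseteq> G. (-1) ^ card A)"
          by (simp add: sum_distrib_left mult.commute)
      qed simp
      also have "\<dots> = (\<Sum>G\<in>R. if F = G then g G * (-1) ^ card F else 0)"
        by (rule sum.cong) (use R_fin in \<open>auto simp: sum_minus_one_power_interval\<close>)
      also have "\<dots> = g F * (-1) ^ card F" using finR F by simp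
      finally have "h F * (\<Sum>A\<in>R. t F A) ^ 2 = h F * (g F * (-1) ^ card F) ^ 2" by simp
      also have "\<dots> = g F"
        using hpos[OF F] by (simp add: gh power2_eq_square mult_ac flip: power_mult_distrib)
      finally show "h F * (\<Sum>A\<in>R. t F A) ^ 2 = g F" .
    qed simp
    finally show ?thesis by (simp add: V_eq)
  qed
  also have "(\<Sum>A\<in>R. \<bar>\<rho> A\<bar>) ^ 2 \<le> (V * real D ^ 2) ^ 2"
    by (rule power_mono[OF rho_sum]) (simp add: sum_nonneg)
  finally have "real (card {m\<in>S. H m \<inter> P = {}}) * V ^ 2 \<le> Y * V + (V * real D ^ 2) ^ 2"
    using lower by linarith
  also have "\<dots> = (Y / V + real D ^ 4) * V ^ 2"
    using V1 by (simp add: field_simps power2_eq_square power4_eq_xxxx)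
  finally show "real (card {m\<in>S. H m \<inter> P = {}}) \<le> Y / V + real D ^ 4"
    using V1 by (simp add: mult_le_cancel_right)
qed

section \<open>Progressions and the denominator of the sieve\<close>

lemma half_le_ln_2: "1/2 \<le> ln (2::real)"
  using exp_half_le2 by (subst ln_ge_iff) auto

lemma card_arith_progression:
  fixes a d N :: nat
  assumes "coprime a d" "a > 0"
  shows "\<bar>real (card {m. m < N \<and> a dvd d * m + 1}) - real N / real a\<bar> \<le> 1"
proof -
  \<comment> \<open>\<open>a - 1\<close> stands for -1 modulo a; the condition on m thus describes a
    single residue class.\<close>
  obtain m0 where m0: "[d * m0 = (a - 1)] (mod a)"
  proof -
    obtain x where "[d * x = 1] (mod a)" using assms cong_solve_coprime_nat[of d a] by (auto simp: coprime_commute)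
    hence "[d * x * (a - 1) = 1 * (a - 1)] (mod a)" by (rule cong_scalar_right)
    thus ?thesis by (intro that[of "x * (a - 1)"]) (simp add: mult.assoc)
  qed
  define c where "c = m0 mod a"
  have c: "c < a" using assms by (simp add: c_def)
  have "[d * m0 + 1 = (a - 1) + 1] (mod a)" using m0 by (rule cong_add) simp
  moreover have "(a - 1) + 1 = a" using assms by simp
  ultimately have m0': "[d * m0 + 1 = 0] (mod a)" by (metis Cong.cong_def mod_self mod_0)
  have iff: "a dvd d * m + 1 \<longleftrightarrow> m mod a = c" for m
  proof -
    have "a dvd d * m + 1 \<longleftrightarrow> [d * m + 1 = d * m0 + 1] (mod a)"
      using m0' by (metis cong_0_iff cong_sym cong_trans)
    also have "\<dots> \<longleftrightarrow> [d * m = d * m0] (mod a)" by (rule cong_add_rcancel_nat)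
    also have "\<dots> \<longleftrightarrow> [m = m0] (mod a)" by (rule cong_mult_lcancel_nat) (use assms in \<open>simp add: coprime_commute\<close>)
    also have "\<dots> \<longleftrightarrow> m mod a = c" by (simp only: Cong.cong_def c_def)
    finally show ?thesis .
  qed
  \<comment> \<open>This is (N - c) / a rounded up, with value 0 for N < c; adding
    \<open>a - 1\<close> before subtracting c prevents truncation, since c < a.\<close>
  define k where "k = (N + a - 1 - c) div a"
  have lt_iff: "c + a * j < N \<longleftrightarrow> j < k" for j
  proof -
    have "j < k \<longleftrightarrow> Suc j \<le> (N + a - 1 - c) div a" by (auto simp: k_def)
    also have "\<dots> \<longleftrightarrow> Suc j * a \<le> N + a - 1 - c" using assms by (simp add: less_eq_div_iff_mult_less_eq)
    also have "\<dots> \<longleftrightarrow> c + a * j < N" using c by (auto simp: algebra_simps)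
    finally show ?thesis ..
  qed
  have "{m. m < N \<and> a dvd d * m + 1} = (\<lambda>j. c + a * j) ` {..<k}"
  proof (intro equalityI subsetI)
    fix m assume "m \<in> {m. m < N \<and> a dvd d * m + 1}"
    hence m: "m < N" "m mod a = c" using iff[of m] by blast+
    hence "m = c + a * (m div a)" using mult_div_mod_eq[of a m] by simp
    moreover have "m div a < k" using lt_iff[of "m div a"] m(1) calculation by simp
    ultimately show "m \<in> (\<lambda>j. c + a * j) ` {..<k}" by blast
  next
    fix m assume "m \<in> (\<lambda>j. c + a * j) ` {..<k}"
    then obtain j where "j < k" "m = c + a * j" by auto
    thus "m \<in> {m. m < N \<and> a dvd d * m + 1}" using lt_iff[of j] iff[of m] c by simp
  qed
  moreover have "inj_on (\<lambda>j. c + a * j) {..<k}" using assms by (auto intro!: inj_onI)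
  ultimately have card: "card {m. m < N \<and> a dvd d * m + 1} = k" by (simp add: card_image)
  have 1: "real k * real a \<le> real N + real a"
  proof -
    have "k * a \<le> N + a - 1 - c" unfolding k_def by (simp add: div_times_less_eq_dividend)
    hence "k * a \<le> N + a" by linarith
    thus ?thesis by (metis of_nat_add of_nat_le_iff of_nat_mult)
  qed
  have 2: "real N \<le> real k * real a + real a"
  proof -
    have "\<not> c + a * k < N" using lt_iff[of k] by simp
    hence "N \<le> k * a + a" using c by (simp add: mult.commute)
    thus ?thesis by (metis of_nat_add of_nat_le_iff of_nat_mult)
  qed
  have "real a > 0" using assms by simp
  have "real N / real a \<le> real k + 1" "real k \<le> real N / real a + 1"
    using 1 2 \<open>real a > 0\<close> by (simp_all add: field_simps)
  thus ?thesis unfolding card by linarith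
qed

lemma sum_inverse_squares_tail_le:
  assumes "Z \<ge> 1"
  shows "(\<Sum>k\<in>{Z<..n}. 1 / real k ^ 2) \<le> 1 / real Z"
proof (cases "Z \<le> n")
  case True
  have "(\<Sum>k\<in>{Z<..n}. 1 / real k ^ 2) \<le> 1 / real Z - 1 / real n"
    using True
  proof (induction n rule: dec_induct)
    case (step n)
    have "1 / real (Suc n) ^ 2 \<le> 1 / (real n * real (Suc n))"
      using step assms by (intro divide_left_mono) (auto simp: power2_eq_square)
    also have "\<dots> = 1 / real n - 1 / real (Suc n)"
      using step assms by (simp add: field_simps)
    finally have 1: "1 / real (Suc n) ^ 2 \<le> 1 / real n - 1 / real (Suc n)" .
    have "{Z<..Suc n} = insert (Suc n) {Z<..n}" using step by auto
    hence "(\<Sum>k\<in>{Z<..Suc n}. 1 / real k ^ 2) = 1 / real (Suc n) ^ 2 + (\<Sum>k\<in>{Z<..n}. 1 / real k ^ 2)" by simp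
    thus ?case using 1 step.IH by linarith
  qed simp
  moreover have "1 / real n \<ge> 0" by simp
  ultimately show ?thesis by linarith
qed simp

lemma sum_inverse_squares_le: "(\<Sum>k=1..n. 1 / real k ^ 2) \<le> 2"
proof (cases "n \<ge> 1")
  case True
  hence "{1..n} = insert 1 {1<..n}" by auto
  thus ?thesis using sum_inverse_squares_tail_le[of 1 n] by simp
qed simp

lemma ln_le_harmonic: "ln (real n + 1) \<le> (\<Sum>k=1..n. 1 / real k)"
proof (induction n)
  case (Suc n)
  have "ln (real (Suc n) + 1) - ln (real n + 1) \<le> 1 / real (Suc n)"
    using ln_diff_le[of "real (Suc n) + 1" "real n + 1"] by (simp add: add_ac)
  with Suc show ?case by simp
qed simp

lemma sum_Un_le:
  fixes f :: "'a \<Rightarrow> real"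
  assumes "finite A" "finite B" "\<And>x. f x \<ge> 0"
  shows "sum f (A \<union> B) \<le> sum f A + sum f B"
  using assms sum.union_inter[of A B f] sum_nonneg[of "A \<inter> B" f] by simp

lemma sum_UN_le:
  fixes f :: "'a \<Rightarrow> real"
  assumes "finite I" "\<And>i. i \<in> I \<Longrightarrow> finite (A i)" "\<And>x. f x \<ge> 0"
  shows "sum f (\<Union>i\<in>I. A i) \<le> (\<Sum>i\<in>I. sum f (A i))"
  using assms
proof (induction I)
  case (insert i I)
  have "sum f (A i \<union> (\<Union>i\<in>I. A i)) \<le> sum f (A i) + sum f (\<Union>i\<in>I. A i)"
    by (rule sum_Un_le) (use insert in auto)
  thus ?case using insert by simp
qed simp

text \<open>Every n is r k^2 with r squarefree, so the harmonic sum is at most the squarefree sum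
  times the sum of 1 / k^2, which is at most 2.\<close>

lemma sum_squarefree_ge:
  assumes "D \<ge> 1"
  shows "ln (real D) \<le> 2 * (\<Sum>r | r \<in> {1..D} \<and> squarefree r. 1 / real r)"
proof -
  let ?SQ = "{r \<in> {1..D}. squarefree r}"
  have "ln (real D) \<le> ln (real D + 1)" using assms by simp
  also have "\<dots> \<le> (\<Sum>n=1..D. 1 / real n)" by (rule ln_le_harmonic)
  also have "\<dots> \<le> (\<Sum>(r, k)\<in>?SQ \<times> {1..D}. 1 / real r * (1 / real k ^ 2))"
  proof (rule sum_le_included[where i = "\<lambda>(r, k). r * k ^ 2"])
    show "\<forall>n\<in>{1..D}. \<exists>x\<in>?SQ \<times> {1..D}. (case x of (r, k) \<Rightarrow> r * k ^ 2) = n \<and>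
            1 / real n \<le> (case x of (r, k) \<Rightarrow> 1 / real r * (1 / real k ^ 2))"
    proof
      fix n assume n: "n \<in> {1..D}"
      obtain r k where eq: "r * k ^ 2 = n" and sq: "squarefree r"
        using squarefree_decompose[of n] squarefree_squarefree_part[of n] by metis
      have "r dvd n" "k dvd n" using eq by auto
      moreover have "r > 0" "k > 0" using n eq by (auto intro!: Nat.gr0I)
      ultimately have "(r, k) \<in> ?SQ \<times> {1..D}"
        using n sq dvd_imp_le[of r n] dvd_imp_le[of k n] by auto
      thus "\<exists>x\<in>?SQ \<times> {1..D}. (case x of (r, k) \<Rightarrow> r * k ^ 2) = n \<and>
            1 / real n \<le> (case x of (r, k) \<Rightarrow> 1 / real r * (1 / real k ^ 2))"
        using eq by (intro bexI[of _ "(r, k)"]) auto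
    qed
  qed auto
  also have "\<dots> = (\<Sum>r\<in>?SQ. 1 / real r) * (\<Sum>k=1..D. 1 / real k ^ 2)"
    by (simp only: sum_product sum.cartesian_product)
  also have "\<dots> \<le> (\<Sum>r\<in>?SQ. 1 / real r) * 2"
    by (intro mult_left_mono sum_inverse_squares_le sum_nonneg) auto
  finally show ?thesis by simp
qed

lemma prod_prime_factors_squarefree:
  fixes r :: nat
  assumes "squarefree r" "r > 0"
  shows "\<Prod>(prime_factors r) = r"
proof -
  have "(\<Prod>p\<in>prime_factors r. p) = (\<Prod>p\<in>prime_factors r. p ^ multiplicity p r)"
    by (rule prod.cong) (use assms in \<open>auto simp: squarefree_factorial_semiring' multiplicity_eq_zero_iff\<close>)
  also have "\<dots> = r" using prime_factorization_nat[of r] assms by simp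
  finally show ?thesis .
qed

abbreviation prime_recip :: "nat \<Rightarrow> real" where
  "prime_recip d \<equiv> \<Sum>q | prime q \<and> q dvd d. 1 / real q"

text \<open>The squarefree r sharing a prime q with d contribute at most 1 / q of the whole
  squarefree sum for each q. By \<open>half\<close> at least half of that sum survives, so a
  constant takes the place of the usual factor \<phi>(d) / d. Passing from 1 / r to 1 / \<phi>(r)
  only enlarges the terms.\<close>

lemma selberg_denominator_ge:
  fixes d D :: nat
  defines "P \<equiv> {q. prime q \<and> q \<le> D \<and> \<not> q dvd d}"
  assumes "D \<ge> 1" "d > 0" and half: "prime_recip d \<le> 1/2"
  shows "(\<Sum>A | A \<subseteq> P \<and> \<Prod>A \<le> D. 1 / (\<Prod>q\<in>A. real q - 1)) \<ge> ln (real D) / 4"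
proof -
  define SQ where "SQ = {r \<in> {1..D}. squarefree r}"
  define U where "U = (\<Sum>r\<in>SQ. 1 / real r)"
  define R where "R = {A. A \<subseteq> P \<and> \<Prod>A \<le> D}"
  define SC where "SC = {r\<in>SQ. \<forall>q. prime q \<longrightarrow> q dvd d \<longrightarrow> \<not> q dvd r}"
  have finP: "finite P" unfolding P_def by (rule finite_subset[of _ "{..D}"]) auto
  have finR: "finite R" unfolding R_def using finP by (auto intro: finite_subset[of _ "Pow P"])
  have finSQ: "finite SQ" by (auto simp: SQ_def)
  have find: "finite {q. prime q \<and> q dvd d}"
    by (rule finite_subset[of _ "{..d}"]) (use \<open>d > 0\<close> dvd_imp_le in auto)
  have gt1: "real q > 1" if "q \<in> P" for q using that prime_gt_1_nat[of q] by (simp add: P_def)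
  have hnn: "(\<Prod>q\<in>A. real q - 1) \<ge> 0" if "A \<in> R" for A
    using that gt1 unfolding R_def by (intro prod_nonneg) (auto intro!: less_imp_le)
  have U0: "U \<ge> 0" unfolding U_def by (rule sum_nonneg) auto
  have "(\<Sum>r\<in>SC. 1 / real r) \<le> (\<Sum>A\<in>R. 1 / (\<Prod>q\<in>A. real q - 1))"
  proof (rule sum_le_included[where i = "\<lambda>A. \<Prod>A"])
    show "\<forall>r\<in>SC. \<exists>A\<in>R. \<Prod>A = r \<and> 1 / real r \<le> 1 / (\<Prod>q\<in>A. real q - 1)"
    proof
      fix r assume r: "r \<in> SC"
      have r': "squarefree r" "r > 0" "r \<le> D" using r by (auto simp: SC_def SQ_def)
      have eq: "\<Prod>(prime_factors r) = r" by (rule prod_prime_factors_squarefree) (use r' in auto)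
      have sub: "prime_factors r \<subseteq> P"
      proof
        fix q assume q: "q \<in> prime_factors r"
        hence "prime q" "q dvd r" by auto
        moreover have "q \<le> r" using \<open>q dvd r\<close> r' by (intro dvd_imp_le) auto
        ultimately show "q \<in> P" using r r' by (auto simp: SC_def P_def)
      qed
      have "0 < (\<Prod>q\<in>prime_factors r. real q - 1)"
        using sub gt1 by (intro prod_pos) auto
      moreover have "(\<Prod>q\<in>prime_factors r. real q - 1) \<le> (\<Prod>q\<in>prime_factors r. real q)"
        using sub gt1 by (intro prod_mono) (auto intro: less_imp_le)
      moreover have "(\<Prod>q\<in>prime_factors r. real q) = real r" using arg_cong[OF eq, of real] by simp
      ultimately have "1 / real r \<le> 1 / (\<Prod>q\<in>prime_factors r. real q - 1)"
        using r' by (intro divide_left_mono) simp_all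
      moreover have "prime_factors r \<in> R" using sub eq r' unfolding R_def by simp
      ultimately show "\<exists>A\<in>R. \<Prod>A = r \<and> 1 / real r \<le> 1 / (\<Prod>q\<in>A. real q - 1)"
        using eq by blast
    qed
  qed (use finR finSQ hnn in \<open>auto simp: SC_def\<close>)
  moreover have "U \<le> (\<Sum>r\<in>SC. 1 / real r) + U / 2"
  proof -
    have "U \<le> (\<Sum>r\<in>SC \<union> (\<Union>q\<in>{q. prime q \<and> q dvd d}. {r\<in>SQ. q dvd r}). 1 / real r)"
      unfolding U_def by (rule sum_mono2) (use finSQ find in \<open>auto simp: SC_def\<close>)
    also have "\<dots> \<le> (\<Sum>r\<in>SC. 1 / real r) + (\<Sum>r\<in>(\<Union>q\<in>{q. prime q \<and> q dvd d}. {r\<in>SQ. q dvd r}). 1 / real r)"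
      by (rule sum_Un_le) (use finSQ find in \<open>auto simp: SC_def\<close>)
    also have "(\<Sum>r\<in>(\<Union>q\<in>{q. prime q \<and> q dvd d}. {r\<in>SQ. q dvd r}). 1 / real r) \<le>
               (\<Sum>q | prime q \<and> q dvd d. \<Sum>r | r \<in> SQ \<and> q dvd r. 1 / real r)"
      by (rule sum_UN_le) (use finSQ find in auto)
    also have "\<dots> \<le> (\<Sum>q | prime q \<and> q dvd d. 1 / real q * U)"
    proof (rule sum_mono)
      fix q assume q: "q \<in> {q. prime q \<and> q dvd d}"
      hence q0: "q > 0" by (auto simp: prime_gt_0_nat)
      have "(\<Sum>r | r \<in> SQ \<and> q dvd r. 1 / real r) \<le> (\<Sum>r\<in>SQ. 1 / real q * (1 / real r))"
      proof (rule sum_le_included[where i = "\<lambda>r. q * r"])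
        show "\<forall>r\<in>{r. r \<in> SQ \<and> q dvd r}. \<exists>y\<in>SQ. q * y = r \<and> 1 / real r \<le> 1 / real q * (1 / real y)"
        proof
          fix r assume r: "r \<in> {r. r \<in> SQ \<and> q dvd r}"
          then obtain y where y: "r = q * y" by auto
          have qy: "squarefree (q * y)" "q * y > 0" "q * y \<le> D" using r y by (simp_all add: SQ_def)
          have "squarefree y" using qy(1) by (rule squarefree_multD)
          moreover have "y > 0" using qy(2) by simp
          moreover have "y \<le> D" using qy(3) q0 le_trans[of y "q * y" D] by simp
          ultimately show "\<exists>y\<in>SQ. q * y = r \<and> 1 / real r \<le> 1 / real q * (1 / real y)"
            using y by (intro bexI[of _ y]) (auto simp: SQ_def)
        qed
      qed (use finSQ in auto)
      thus "(\<Sum>r | r \<in> SQ \<and> q dvd r. 1 / real r) \<le> 1 / real q * U" by (simp add: U_def sum_distrib_left)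
    qed
    also have "\<dots> = prime_recip d * U" by (rule sum_distrib_right[symmetric])
    also have "\<dots> \<le> 1 / 2 * U" by (rule mult_right_mono[OF half U0])
    finally show ?thesis by simp
  qed
  moreover have "ln (real D) \<le> 2 * U" using sum_squarefree_ge[OF \<open>D \<ge> 1\<close>] by (simp add: U_def SQ_def)
  ultimately show ?thesis unfolding R_def[symmetric] by linarith
qed

section \<open>Upper bounds for primes in arithmetic progressions\<close>

lemma real_card_le_sum:
  assumes "finite I" "\<And>i. i \<in> I \<Longrightarrow> finite (A i)" "S \<subseteq> (\<Union>i\<in>I. A i)"
  shows "real (card S) \<le> (\<Sum>i\<in>I. real (card (A i)))"
proof -
  have "card S \<le> card (\<Union>i\<in>I. A i)" by (rule card_mono) (use assms in auto)
  also have "\<dots> \<le> (\<Sum>i\<in>I. card (A i))" by (rule card_UN_le[OF assms(1)])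
  finally show ?thesis by (simp only: of_nat_le_iff flip: of_nat_sum)
qed

abbreviation multiples :: "nat \<Rightarrow> nat \<Rightarrow> nat set" where
  "multiples N d \<equiv> {n. 0 < n \<and> n \<le> N \<and> d dvd n}"

lemma card_multiples_le:
  assumes "d > 0"
  shows "real (card (multiples N d)) \<le> real N / real d"
proof -
  have "(multiples N d) \<subseteq> (\<lambda>j. d * j) ` {1..N div d}"
  proof
    fix n assume "n \<in> (multiples N d)"
    hence n: "0 < n" "n \<le> N" "d dvd n" by auto
    then obtain j where j: "n = d * j" by blast
    have "j \<le> N div d" using j n assms by (simp add: less_eq_div_iff_mult_less_eq mult.commute)
    moreover have "j \<ge> 1" using j n by (cases j) auto
    ultimately show "n \<in> (\<lambda>j. d * j) ` {1..N div d}" using j by auto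
  qed
  hence "card (multiples N d) \<le> card ((\<lambda>j. d * j) ` {1..N div d})"
    by (rule card_mono[rotated]) auto
  also have "\<dots> \<le> N div d" using card_image_le[of "{1..N div d}" "\<lambda>j. d * j"] by simp
  finally have "real (card (multiples N d)) \<le> real (N div d)" by simp
  also have "\<dots> \<le> real N / real d" by (rule of_nat_div_le_of_nat)
  finally show ?thesis .
qed

lemma inj_on_pred_primes: "(\<And>p. p \<in> S \<Longrightarrow> prime p) \<Longrightarrow> inj_on (\<lambda>p::nat. p - 1) S"
  by (rule inj_onI) (metis Suc_diff_1 prime_gt_0_nat)

lemma card_le_real:
  assumes "y \<ge> 0" "\<And>n. n \<in> S \<Longrightarrow> 0 < n \<and> real n \<le> y"
  shows "real (card S) \<le> y"
proof -
  have "card S \<le> card {1..nat \<lfloor>y\<rfloor>}"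
    by (rule card_mono) (use assms(2) in \<open>auto simp: le_nat_floor Suc_le_eq\<close>)
  hence "real (card S) \<le> real (nat \<lfloor>y\<rfloor>)" by (simp only: card_atLeastAtMost diff_Suc_1 of_nat_le_iff)
  also have "\<dots> \<le> y" using assms(1) by simp
  finally show ?thesis .
qed

abbreviation primes_AP :: "nat \<Rightarrow> nat \<Rightarrow> nat set" where
  "primes_AP X d \<equiv> {p. prime p \<and> p \<le> X \<and> d dvd p - 1}"

lemma card_primes_AP_trivial:
  assumes "d > 0"
  shows "real (card (primes_AP X d)) \<le> real X / real d"
proof -
  have "card (primes_AP X d) \<le> card (multiples X d)"
  proof (rule card_inj_on_le)
    show "inj_on (\<lambda>p. p - 1) (primes_AP X d)" by (rule inj_on_pred_primes) simp
    show "(\<lambda>p. p - 1) ` (primes_AP X d) \<subseteq> (multiples X d)"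
    proof (rule image_subsetI)
      fix p assume "p \<in> (primes_AP X d)"
      thus "p - 1 \<in> (multiples X d)" using prime_gt_1_nat[of p] by auto
    qed
    show "finite (multiples X d)" by (rule finite_subset[of _ "{..X}"]) auto
  qed
  also have "real (card (multiples X d)) \<le> real X / real d"
    by (rule card_multiples_le[OF assms])
  finally show ?thesis by simp
qed

text \<open>A prime p = d m + 1 above D has no prime factor up to D, so m survives the sieve; the
  primes up to D account for the summand D. Primes dividing d never divide d m + 1 and are therefore
  left out of the sifting set.\<close>

lemma card_primes_AP_sieve:
  fixes d D X :: nat
  assumes D: "D \<ge> 2" and "d > 0" and half: "prime_recip d \<le> 1/2"
  shows "real (card (primes_AP X d)) \<le>
           real D + (real X / real d + 1) * 4 / ln (real D) + real D ^ 4"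
proof -
  define P where "P = {q. prime q \<and> q \<le> D \<and> \<not> q dvd d}"
  define S where "S = {m. m < X div d + 1}"
  define H where "H m = {q. prime q \<and> q dvd d * m + 1}" for m
  define V where "V = (\<Sum>A | A \<subseteq> P \<and> \<Prod>A \<le> D. 1 / (\<Prod>q\<in>A. real q - 1))"
  define Y where "Y = real (X div d + 1)"
  have finP: "finite P" unfolding P_def by (rule finite_subset[of _ "{..D}"]) auto
  have finS: "finite S" by (simp add: S_def)
  have PH: "\<bar>real (card {m\<in>S. A \<subseteq> H m}) - Y / real (\<Prod>A)\<bar> \<le> 1" if A: "A \<subseteq> P" for A
  proof -
    have finA: "finite A" using A finP by (rule finite_subset)
    have prA: "\<And>q. q \<in> A \<Longrightarrow> prime q" using A by (auto simp: P_def)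
    have "{m\<in>S. A \<subseteq> H m} = {m. m < X div d + 1 \<and> \<Prod>A dvd d * m + 1}"
      using prod_primes_dvd_iff[OF finA prA] prA by (auto simp: S_def H_def)
    moreover have "coprime (\<Prod>A) d"
      by (rule prod_coprime_left) (use A in \<open>auto simp: P_def intro!: prime_imp_coprime\<close>)
    moreover have "\<Prod>A > 0" using prA by (intro prod_pos) (auto simp: prime_gt_0_nat)
    ultimately show ?thesis unfolding Y_def using card_arith_progression[of "\<Prod>A" d "X div d + 1"] by simp
  qed
  have sieve: "real (card {m\<in>S. H m \<inter> P = {}}) \<le> Y / V + real D ^ 4" 
    unfolding V_def
    by (rule selberg_sieve(1)) (use finP finS PH D in \<open>auto simp: P_def\<close>)
  have V: "V \<ge> ln (real D) / 4" unfolding V_def P_def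
    by (rule selberg_denominator_ge) (use assms in auto)
  have lnD: "ln (real D) > 0" using D by simp
  let ?B = "(primes_AP X d)"
  have finB: "finite ?B" by (rule finite_subset[of _ "{..X}"]) auto
  have "?B \<subseteq> {1..D} \<union> (\<lambda>m. d * m + 1) ` {m\<in>S. H m \<inter> P = {}}"
  proof
    fix p assume "p \<in> ?B"
    hence p: "prime p" "p \<le> X" "d dvd p - 1" by auto
    then obtain m where "p - 1 = d * m" by blast
    hence pm: "p = d * m + 1" using p(1) prime_gt_0_nat[of p] by simp
    show "p \<in> {1..D} \<union> (\<lambda>m. d * m + 1) ` {m\<in>S. H m \<inter> P = {}}"
    proof (cases "p \<le> D")
      case False
      have "m * d \<le> X" using pm p(2) by (simp add: mult.commute)
      hence "m \<le> X div d" using \<open>d > 0\<close> by (simp add: less_eq_div_iff_mult_less_eq)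
      hence "m \<in> S" by (simp add: S_def)
      moreover have "H m \<inter> P = {}"
      proof (rule ccontr)
        assume "H m \<inter> P \<noteq> {}"
        then obtain q where "prime q" "q dvd p" "q \<le> D" unfolding H_def P_def pm by blast
        moreover from this have "q = p" using p(1) by (intro primes_dvd_imp_eq)
        ultimately show False using False by simp
      qed
      ultimately show ?thesis using pm by blast
    qed (use p prime_ge_1_nat in auto)
  qed
  hence "card ?B \<le> card ({1..D} \<union> (\<lambda>m. d * m + 1) ` {m\<in>S. H m \<inter> P = {}})"
    by (rule card_mono[rotated]) (use finS in auto)
  also have "\<dots> \<le> card {1..D} + card ((\<lambda>m. d * m + 1) ` {m\<in>S. H m \<inter> P = {}})"
    by (rule card_Un_le)
  also have "\<dots> \<le> D + card {m\<in>S. H m \<inter> P = {}}"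
    using card_image_le[of "{m\<in>S. H m \<inter> P = {}}" "\<lambda>m. d * m + 1"] finS by simp
  finally have "real (card ?B) \<le> real D + (Y / V + real D ^ 4)" using sieve by linarith
  also have "Y / V \<le> (real X / real d + 1) / (ln (real D) / 4)"
  proof (rule frac_le)
    show "Y \<le> real X / real d + 1" using of_nat_div_le_of_nat[of X d, where ?'a = real] by (simp add: Y_def)
  qed (use V lnD in auto)
  finally show ?thesis by simp
qed

text \<open>The additive term X^(1/10) covers all d with X / d below it, so the sieve is applied
  only where the progression has at least X^(1/10) terms. This gives uniformity in d without any
  condition on the size of d.\<close>

theorem brun_titchmarsh:
  "\<exists>C\<ge>1. \<forall>X d. X \<ge> 2 \<longrightarrow> d > 0 \<longrightarrow> prime_recip d \<le> 1/2 \<longrightarrow>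
     real (card (primes_AP X d)) \<le>
       C * real X / (real d * ln (real X)) + real X powr (1/10)"
proof -
  have ev: "eventually (\<lambda>x::real. x powr (1/80) \<ge> 4 \<and> 40 * ln x * x powr (1/20) \<le> x powr (1/10) \<and> x \<ge> 2) at_top"
    by (intro eventually_conj; real_asymp)
  then obtain X0 :: real where X0: "\<And>x. x \<ge> X0 \<Longrightarrow> x powr (1/80) \<ge> 4 \<and> 40 * ln x * x powr (1/20) \<le> x powr (1/10) \<and> x \<ge> 2"
    by (auto simp: eventually_at_top_linorder)
  \<comment> \<open>1400 exceeds 1281: the sieve gives 1280 = 8 * 160, from
    \<open>?N + 1 \<le> 2 * ?N\<close> and \<open>ln D \<ge> ln X / 160\<close>, and the remainders
    add 1. The term with \<open>X0\<close> makes the trivial bound X / d sufficient for X below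
    \<open>X0\<close>.\<close>
  define C where "C = 1400 + \<bar>ln X0\<bar>"
  show ?thesis
  proof (intro exI[of _ C] conjI allI impI)
    fix X d :: nat
    assume X2: "X \<ge> 2" and d: "d > 0" and half: "prime_recip d \<le> 1/2"
    let ?B = "real (card (primes_AP X d))"
    let ?N = "real X / real d"
    have triv: "?B \<le> ?N" by (rule card_primes_AP_trivial[OF d])
    have lnX: "ln (real X) > 0" using X2 by simp
    have N0: "?N \<ge> 0" by simp
    have rhs: "C * real X / (real d * ln (real X)) = ?N * (C / ln (real X))" by simp
    consider "real X < X0" | "real X \<ge> X0" "?N < real X powr (1/10)" | "real X \<ge> X0" "?N \<ge> real X powr (1/10)" by linarith
    thus "?B \<le> C * real X / (real d * ln (real X)) + real X powr (1/10)"
    proof cases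
      case 1
      have "ln (real X) \<le> ln X0" using 1 X2 by (intro ln_mono) auto
      hence "ln (real X) \<le> C" unfolding C_def by linarith
      hence "1 \<le> C / ln (real X)" using lnX by simp
      hence "?N * 1 \<le> ?N * (C / ln (real X))" by (rule mult_left_mono) simp
      thus ?thesis using triv rhs powr_ge_zero[of "real X" "1/10"] by linarith
    next
      case 2
      have "0 \<le> C * real X / (real d * ln (real X))" using lnX by (auto simp: C_def intro!: divide_nonneg_nonneg mult_nonneg_nonneg)
      thus ?thesis using 2 triv by linarith
    next
      case 3
      define t where "t = real X powr (1/80)"
      have t: "t \<ge> 4" "40 * ln (real X) * real X powr (1/20) \<le> real X powr (1/10)"
        using X0[OF 3(1)] by (auto simp: t_def)
      \<comment> \<open>D^4 is at most X^(1/20), well below X^(1/10). Rounding down costs at most a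
        square root of t, hence half of ln t = ln X / 80.\<close>
      define D where "D = nat \<lfloor>t\<rfloor>"
      have D: "real D \<le> t" "real D \<ge> t / 2" "D \<ge> 2" using t(1) unfolding D_def by linarith+
      have "t powr (1/2) * 2 \<le> t powr (1/2) * t powr (1/2)"
        using t(1) powr_mono2[of "1/2" 4 t] by (intro mult_left_mono) (auto simp: powr_half_sqrt)
      also have "\<dots> = t" using t(1) by (simp flip: powr_add)
      finally have "t powr (1/2) \<le> real D" using D(2) by simp
      hence "ln (t powr (1/2)) \<le> ln (real D)" using t(1) by (intro ln_mono) auto
      also have "ln (t powr (1/2)) = ln (real X) / 160" using X2 by (simp add: t_def ln_powr)
      finally have lnD: "ln (real X) / 160 \<le> ln (real D)" .
      have D4: "real D ^ 4 \<le> real X powr (1/20)"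
      proof -
        have "real D ^ 4 \<le> t ^ 4" using D by (intro power_mono) auto
        also have "t ^ 4 = t powr 4" using t(1) by simp
        also have "\<dots> = real X powr (1/20)" by (simp add: t_def powr_powr)
        finally show ?thesis .
      qed
      have "real D \<le> real D ^ 4" using power_increasing[of 1 4 "real D"] D by simp
      hence "real D + real D ^ 4 \<le> 2 * real X powr (1/20)" using D4 by linarith
      also have "\<dots> \<le> ?N * (1 / ln (real X))"
      proof -
        have "2 * real X powr (1/20) * ln (real X) \<le> 40 * ln (real X) * real X powr (1/20)" using lnX by simp
        also have "\<dots> \<le> ?N" using t(2) 3(2) by linarith
        finally have "2 * real X powr (1/20) \<le> ?N / ln (real X)" using pos_le_divide_eq[OF lnX] by blast
        thus ?thesis by simp
      qed
      finally have 1: "real D + real D ^ 4 \<le> ?N * (1 / ln (real X))" .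
      have "1 \<le> real X powr (1/10)" using X2 by (intro ge_one_powr_ge_zero) auto
      hence N1: "?N \<ge> 1" using 3(2) by linarith
      have "(?N + 1) * 4 / ln (real D) \<le> (2 * ?N) * 4 / (ln (real X) / 160)"
        by (rule frac_le) (use N1 lnX lnD in auto)
      also have "\<dots> = ?N * (1280 / ln (real X))" by simp
      finally have 2: "(?N + 1) * 4 / ln (real D) \<le> ?N * (1280 / ln (real X))" .
      have "?B \<le> real D + (?N + 1) * 4 / ln (real D) + real D ^ 4"
        by (rule card_primes_AP_sieve[OF D(3) d half])
      also have "\<dots> \<le> ?N * (1 / ln (real X)) + ?N * (1280 / ln (real X))" using 1 2 by linarith
      also have "\<dots> = ?N * (1281 / ln (real X))" by (simp add: field_simps)
      also have "\<dots> \<le> ?N * (C / ln (real X))"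
        using lnX N0 by (intro mult_left_mono divide_right_mono) (auto simp: C_def)
      finally show ?thesis using rhs powr_ge_zero[of "real X" "1/10"] by linarith
    qed
  qed (auto simp: C_def)
qed

section \<open>Theorems of Chebyshev and Mertens\<close>

lemma finite_primes_upto: "finite {p::nat. prime p \<and> p \<le> X}"
  by (rule finite_subset[of _ "{..X}"]) auto

lemma finite_primes_upto': "finite {p::nat. prime p \<and> p \<le> X \<and> Q p}"
  by (rule finite_subset[of _ "{..X}"]) auto

text \<open>The sieve bound with d = 1 already yields the correct order X / ln X for the number of
  primes; each of them contributes at most ln X.\<close>

lemma chebyshev_theta_le:
  "\<exists>C\<ge>1. \<forall>X::nat. (\<Sum>p | prime p \<and> p \<le> X. ln (real p)) \<le> C * real X"
proof -
  obtain C where C: "C \<ge> 1" and bt: "\<And>X d. X \<ge> 2 \<Longrightarrow> d > 0 \<Longrightarrow> prime_recip d \<le> 1/2 \<Longrightarrow>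
     real (card (primes_AP X d)) \<le> C * real X / (real d * ln (real X)) + real X powr (1/10)"
    using brun_titchmarsh by blast
  have "(\<Sum>p | prime p \<and> p \<le> X. ln (real p)) \<le> (C + 10) * real X" for X :: nat
  proof (cases "X \<ge> 2")
    case True
    have no: "prime_recip 1 \<le> 1/2"
    proof -
      have "{q::nat. prime q \<and> q dvd 1} = {}" using not_prime_1 by auto
      thus ?thesis by (simp only: sum.empty)
    qed
    have lnX: "ln (real X) > 0" using True by simp
    have "(\<Sum>p | prime p \<and> p \<le> X. ln (real p)) \<le> (\<Sum>p | prime p \<and> p \<le> X. ln (real X))"
    proof (rule sum_mono)
      fix p assume "p \<in> {p. prime p \<and> p \<le> X}"
      thus "ln (real p) \<le> ln (real X)" using prime_gt_0_nat[of p] by simp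
    qed
    also have "\<dots> = real (card (primes_AP X 1)) * ln (real X)" by simp
    also have "\<dots> \<le> (C * real X / (real 1 * ln (real X)) + real X powr (1/10)) * ln (real X)"
      using lnX bt[OF True _ no] by (intro mult_right_mono) simp_all
    also have "\<dots> = C * real X + real X powr (1/10) * ln (real X)"
      using lnX by (simp add: distrib_right)
    also have "real X powr (1/10) * ln (real X) \<le> real X powr (1/10) * (10 * real X powr (1/10))"
    proof (rule mult_left_mono)
      have "ln (real X powr (1/10)) \<le> real X powr (1/10)"
        using True by (intro ln_bound) auto
      thus "ln (real X) \<le> 10 * real X powr (1/10)" using True by (simp add: ln_powr)
    qed simp
    also have "\<dots> = 10 * real X powr (1/5)" by (simp flip: powr_add)
    also have "\<dots> \<le> 10 * real X powr 1" using True by (intro mult_left_mono powr_mono) auto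
    finally show ?thesis using True by (simp add: algebra_simps)
  next
    case False
    have "\<not> (prime p \<and> p \<le> X)" for p
      using prime_ge_2_nat[of p] False by linarith
    hence "{p::nat. prime p \<and> p \<le> X} = {}" by blast
    hence "(\<Sum>p | prime p \<and> p \<le> X. ln (real p)) = 0" by (simp only: sum.empty)
    thus ?thesis using C by simp
  qed
  thus ?thesis using C by (intro exI[of _ "C + 10"]) auto
qed

text \<open>Expand each ln m as the sum of the Mangoldt function over the divisors of m and count
  the multiples of d up to n.\<close>

lemma ln_fact_eq_mangoldt_sum: "ln (fact n :: real) = (\<Sum>d=1..n. mangoldt d * real (n div d))"
proof -
  have "ln (fact n :: real) = (\<Sum>m=1..n. ln (real m))"
    by (induction n) (auto simp: ln_mult)
  also have "\<dots> = (\<Sum>m=1..n. \<Sum>d=1..n. if d dvd m then mangoldt d else 0)"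
  proof (rule sum.cong)
    fix m assume m: "m \<in> {1..n}"
    have "ln (real m) = (\<Sum>d | d dvd m. mangoldt d)"
      using mangoldt_sum[of m, where ?'a = real] m by simp
    also have "\<dots> = (\<Sum>d=1..n. if d dvd m then mangoldt d else 0)"
    proof (rule sum.mono_neutral_cong_left)
      show "{d. d dvd m} \<subseteq> {1..n}"
      proof
        fix d assume "d \<in> {d. d dvd m}"
        thus "d \<in> {1..n}" using m dvd_imp_le[of d m] by (auto intro!: Nat.gr0I simp: Suc_le_eq)
      qed
    qed auto
    finally show "ln (real m) = (\<Sum>d=1..n. if d dvd m then mangoldt d else 0)" .
  qed simp
  also have "\<dots> = (\<Sum>d=1..n. \<Sum>m=1..n. if d dvd m then mangoldt d else 0)" by (rule sum.swap)
  also have "\<dots> = (\<Sum>d=1..n. mangoldt d * real (n div d))"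
  proof (rule sum.cong)
    fix d assume d: "d \<in> {1..n}"
    have "{m\<in>{1..n}. d dvd m} = (\<lambda>j. d * j) ` {1..n div d}"
    proof (intro equalityI subsetI)
      fix m assume m: "m \<in> {m\<in>{1..n}. d dvd m}"
      then obtain j where j: "m = d * j" by auto
      have "j * d \<le> n" "j \<ge> 1" using m j by (auto simp: mult.commute intro!: Suc_leI Nat.gr0I)
      thus "m \<in> (\<lambda>j. d * j) ` {1..n div d}"
        using j d by (auto simp: less_eq_div_iff_mult_less_eq)
    next
      fix m assume "m \<in> (\<lambda>j. d * j) ` {1..n div d}"
      then obtain j where j': "m = d * j" "j \<in> {1..n div d}" by blast
      hence j: "m = d * j" "j \<ge> 1" "j \<le> n div d" by simp_all
      have "d * j \<le> n" using j(3) d by (simp add: less_eq_div_iff_mult_less_eq mult.commute)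
      thus "m \<in> {m\<in>{1..n}. d dvd m}" using j d by simp
    qed
    moreover have "inj_on (\<lambda>j. d * j) {1..n div d}" using d by (auto intro!: inj_onI)
    ultimately have "card {m\<in>{1..n}. d dvd m} = n div d" by (simp add: card_image)
    moreover have "(\<Sum>m=1..n. if d dvd m then mangoldt d else 0) = real (card {m\<in>{1..n}. d dvd m}) * mangoldt d"
      by (simp add: sum.If_cases Int_def)
    ultimately show "(\<Sum>m=1..n. if d dvd m then mangoldt d else 0) = mangoldt d * real (n div d)" by simp
  qed simp
  finally show ?thesis .
qed

lemma ln_fact_ge: "real n * ln (real n) - real n \<le> ln (fact n :: real)"
proof (induction n)
  case (Suc n)
  show ?case
  proof (cases "n = 0")
    case False
    have "ln (real (Suc n)) - ln (real n) \<le> 1 / real n"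
      using ln_diff_le[of "real (Suc n)" "real n"] False by simp
    hence "real n * (ln (real (Suc n)) - ln (real n)) \<le> real n * (1 / real n)"
      by (intro mult_left_mono) auto
    hence "real n * ln (real (Suc n)) - real n * ln (real n) \<le> 1" using False by (simp add: right_diff_distrib)
    moreover have "ln (fact (Suc n) :: real) = ln (real (Suc n)) + ln (fact n)"
      by (simp add: ln_mult del: of_nat_Suc)
    moreover have "real (Suc n) * ln (real (Suc n)) = real n * ln (real (Suc n)) + ln (real (Suc n))"
      by (simp add: distrib_right)
    moreover have "real (Suc n) = real n + 1" by simp
    ultimately show ?thesis using Suc by linarith
  qed simp
qed simp

lemma ln_fact_le: "ln (fact n :: real) \<le> real n * ln (real n)"
proof (cases "n = 0")
  case False
  have "ln (fact n :: real) \<le> ln (real n ^ n)"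
    using fact_le_power[of n, where ?'a = real] False by (intro ln_mono) auto
  thus ?thesis using False by (simp add: ln_realpow)
qed simp

abbreviation nonprime_mangoldt_sum :: "nat \<Rightarrow> real" where
  "nonprime_mangoldt_sum N \<equiv> \<Sum>d | d \<in> {1..N} \<and> \<not> prime d. mangoldt d / real d"

text \<open>Only powers q^k with k \<ge> 2 contribute. The geometric series over k is at most 2 /
  q^2 and ln q \<le> 2 q^(1/2), so the sum over all integers q is dominated by that of 4
  q^(-3/2).\<close>

lemma mangoldt_nonprime_sum_bounded:
  "\<exists>C\<ge>0. \<forall>N::nat. nonprime_mangoldt_sum N \<le> (C::real)"
proof -
  define f where "f q = 4 * real q powr (-3/2)" for q :: nat
  have summ: "summable f" unfolding f_def
    by (intro summable_mult) (simp add: summable_real_powr_iff)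
  have bound: "nonprime_mangoldt_sum N \<le> suminf f" for N :: nat
  proof -
    let ?S = "{d. d \<in> {1..N} \<and> \<not> prime d}"
    have "(\<Sum>d\<in>?S. mangoldt d / real d) = (\<Sum>d | d \<in> ?S \<and> primepow d. mangoldt d / real d)"
      by (rule sum.mono_neutral_right) (auto simp: mangoldt_def)
    also have "\<dots> \<le> (\<Sum>(q, k)\<in>{2..N} \<times> {2..N}. ln (real q) * (1 / real q ^ k))"
    proof (rule sum_le_included[where i = "\<lambda>(q, k). q ^ k"])
      show "\<forall>d\<in>{d. d \<in> ?S \<and> primepow d}. \<exists>y\<in>{2..N} \<times> {2..N}. (case y of (q, k) \<Rightarrow> q ^ k) = d \<and>
              mangoldt d / real d \<le> (case y of (q, k) \<Rightarrow> ln (real q) * (1 / real q ^ k))"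
      proof
        fix d assume d: "d \<in> {d. d \<in> ?S \<and> primepow d}"
        then obtain q k where qk: "prime q" "k > 0" "d = q ^ k" by (auto simp: primepow_def)
        have k2: "k \<ge> 2" using qk d by (cases "k = 1") auto
        have q2: "q \<ge> 2" using qk prime_ge_2_nat by blast
        have "q \<le> q ^ k" using q2 qk(2) self_le_power[of q k] by simp
        moreover have "k < q ^ k" using q2 by (intro power_gt_expt) auto
        moreover have "q ^ k \<le> N" using d qk by auto
        ultimately have "(q, k) \<in> {2..N} \<times> {2..N}" using q2 k2 by simp
        moreover have "mangoldt d / real d = ln (real q) * (1 / real q ^ k)"
          using qk by simp
        ultimately show "\<exists>y\<in>{2..N} \<times> {2..N}. (case y of (q, k) \<Rightarrow> q ^ k) = d \<and>
              mangoldt d / real d \<le> (case y of (q, k) \<Rightarrow> ln (real q) * (1 / real q ^ k))"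
          using qk(3) by (intro bexI[of _ "(q, k)"]) simp_all
      qed
    qed (auto intro!: mult_nonneg_nonneg)
    also have "\<dots> = (\<Sum>q=2..N. \<Sum>k=2..N. ln (real q) * (1 / real q ^ k))"
      by (rule sum.cartesian_product[symmetric])
    also have "\<dots> \<le> (\<Sum>q=2..N. f q)"
    proof (rule sum_mono)
      fix q assume q: "q \<in> {2..N}"
      \<comment> \<open>The subtracted last term is what lets the induction close: each step needs
        only 2 / q^(n+1) \<le> 1 / q^n.\<close>
      have "(\<Sum>k=2..N. 1 / real q ^ k) \<le> 2 / real q ^ 2 - (1 / real q ^ N)" if "N \<ge> 2"
        using that
      proof (induction N rule: dec_induct)
        case (step n)
        have "1 / real q ^ Suc n = 1 / real q ^ n * (1 / real q)" by simp
        also have "\<dots> \<le> 1 / real q ^ n * (1 / 2)"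
          using q by (intro mult_left_mono divide_left_mono) auto
        finally have "2 * (1 / real q ^ Suc n) \<le> 1 / real q ^ n" by simp
        moreover have "(\<Sum>k=2..Suc n. 1 / real q ^ k) = (\<Sum>k=2..n. 1 / real q ^ k) + 1 / real q ^ Suc n"
          using step(1) by (intro sum.cl_ivl_Suc[THEN trans]) auto
        ultimately show ?case using step.IH by linarith
      qed simp
      moreover have "1 / real q ^ N \<ge> 0" by simp
      ultimately have geo: "(\<Sum>k=2..N. 1 / real q ^ k) \<le> 2 / real q ^ 2"
        by (cases "N \<ge> 2") (linarith, simp)
      have "ln (real q) \<le> 2 * real q powr (1/2)"
      proof -
        have "ln (real q powr (1/2)) \<le> real q powr (1/2)" using q by (intro ln_bound) auto
        thus ?thesis using q by (simp add: ln_powr)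
      qed
      hence "ln (real q) * (\<Sum>k=2..N. 1 / real q ^ k) \<le> 2 * real q powr (1/2) * (2 / real q ^ 2)"
        using geo q by (intro mult_mono) (auto intro!: sum_nonneg)
      also have "\<dots> = f q"
      proof -
        have "real q powr (1/2) / real q powr 2 = real q powr (1/2 - 2)" by (rule powr_diff[symmetric])
        thus ?thesis using q by (simp add: f_def)
      qed
      finally show "(\<Sum>k=2..N. ln (real q) * (1 / real q ^ k)) \<le> f q" by (simp only: sum_distrib_left)
    qed
    also have "\<dots> \<le> suminf f" by (rule sum_le_suminf[OF summ]) (auto simp: f_def)
    finally show ?thesis .
  qed
  moreover have "suminf f \<ge> 0" by (rule suminf_nonneg[OF summ]) (simp add: f_def)
  ultimately show ?thesis by blast
qed

definition mertens_sum :: "nat \<Rightarrow> real" where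
  "mertens_sum n = (\<Sum>p | prime p \<and> p \<le> n. ln (real p) / real p)"

text \<open>Both directions compare n times the sum with ln n!. From above, replacing n / p by its
  integer part costs at most the sum of ln p over p \<le> n, which is O(n); from below, the error
  consists of the higher prime powers, whose sum is bounded.\<close>

lemma mertens_first: "\<exists>C\<ge>0. \<forall>n\<ge>1. \<bar>mertens_sum n - ln (real n)\<bar> \<le> C"
proof -
  obtain C where C: "C \<ge> 1" "\<And>X::nat. (\<Sum>p | prime p \<and> p \<le> X. ln (real p)) \<le> C * real X"
    using chebyshev_theta_le by blast
  obtain C0 where C0: "C0 \<ge> 0" "\<And>N::nat. nonprime_mangoldt_sum N \<le> (C0::real)"
    using mangoldt_nonprime_sum_bounded by blast
  have "\<bar>mertens_sum n - ln (real n)\<bar> \<le> C + C0 + 1" if n: "n \<ge> 1" for n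
  proof -
    have sub: "{p. prime p \<and> p \<le> n} \<subseteq> {1..n}" using prime_ge_1_nat by auto
    have "real n * mertens_sum n \<le> (\<Sum>p | prime p \<and> p \<le> n. ln (real p) * real (n div p) + ln (real p))"
      unfolding mertens_sum_def sum_distrib_left
    proof (rule sum_mono)
      fix p assume p: "p \<in> {p. prime p \<and> p \<le> n}"
      hence p1: "p \<ge> 1" using sub by auto
      have "real n / real p \<le> real (n div p) + 1"
        using floor_divide_of_nat_eq[of n p, where ?'a = real] by linarith
      hence "ln (real p) * (real n / real p) \<le> ln (real p) * (real (n div p) + 1)"
        using p1 by (intro mult_left_mono) auto
      thus "real n * (ln (real p) / real p) \<le> ln (real p) * real (n div p) + ln (real p)"
        by (simp add: distrib_left mult.commute)
    qed
    also have "\<dots> = (\<Sum>p | prime p \<and> p \<le> n. mangoldt p * real (n div p)) + (\<Sum>p | prime p \<and> p \<le> n. ln (real p))"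
      by (simp add: sum.distrib)
    also have "(\<Sum>p | prime p \<and> p \<le> n. mangoldt p * real (n div p)) \<le> (\<Sum>d=1..n. mangoldt d * real (n div d))"
      by (rule sum_mono2) (use sub in \<open>auto intro!: mult_nonneg_nonneg mangoldt_nonneg\<close>)
    also have "\<dots> = ln (fact n)" by (rule ln_fact_eq_mangoldt_sum[symmetric])
    also have "\<dots> \<le> real n * ln (real n)" by (rule ln_fact_le)
    also have "(\<Sum>p | prime p \<and> p \<le> n. ln (real p)) \<le> C * real n" by (rule C(2))
    finally have "real n * mertens_sum n \<le> real n * (ln (real n) + C)" by (simp add: algebra_simps)
    hence up: "mertens_sum n \<le> ln (real n) + C" using n by simp

    have "real n * ln (real n) - real n \<le> (\<Sum>d=1..n. mangoldt d * real (n div d))"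
      using ln_fact_ge[of n] ln_fact_eq_mangoldt_sum[of n] by simp
    also have "\<dots> \<le> (\<Sum>d=1..n. real n * (mangoldt d / real d))"
    proof (rule sum_mono)
      fix d assume d: "d \<in> {1..n}"
      have "mangoldt d * real (n div d) \<le> mangoldt d * (real n / real d)"
        by (intro mult_left_mono of_nat_div_le_of_nat mangoldt_nonneg)
      thus "mangoldt d * real (n div d) \<le> real n * (mangoldt d / real d)" by (simp add: mult.commute)
    qed
    also have "\<dots> = real n * (\<Sum>d=1..n. mangoldt d / real d)" by (simp only: sum_distrib_left)
    also have "(\<Sum>d=1..n. mangoldt d / real d) =
      (\<Sum>d | d \<in> {1..n} \<and> prime d. mangoldt d / real d) + nonprime_mangoldt_sum n"
      by (subst sum.union_disjoint[symmetric]) (auto intro!: sum.cong)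
    also have "(\<Sum>d | d \<in> {1..n} \<and> prime d. mangoldt d / real d) = mertens_sum n"
      unfolding mertens_sum_def by (rule sum.cong) (use sub in auto)
    finally have "real n * (ln (real n) - 1) \<le> real n * (mertens_sum n + nonprime_mangoldt_sum n)"
      by (simp add: right_diff_distrib)
    hence "ln (real n) - 1 \<le> mertens_sum n + nonprime_mangoldt_sum n"
      using n by simp
    hence "ln (real n) - 1 \<le> mertens_sum n + C0" using C0(2)[of n] by linarith
    thus ?thesis using up C(1) C0(1) by linarith
  qed
  thus ?thesis using C(1) C0(1) by (intro exI[of _ "C + C0 + 1"]) auto
qed

abbreviation window_sum :: "real \<Rightarrow> real \<Rightarrow> real" where
  "window_sum a b \<equiv> \<Sum>p | prime p \<and> a \<le> real p \<and> real p \<le> b. ln (real p) / real p"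

lemma mertens_window:
  "\<exists>C\<ge>0. \<forall>a b::real. 0 < a \<longrightarrow> a \<le> b \<longrightarrow>
     window_sum a b \<le> ln (b / a) + C"
proof -
  obtain C where C: "C \<ge> 0" "\<And>n. n \<ge> 1 \<Longrightarrow> \<bar>mertens_sum n - ln (real n)\<bar> \<le> C"
    using mertens_first by blast
  have "window_sum a b \<le> ln (b / a) + (2 * C + 1)"
    if ab: "0 < a" "a \<le> b" for a b :: real
  proof (cases "b < 1")
    case True
    have "\<not> (prime p \<and> a \<le> real p \<and> real p \<le> b)" for p
      using True prime_ge_1_nat[of p] by auto
    hence "{p. prime p \<and> a \<le> real p \<and> real p \<le> b} = {}" by blast
    hence "window_sum a b = 0" by (simp only: sum.empty)
    moreover have "ln (b / a) \<ge> 0" using ab by simp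
    ultimately show ?thesis using C(1) by simp
  next
    case False
    define n where "n = nat \<lfloor>b\<rfloor>"
    have n: "n \<ge> 1" "real n \<le> b" "b < real n + 1" using False unfolding n_def by linarith+
    have le_n: "real p \<le> b \<longleftrightarrow> p \<le> n" for p using n by linarith
    have upn: "mertens_sum n \<le> ln b + C"
    proof -
      have "ln (real n) \<le> ln b" using n by (intro ln_mono) auto
      thus ?thesis using C(2)[OF n(1)] by linarith
    qed
    show ?thesis
    proof (cases "a \<le> 1")
      case True
      have "window_sum a b \<le> mertens_sum n"
        unfolding mertens_sum_def
        by (rule sum_mono2[OF finite_primes_upto]) (use le_n prime_ge_1_nat in \<open>auto intro!: divide_nonneg_nonneg ln_ge_zero\<close>)
      moreover have "ln b \<le> ln (b / a)" using True ab False by (intro ln_mono) (auto simp: field_simps)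
      ultimately show ?thesis using upn C(1) by linarith
    next
      case a1: False
      \<comment> \<open>The largest integer strictly below a, because the window is closed at a.
        From a \<le> m + 1 \<le> 2 m the loss is at most ln 2.\<close>
      define m where "m = nat (\<lceil>a\<rceil> - 1)"
      have m: "m \<ge> 1" "real m < a" "a \<le> real m + 1" using a1 unfolding m_def by linarith+
      have ge_m: "a \<le> real p \<longleftrightarrow> m < p" for p using m by linarith
      have mn: "m \<le> n" using m n ab by linarith
      have "mertens_sum n = mertens_sum m + window_sum a b"
        unfolding mertens_sum_def le_n ge_m
        by (subst sum.union_disjoint[symmetric])
           (use mn in \<open>auto intro!: sum.cong finite_primes_upto finite_subset[OF _ finite_primes_upto[of n]]\<close>)
      moreover have "mertens_sum m \<ge> ln (a / 2) - C"
      proof -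
        have "ln (a / 2) \<le> ln (real m)" using m(2,3) a1 of_nat_mono[OF m(1), where ?'a = real] by (intro ln_mono) linarith+
        thus ?thesis using C(2)[OF m(1)] by linarith
      qed
      moreover have "ln (a / 2) = ln a - ln 2" using ab by (simp add: ln_div)
      moreover have "ln (b / a) = ln b - ln a" using ab by (simp add: ln_div)
      moreover have "ln (2::real) \<le> 1" using ln_2_less_1 by simp
      ultimately show ?thesis using upn by linarith
    qed
  qed
  thus ?thesis using C(1) by (intro exI[of _ "2 * C + 1"]) auto
qed

lemma mertens_second:
  "\<exists>C\<ge>0. \<forall>a b::real. 2 \<le> a \<longrightarrow> a \<le> b \<longrightarrow>
     (\<Sum>p | prime p \<and> a < real p \<and> real p \<le> b. 1 / real p) \<le> ln (ln b / ln a) + C"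
proof -
  obtain C where C: "C \<ge> 0" "\<And>n. n \<ge> 1 \<Longrightarrow> \<bar>mertens_sum n - ln (real n)\<bar> \<le> C"
    using mertens_first by blast
  define E where "E n = mertens_sum n - ln (real n)" for n
  have step: "mertens_sum (Suc n) = mertens_sum n + (if prime (Suc n) then ln (real (Suc n)) / real (Suc n) else 0)" for n
  proof -
    have "{p. prime p \<and> p \<le> Suc n} = {p. prime p \<and> p \<le> n} \<union> (if prime (Suc n) then {Suc n} else {})"
      by (auto simp: le_Suc_eq)
    thus ?thesis unfolding mertens_sum_def
      by (simp add: finite_primes_upto del: of_nat_Suc)
  qed
  define S where "S m n = (\<Sum>p | prime p \<and> m < p \<and> p \<le> n. 1 / real p)" for m n :: nat
  have stepS: "S m (Suc n) = S m n + (if prime (Suc n) then 1 / real (Suc n) else 0)" if "m \<le> n" for m n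
  proof -
    have eq: "{p. prime p \<and> m < p \<and> p \<le> Suc n} = {p. prime p \<and> m < p \<and> p \<le> n} \<union> (if prime (Suc n) then {Suc n} else {})"
      using that by (auto simp: le_Suc_eq)
    have "finite {p. prime p \<and> m < p \<and> p \<le> n}" by (rule finite_subset[of _ "{..n}"]) auto
    thus ?thesis unfolding S_def eq by (simp del: of_nat_Suc)
  qed
  \<comment> \<open>Partial summation in the form of an induction on n. The increment of the main
    term, (l' - l) / l' with l = ln n and l' = ln (n + 1), is at most ln l' - ln l; the quotient
    \<open>E n / ln n\<close> telescopes up to \<open>E n * (1 / l - 1 / l')\<close>, and the
    bracket with C collects these remainders.\<close>
  have nat_bound: "S m n \<le> E n / ln (real n) + ln (ln (real n)) - ln (ln (real m)) + C * (2 / ln (real m) - 1 / ln (real n))"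
    if "m \<le> n" "m \<ge> 2" for m n
    using that(1)
  proof (induction n rule: dec_induct)
    case base
    have "{p. prime p \<and> m < p \<and> p \<le> m} = {}" by auto
    hence "S m m = 0" unfolding S_def by (simp only: sum.empty)
    moreover have "- C / ln (real m) \<le> E m / ln (real m)"
      using C(2)[of m] that(2) by (intro divide_right_mono) (auto simp: E_def)
    ultimately show ?case by (simp add: right_diff_distrib)
  next
    case (step n)
    let ?l = "ln (real n)" and ?l' = "ln (real (Suc n))"
    have n2: "n \<ge> 2" using step that by simp
    have l: "?l > 0" "?l' > 0" "?l \<le> ?l'" using n2 by auto
    have "(if prime (Suc n) then 1 / real (Suc n) else 0) = (mertens_sum (Suc n) - mertens_sum n) / ?l'"
      using \<open>\<And>n. mertens_sum (Suc n) = _\<close> l by (simp del: of_nat_Suc)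
    also have "\<dots> = E (Suc n) / ?l' - E n / ?l' + (?l' - ?l) / ?l'"
      by (simp add: E_def diff_divide_distrib add_divide_distrib del: of_nat_Suc)
    also have "(?l' - ?l) / ?l' \<le> ln ?l' - ln ?l"
      using ln_diff_le[of ?l ?l'] l by (simp add: diff_divide_distrib del: of_nat_Suc)
    finally have 1: "(if prime (Suc n) then 1 / real (Suc n) else 0) \<le> E (Suc n) / ?l' - E n / ?l' + (ln ?l' - ln ?l)" by simp
    have "E n * (1 / ?l - 1 / ?l') \<le> C * (1 / ?l - 1 / ?l')"
    proof (rule mult_right_mono)
      show "E n \<le> C" using C(2)[of n] n2 by (auto simp: E_def)
      show "0 \<le> 1 / ?l - 1 / ?l'" using l by (simp add: frac_le del: of_nat_Suc)
    qed
    hence 2: "E n / ?l - E n / ?l' \<le> C * (1 / ?l) - C * (1 / ?l')"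
      by (simp add: right_diff_distrib del: of_nat_Suc)
    have "S m (Suc n) = S m n + (if prime (Suc n) then 1 / real (Suc n) else 0)" by (rule stepS) (use step in simp)
    also have "\<dots> \<le> (E n / ?l + ln ?l - ln (ln (real m)) + C * (2 / ln (real m) - 1 / ?l)) + 
                     (E (Suc n) / ?l' - E n / ?l' + (ln ?l' - ln ?l))"
      using 1 step.IH by linarith
    also have "\<dots> \<le> E (Suc n) / ?l' + ln ?l' - ln (ln (real m)) + C * (2 / ln (real m) - 1 / ?l')"
      using 2 by (simp only: right_diff_distrib)
    finally show ?case .
  qed
  have "(\<Sum>p | prime p \<and> a < real p \<and> real p \<le> b. 1 / real p) \<le> ln (ln b / ln a) + (4 * C + 1)"
    if ab: "2 \<le> a" "a \<le> b" for a b :: real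
  proof -
    define m where "m = nat \<lfloor>a\<rfloor>"
    define n where "n = nat \<lfloor>b\<rfloor>"
    have m: "m \<ge> 2" "real m \<le> a" "a < real m + 1" using ab unfolding m_def by linarith+
    have n: "m \<le> n" "real n \<le> b" "b < real n + 1" using ab unfolding m_def n_def by linarith+
    have iff: "a < real p \<and> real p \<le> b \<longleftrightarrow> m < p \<and> p \<le> n" for p using m n by linarith
    have lm: "ln (real m) > 0" using m by simp
    have lnm: "ln (real m) \<ge> 1 / 2"
    proof -
      have "ln (2::real) \<le> ln (real m)" using m by (intro ln_mono) auto
      thus ?thesis using half_le_ln_2 by linarith
    qed
    have ln0: "ln (real n) > 0" using m n by simp
    have "E n / ln (real n) \<le> C / ln (real n)"
      using C(2)[of n] ln0 m n by (intro divide_right_mono) (auto simp: E_def)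
    hence "S m n \<le> ln (ln (real n)) - ln (ln (real m)) + C * (2 / ln (real m))" (is "_ \<le> _ - _ + ?c")
      using nat_bound[OF n(1) m(1)] by (simp add: right_diff_distrib)
    moreover have "?c \<le> C * 4"
      using C(1) lnm lm by (intro mult_left_mono) (auto simp: field_simps)
    moreover have "ln (ln (real n)) \<le> ln (ln b)" using ln0 n m by (intro ln_mono) auto
    moreover have "ln (ln a) - 1 \<le> ln (ln (real m))"
    proof -
      have "a \<le> real m * real m"
      proof -
        have "real m * 2 \<le> real m * real m" using m by (intro mult_left_mono) auto
        thus ?thesis using m by linarith
      qed
      hence "ln a \<le> ln (real m * real m)" using ab m by (intro ln_mono) auto
      also have "\<dots> = 2 * ln (real m)" using m by (simp add: ln_mult)
      finally have "ln (ln a) \<le> ln (2 * ln (real m))" using ab lm by (intro ln_mono) auto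
      also have "\<dots> = ln 2 + ln (ln (real m))" using lm by (simp add: ln_mult)
      finally show ?thesis using ln_2_less_1 by linarith
    qed
    ultimately have "S m n \<le> ln (ln b) - ln (ln a) + (4 * C + 1)" by linarith
    moreover have "ln (ln b / ln a) = ln (ln b) - ln (ln a)" using ab by (simp add: ln_div)
    ultimately show ?thesis unfolding iff S_def by simp
  qed
  thus ?thesis using C(1) by (intro exI[of _ "4 * C + 1"]) auto
qed

abbreviation smooth_mangoldt_sum :: "real \<Rightarrow> nat \<Rightarrow> real" where
  "smooth_mangoldt_sum z N \<equiv> \<Sum>d | d \<in> {1..N} \<and> real (aprimedivisor d) \<le> z. mangoldt d / real d"

text \<open>On prime powers, the support of \<open>mangoldt\<close>, \<open>aprimedivisor\<close> is
  the base. The primes up to z give ln z + O(1) and the higher powers a bounded amount, so the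
  estimate is uniform in N.\<close>

lemma mangoldt_smooth_sum_le:
  "\<exists>C\<ge>0. \<forall>(z::real) N. z \<ge> 1 \<longrightarrow> smooth_mangoldt_sum z N \<le> ln z + C"
proof -
  obtain C where C: "C \<ge> 0" "\<And>a b. 0 < a \<Longrightarrow> a \<le> b \<Longrightarrow>
     window_sum a b \<le> ln (b / a) + C"
    using mertens_window by blast
  obtain C0 where C0: "C0 \<ge> 0" "\<And>N::nat. nonprime_mangoldt_sum N \<le> (C0::real)"
    using mangoldt_nonprime_sum_bounded by blast
  have "smooth_mangoldt_sum z N \<le> ln z + (C + C0)" if z: "z \<ge> 1" for z :: real and N :: nat
  proof -
    have fin: "finite {p::nat. prime p \<and> 1 \<le> real p \<and> real p \<le> z}"
      by (rule finite_subset[of _ "{..nat \<lfloor>z\<rfloor>}"]) (auto simp: le_nat_floor)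
    have "smooth_mangoldt_sum z N \<le>
          (\<Sum>d\<in>{d. prime d \<and> 1 \<le> real d \<and> real d \<le> z} \<union> {d. d \<in> {1..N} \<and> \<not> prime d}. mangoldt d / real d)"
      by (rule sum_mono2) (use fin in \<open>auto intro!: divide_nonneg_nonneg mangoldt_nonneg\<close>)
    also have "\<dots> = (\<Sum>d | prime d \<and> 1 \<le> real d \<and> real d \<le> z. mangoldt d / real d) + nonprime_mangoldt_sum N"
      by (rule sum.union_disjoint) (use fin in auto)
    also have "(\<Sum>d | prime d \<and> 1 \<le> real d \<and> real d \<le> z. mangoldt d / real d) = (\<Sum>d | prime d \<and> 1 \<le> real d \<and> real d \<le> z. ln (real d) / real d)"
      by (rule sum.cong) auto
    also have "\<dots> \<le> ln (z / 1) + C" by (rule C(2)) (use z in auto)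
    finally show ?thesis using C0(2)[of N] by simp
  qed
  thus ?thesis using C(1) C0(1) by (intro exI[of _ "C + C0"]) auto
qed

section \<open>Rough and smooth parts of shifted primes\<close>

text \<open>\<open>smooth_log z n\<close> is the logarithm of the largest divisor of \<open>n\<close> without prime factors above \<open>z\<close>.\<close>

definition smooth_log :: "real \<Rightarrow> nat \<Rightarrow> real" where
  "smooth_log z n = (\<Sum>d | d dvd n \<and> real (aprimedivisor d) \<le> z. mangoldt d)"

lemma smooth_log_mono:
  assumes "m dvd n" "n > 0"
  shows "smooth_log z m \<le> smooth_log z n"
  unfolding smooth_log_def
proof (rule sum_mono2)
  show "finite {d. d dvd n \<and> real (aprimedivisor d) \<le> z}"
    by (rule finite_subset[of _ "{d. d dvd n}"]) (use assms in auto)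
qed (use assms in \<open>auto intro: mangoldt_nonneg dvd_trans\<close>)

lemma smooth_log_nonneg: "smooth_log z n \<ge> 0"
  unfolding smooth_log_def by (intro sum_nonneg mangoldt_nonneg)

lemma finite_prime_divisors: "n > 0 \<Longrightarrow> finite {q::nat. prime q \<and> Q q \<and> q dvd n}"
  by (rule finite_subset[of _ "{d. d dvd n}"]) auto

text \<open>Split ln n, the sum of the Mangoldt function over the divisors of n, by the base of the
  prime power. Since no square of a number q > z that is prime divides n, the powers with large base
  that occur are primes.\<close>

lemma ln_eq_smooth_log_plus:
  assumes n: "n > 0" and sqf: "\<And>q. prime q \<Longrightarrow> real q > z \<Longrightarrow> \<not> q ^ 2 dvd n"
  shows "ln (real n) = smooth_log z n + (\<Sum>q | prime q \<and> real q > z \<and> q dvd n. ln (real q))"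
proof -
  have fin: "finite {d. d dvd n}" using n by simp
  have "ln (real n) = (\<Sum>d | d dvd n. mangoldt d)"
    using mangoldt_sum[of n, where ?'a = real] n by simp
  also have "{d. d dvd n} = {d. d dvd n \<and> real (aprimedivisor d) \<le> z} \<union> {d. d dvd n \<and> real (aprimedivisor d) > z}"
    by auto
  also have "(\<Sum>d\<in>\<dots>. mangoldt d) = smooth_log z n + (\<Sum>d | d dvd n \<and> real (aprimedivisor d) > z. mangoldt d)"
    unfolding smooth_log_def by (rule sum.union_disjoint) (use fin in auto)
  also have "(\<Sum>d | d dvd n \<and> real (aprimedivisor d) > z. mangoldt d) =
             (\<Sum>q | prime q \<and> real q > z \<and> q dvd n. mangoldt q :: real)"
  proof (rule sum.mono_neutral_right)
    show "finite {d. d dvd n \<and> real (aprimedivisor d) > z}"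
      by (rule finite_subset[OF _ fin]) auto
    show "{q. prime q \<and> z < real q \<and> q dvd n} \<subseteq> {d. d dvd n \<and> z < real (aprimedivisor d)}" by auto
    show "\<forall>d\<in>{d. d dvd n \<and> z < real (aprimedivisor d)} - {q. prime q \<and> z < real q \<and> q dvd n}. mangoldt d = (0::real)"
    proof
      fix d assume d: "d \<in> {d. d dvd n \<and> z < real (aprimedivisor d)} - {q. prime q \<and> z < real q \<and> q dvd n}"
      have "\<not> primepow d"
      proof
        assume "primepow d"
        then obtain q k where qk: "prime q" "k > 0" "d = q ^ k" by (auto simp: primepow_def)
        hence ap: "aprimedivisor d = q" by (simp add: aprimedivisor_prime_power)
        have "k \<noteq> 1" using d qk ap by auto
        hence "q ^ 2 dvd d" unfolding qk(3) using qk(2) by (intro le_imp_power_dvd) simp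
        hence "q ^ 2 dvd n" using d dvd_trans by blast
        thus False using sqf[OF qk(1)] d ap by auto
      qed
      thus "mangoldt d = (0::real)" by (simp add: mangoldt_def)
    qed
  qed
  also have "\<dots> = (\<Sum>q | prime q \<and> real q > z \<and> q dvd n. ln (real q))"
    by (rule sum.cong) auto
  finally show ?thesis .
qed

text \<open>As in the sieve, a set \<open>A \<subseteq> rough_primes \<delta> X\<close> stands for
  the squarefree integer \<open>\<Prod>A\<close>, with \<open>card A\<close> as its number of prime
  factors. The bound q \<le> X keeps the family of such sets finite.\<close>

definition rough_primes :: "real \<Rightarrow> nat \<Rightarrow> nat set" where
  "rough_primes \<delta> X = {q. prime q \<and> real X powr \<delta> < real q \<and> q \<le> X}"

lemma finite_rough_primes [simp]: "finite (rough_primes \<delta> X)"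
  unfolding rough_primes_def by (rule finite_subset[of _ "{..X}"]) auto

lemma rough_primes_prime: "q \<in> rough_primes \<delta> X \<Longrightarrow> prime q"
  by (simp add: rough_primes_def)

lemma rough_subset:
  assumes "A \<subseteq> rough_primes \<delta> X"
  shows "finite A" and "\<And>q. q \<in> A \<Longrightarrow> prime q" and "\<Prod>A > 0" and "real (\<Prod>A) > 0"
    and "{q. prime q \<and> q dvd \<Prod>A} = A" and "ln (real (\<Prod>A)) = (\<Sum>q\<in>A. ln (real q))"
proof -
  show fin: "finite A" using assms finite_rough_primes by (rule finite_subset)
  show pr: "\<And>q. q \<in> A \<Longrightarrow> prime q" using assms rough_primes_prime by blast
  show pos: "\<Prod>A > 0" using pr by (intro prod_pos) (auto simp: prime_gt_0_nat)
  thus "real (\<Prod>A) > 0" by (simp only: of_nat_0_less_iff)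
  show "{q. prime q \<and> q dvd \<Prod>A} = A"
  proof (intro equalityI subsetI)
    fix q assume "q \<in> {q. prime q \<and> q dvd \<Prod>A}"
    hence q: "prime q" "q dvd \<Prod>A" by auto
    hence "\<exists>r\<in>A. q dvd r" using prime_dvd_prod_iff[OF fin q(1), of "\<lambda>x. x"] by simp
    thus "q \<in> A" using pr q(1) primes_dvd_imp_eq by metis
  qed (use pr fin in \<open>auto intro: dvd_prodI\<close>)
  show "ln (real (\<Prod>A)) = (\<Sum>q\<in>A. ln (real q))"
    unfolding of_nat_prod by (rule ln_prod[OF fin]) (use pr prime_gt_0_nat in force)
qed

lemma rough_card_le:
  assumes "A \<subseteq> rough_primes \<delta> X" "\<Prod>A \<le> X" "\<delta> > 0" "X \<ge> 2"
  shows "real (card A) \<le> 1 / \<delta>"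
proof -
  have lnX: "ln (real X) > 0" using assms by simp
  have "real (card A) * (\<delta> * ln (real X)) = (\<Sum>q\<in>A. \<delta> * ln (real X))" by simp
  also have "\<dots> \<le> (\<Sum>q\<in>A. ln (real q))"
  proof (rule sum_mono)
    fix q assume "q \<in> A"
    hence "real X powr \<delta> \<le> real q" using assms(1) by (auto simp: rough_primes_def)
    hence "ln (real X powr \<delta>) \<le> ln (real q)" using assms(4) by (intro ln_mono) auto
    thus "\<delta> * ln (real X) \<le> ln (real q)" using assms(4) by (simp add: ln_powr)
  qed
  also have "\<dots> = ln (real (\<Prod>A))" using rough_subset(6)[OF assms(1)] by simp
  also have "\<dots> \<le> ln (real X)" using rough_subset(4)[OF assms(1)] assms(2) by (intro ln_mono of_nat_mono)
  finally have "real (card A) * \<delta> * ln (real X) \<le> 1 * ln (real X)" by simp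
  hence "real (card A) * \<delta> \<le> 1" using lnX by (rule mult_right_le_imp_le)
  thus ?thesis using assms(3) by (simp add: field_simps)
qed

abbreviation rough_recip :: "real \<Rightarrow> nat \<Rightarrow> real" where
  "rough_recip \<delta> X \<equiv> \<Sum>q\<in>rough_primes \<delta> X. 1 / real q"

text \<open>Between X^\<delta> and X the function ln ln grows by exactly ln (1 / \<delta>). C is
  chosen before \<delta>; only the threshold for X depends on \<delta>.\<close>

lemma rough_reciprocal_sum:
  "\<exists>C\<ge>0. \<forall>\<delta>. 0 < \<delta> \<longrightarrow> \<delta> < 1 \<longrightarrow>
     (\<forall>\<^sub>F X in sequentially. rough_recip \<delta> X \<le> ln (1 / \<delta>) + C)"
proof -
  obtain C where C: "C \<ge> 0" "\<And>a b::real. 2 \<le> a \<Longrightarrow> a \<le> b \<Longrightarrow>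
     (\<Sum>p | prime p \<and> a < real p \<and> real p \<le> b. 1 / real p) \<le> ln (ln b / ln a) + C"
    using mertens_second by blast
  have "\<forall>\<^sub>F X in sequentially. rough_recip \<delta> X \<le> ln (1 / \<delta>) + C" if \<delta>: "0 < \<delta>" "\<delta> < 1" for \<delta> :: real
  proof -
    have "\<forall>\<^sub>F X in sequentially. real X powr \<delta> \<ge> 2 \<and> real X \<ge> 2" using \<delta> by (intro eventually_conj; real_asymp)
    thus ?thesis
    proof eventually_elim
      case (elim X)
      have "rough_primes \<delta> X = {p. prime p \<and> real X powr \<delta> < real p \<and> real p \<le> real X}"
        by (auto simp: rough_primes_def)
      hence "rough_recip \<delta> X \<le> ln (ln (real X) / ln (real X powr \<delta>)) + C"
        using C(2)[of "real X powr \<delta>" "real X"] elim \<delta> powr_mono[of \<delta> 1 "real X"] by simp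
      also have "ln (real X) / ln (real X powr \<delta>) = 1 / \<delta>" using elim by (simp add: ln_powr)
      finally show ?case .
    qed
  qed
  thus ?thesis using C(1) by blast
qed

text \<open>The sum is the Euler product of the factors 1 + \<mu> / q, and 1 + t \<le> exp t.
  Together with the bound for the reciprocal sum the total weight is at most a constant times
  \<delta>^(- \<mu>), independently of X.\<close>

lemma rough_weight_sum_le:
  assumes "\<mu> \<ge> 0"
  shows "(\<Sum>A\<in>Pow (rough_primes \<delta> X). \<mu> ^ card A / real (\<Prod>A)) \<le> exp (\<mu> * rough_recip \<delta> X)"
proof -
  let ?P = "rough_primes \<delta> X"
  have "(\<Sum>A\<in>Pow ?P. \<mu> ^ card A / real (\<Prod>A)) = (\<Sum>A\<in>Pow ?P. \<Prod>q\<in>A. \<mu> / real q)"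
    by (simp add: prod_dividef)
  also have "\<dots> = (\<Prod>q\<in>?P. \<mu> / real q + 1)" by (subst prod_add) auto
  also have "\<dots> \<le> (\<Prod>q\<in>?P. exp (\<mu> / real q))"
    using assms by (intro prod_mono) (auto simp: add.commute intro!: exp_ge_add_one_self add_nonneg_nonneg)
  also have "\<dots> = exp (\<mu> * (\<Sum>q\<in>?P. 1 / real q))"
    by (simp add: exp_sum sum_distrib_left)
  finally show ?thesis .
qed

abbreviation rough_sieve_bound :: "real \<Rightarrow> real \<Rightarrow> bool" where
  "rough_sieve_bound \<delta> C \<equiv> \<forall>\<^sub>F X in sequentially. \<forall>A. A \<subseteq> rough_primes \<delta> X \<longrightarrow> real (\<Prod>A) \<le> real X powr (7/8) \<longrightarrow>
     real (card (primes_AP X (\<Prod>A))) \<le> C * real X / (real (\<Prod>A) * ln (real X))"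

text \<open>A has at most 1 / \<delta> members, each at least 2 / \<delta> for large X, so the
  reciprocals sum to at most 1/2 and the sieve constant is independent of \<delta>. The level
  X^(7/8) leaves X^(1/8) for the quotient, which absorbs X^(1/10) ln X.\<close>

lemma card_primes_rough_divisor:
  "\<exists>C\<ge>1. \<forall>\<delta>. 0 < \<delta> \<longrightarrow> \<delta> < 1 \<longrightarrow>
     rough_sieve_bound \<delta> C"
proof -
  obtain C where C: "C \<ge> 1" and bt: "\<And>X d. X \<ge> 2 \<Longrightarrow> d > 0 \<Longrightarrow> prime_recip d \<le> 1/2 \<Longrightarrow>
     real (card (primes_AP X d)) \<le> C * real X / (real d * ln (real X)) + real X powr (1/10)"
    using brun_titchmarsh by blast
  have "rough_sieve_bound \<delta> (C + 1)"
    if \<delta>: "0 < \<delta>" "\<delta> < 1" for \<delta> :: real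
  proof -
    have "\<forall>\<^sub>F X in sequentially. real X \<ge> 2 \<and> real X powr \<delta> \<ge> 2 / \<delta> \<and> real X powr (1/10) * ln (real X) \<le> real X powr (1/8)"
      using \<delta> by (intro eventually_conj; real_asymp)
    thus ?thesis
    proof eventually_elim
      case (elim X)
      hence X: "X \<ge> 2" "real X powr \<delta> \<ge> 2 / \<delta>" "real X powr (1/10) * ln (real X) \<le> real X powr (1/8)" by auto
      show ?case
      proof (intro allI impI)
        fix A assume A: "A \<subseteq> rough_primes \<delta> X" "real (\<Prod>A) \<le> real X powr (7/8)"
        let ?d = "\<Prod>A"
        note RA = rough_subset[OF A(1)]
        have lnX: "ln (real X) > 0" using X by simp
        have "real ?d \<le> real X powr 1"
          using A(2) powr_mono[of "7/8" 1 "real X"] X by linarith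
        hence dX: "?d \<le> X" using X by (simp del: of_nat_prod)
        have "prime_recip ?d = (\<Sum>q\<in>A. 1 / real q)" using RA(5) by simp
        also have "\<dots> \<le> (\<Sum>q\<in>A. \<delta> / 2)"
        proof (rule sum_mono)
          fix q assume "q \<in> A"
          hence "real q \<ge> 2 / \<delta>" using A(1) X(2) by (auto simp: rough_primes_def)
          moreover have "2 / \<delta> > 0" using \<delta> by simp
          ultimately have "1 / real q \<le> 1 / (2 / \<delta>)" by (intro divide_left_mono mult_pos_pos) linarith+
          thus "1 / real q \<le> \<delta> / 2" by simp
        qed
        also have "\<dots> = real (card A) * \<delta> / 2" by simp
        also have "\<dots> \<le> (1 / \<delta>) * \<delta> / 2"
          using rough_card_le[OF A(1) dX \<delta>(1) X(1)] \<delta> by (intro divide_right_mono mult_right_mono) auto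
        finally have half: "prime_recip ?d \<le> 1/2" using \<delta> by simp
        have "real X powr (1/10) * (real ?d * ln (real X)) \<le> real X powr (1/8) * real X powr (7/8)"
          using mult_mono[OF X(3) A(2)] RA(4) by (simp add: mult_ac del: of_nat_prod)
        also have "\<dots> = real X" using X by (simp flip: powr_add)
        finally have "real X powr (1/10) \<le> real X / (real ?d * ln (real X))"
          using RA(4) lnX by (subst pos_le_divide_eq) (auto simp del: of_nat_prod)
        moreover have "real (card (primes_AP X ?d)) \<le> C * real X / (real ?d * ln (real X)) + real X powr (1/10)"
          by (rule bt[OF X(1) RA(3) half])
        ultimately have "real (card (primes_AP X ?d)) \<le>
            C * real X / (real ?d * ln (real X)) + real X / (real ?d * ln (real X))" by linarith
        also have "\<dots> = (C + 1) * real X / (real ?d * ln (real X))"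
          by (simp add: add_divide_distrib distrib_right del: of_nat_prod)
        finally show "real (card (primes_AP X ?d)) \<le> (C + 1) * real X / (real ?d * ln (real X))" .
      qed
    qed
  qed
  thus ?thesis using C by (intro exI[of _ "C + 1"]) auto
qed

text \<open>Controls the accumulated X^(1/10) errors of the sieve. There are at most z bases,
  exponents are at most 2 ln X because ln 2 \<ge> 1/2, and each term is at most ln X.\<close>

lemma mangoldt_smooth_sum_trivial:
  assumes "X \<ge> 2" "z \<ge> 1"
  shows "(\<Sum>d | d \<in> {1..X} \<and> primepow d \<and> real (aprimedivisor d) \<le> z. mangoldt d) \<le> 2 * z * ln (real X) ^ 2"
proof -
  let ?D = "{d. d \<in> {1..X} \<and> primepow d \<and> real (aprimedivisor d) \<le> z}"
  define Z where "Z = nat \<lfloor>z\<rfloor>"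
  define J where "J = nat \<lfloor>2 * ln (real X)\<rfloor>"
  have lnX: "ln (real X) > 0" using assms by simp
  have "(\<Sum>d\<in>?D. mangoldt d) \<le> (\<Sum>(q, k)\<in>{1..Z} \<times> {1..J}. ln (real X))"
  proof (rule sum_le_included[where i = "\<lambda>(q, k). q ^ k"])
    show "\<forall>d\<in>?D. \<exists>y\<in>{1..Z} \<times> {1..J}. (case y of (q, k) \<Rightarrow> q ^ k) = d \<and> mangoldt d \<le> (case y of (q, k) \<Rightarrow> ln (real X))"
    proof
      fix d assume d: "d \<in> ?D"
      then obtain q k where qk: "prime q" "k > 0" "d = q ^ k" by (auto simp: primepow_def)
      have q2: "q \<ge> 2" using qk(1) by (rule prime_ge_2_nat)
      have "aprimedivisor d = q" using qk by (simp add: aprimedivisor_prime_power)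
      hence "q \<le> Z" using d by (simp add: Z_def le_nat_floor)
      moreover have "k \<le> J"
      proof -
        have "real k * (1 / 2) \<le> real k * ln (real q)"
        proof (rule mult_left_mono)
          have "1 / 2 \<le> ln (2::real)" by (rule half_le_ln_2)
          also have "\<dots> \<le> ln (real q)" using q2 by (intro ln_mono) auto
          finally show "1 / 2 \<le> ln (real q)" .
        qed simp
        also have "\<dots> = ln (real d)" using q2 by (simp add: qk(3) ln_realpow)
        also have "\<dots> \<le> ln (real X)" using d by (intro ln_mono) auto
        finally show ?thesis unfolding J_def by (intro le_nat_floor) simp
      qed
      moreover have "mangoldt d \<le> ln (real X)"
      proof -
        have "mangoldt d \<le> ln (real d)" using d by (intro mangoldt_le) auto
        also have "\<dots> \<le> ln (real X)" using d by (intro ln_mono) auto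
        finally show ?thesis .
      qed
      ultimately show "\<exists>y\<in>{1..Z} \<times> {1..J}. (case y of (q, k) \<Rightarrow> q ^ k) = d \<and> mangoldt d \<le> (case y of (q, k) \<Rightarrow> ln (real X))"
        using q2 qk by (intro bexI[of _ "(q, k)"]) auto
    qed
  qed (use lnX in \<open>auto\<close>)
  also have "\<dots> = real Z * real J * ln (real X)" by (simp add: case_prod_unfold)
  also have "\<dots> \<le> z * (2 * ln (real X)) * ln (real X)"
    using assms lnX by (intro mult_right_mono mult_mono) (auto simp: Z_def J_def)
  finally show ?thesis by (simp add: power2_eq_square mult_ac)
qed

section \<open>Moment inequalities and three rare types of shifted primes\<close>

lemma card_mult_le_double_count:
  fixes w :: "'b \<Rightarrow> real"
  assumes "finite G" "finite R" "\<And>p. p \<in> G \<Longrightarrow> t \<le> (\<Sum>a | a \<in> R \<and> Q a p. w a)"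
  shows "real (card G) * t \<le> (\<Sum>a\<in>R. w a * real (card {p\<in>G. Q a p}))"
proof -
  have "real (card G) * t = (\<Sum>p\<in>G. t)" by simp
  also have "\<dots> \<le> (\<Sum>p\<in>G. \<Sum>a | a \<in> R \<and> Q a p. w a)" by (rule sum_mono) (rule assms(3))
  also have "\<dots> = (\<Sum>p\<in>G. \<Sum>a\<in>R. if Q a p then w a else 0)"
    using assms(2) by (intro sum.cong refl sum.inter_filter)
  also have "\<dots> = (\<Sum>a\<in>R. \<Sum>p\<in>G. if Q a p then w a else 0)" by (rule sum.swap)
  also have "\<dots> = (\<Sum>a\<in>R. w a * real (card {p\<in>G. Q a p}))"
    using assms(1) by (intro sum.cong refl) (simp add: sum.If_cases Int_def)
  finally show ?thesis .
qed

text \<open>Markov's inequality for the logarithm of the smooth part. The map h allows the same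
  argument for shifted primes p - 1 and for integers n.\<close>

lemma smooth_log_markov:
  fixes h :: "'a \<Rightarrow> nat"
  assumes "finite G" "\<And>p. p \<in> G \<Longrightarrow> h p \<in> {1..X}" "\<And>p. p \<in> G \<Longrightarrow> t \<le> smooth_log z (h p)"
  shows "real (card G) * t \<le> (\<Sum>d | d \<in> {1..X} \<and> primepow d \<and> real (aprimedivisor d) \<le> z.
           mangoldt d * real (card {p\<in>G. d dvd h p}))"
proof (rule card_mult_le_double_count[OF assms(1)])
  let ?D = "{d. d \<in> {1..X} \<and> primepow d \<and> real (aprimedivisor d) \<le> z}"
  show "finite ?D" by (rule finite_subset[of _ "{1..X}"]) auto
  fix p assume p: "p \<in> G"
  have hp: "0 < h p" "h p \<le> X" using assms(2)[OF p] by auto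
  have "smooth_log z (h p) = (\<Sum>d | d \<in> ?D \<and> d dvd h p. mangoldt d)"
    unfolding smooth_log_def
  proof (rule sum.mono_neutral_right)
    show "finite {d. d dvd h p \<and> real (aprimedivisor d) \<le> z}"
      by (rule finite_subset[of _ "{d. d dvd h p}"]) (use hp in auto)
    show "\<forall>d\<in>{d. d dvd h p \<and> real (aprimedivisor d) \<le> z} - {d. d \<in> ?D \<and> d dvd h p}. mangoldt d = (0::real)"
    proof
      fix d assume d: "d \<in> {d. d dvd h p \<and> real (aprimedivisor d) \<le> z} - {d. d \<in> ?D \<and> d dvd h p}"
      have "d \<le> h p" using d hp by (intro dvd_imp_le) auto
      moreover have "d \<noteq> 0" using d hp by (intro notI) auto
      ultimately have "\<not> primepow d" using d hp by auto
      thus "mangoldt d = (0::real)" by (simp add: mangoldt_def)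
    qed
  qed auto
  thus "t \<le> (\<Sum>d | d \<in> ?D \<and> d dvd h p. mangoldt d)" using assms(3)[OF p] by simp
qed

abbreviation sparse :: "(nat \<Rightarrow> nat set) \<Rightarrow> real \<Rightarrow> bool" where
  "sparse S c \<equiv> \<forall>\<^sub>F X in sequentially. real (card (S X)) \<le> c * (real X / ln (real X))"

abbreviation smooth_shift_primes :: "real \<Rightarrow> real \<Rightarrow> nat \<Rightarrow> nat set" where
  "smooth_shift_primes \<delta> K X \<equiv>
     {p. prime p \<and> p \<le> X \<and> smooth_log (real X powr \<delta>) (p - 1) > K * \<delta> * ln (real X)}"

text \<open>A prime power has one prime factor, so the sieve applies to every d that occurs. On
  average over the X / ln X expected primes, \<open>smooth_log\<close> is then O(\<delta> ln X), and
  Markov's inequality leaves the factor 1 / K. The constant depends neither on \<delta> nor on K, so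
  K can be fixed before \<delta>.\<close>

lemma primes_smooth_shift:
  "\<exists>C\<ge>1. \<forall>\<delta> K. 0 < \<delta> \<longrightarrow> \<delta> \<le> 1/4 \<longrightarrow> 0 < K \<longrightarrow>
     (sparse (smooth_shift_primes \<delta> K) (C / K))"
proof -
  obtain C1 where C1: "C1 \<ge> 1" and bt: "\<And>X d. X \<ge> 2 \<Longrightarrow> d > 0 \<Longrightarrow> prime_recip d \<le> 1/2 \<Longrightarrow>
     real (card (primes_AP X d)) \<le> C1 * real X / (real d * ln (real X)) + real X powr (1/10)"
    using brun_titchmarsh by blast
  obtain C2 where C2: "C2 \<ge> 0" "\<And>(z::real) N. z \<ge> 1 \<Longrightarrow>
      smooth_mangoldt_sum z N \<le> ln z + C2"
    using mangoldt_smooth_sum_le by blast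
  have "sparse (smooth_shift_primes \<delta> K) ((C1 + 2) / K)" if \<delta>: "0 < \<delta>" "\<delta> \<le> 1/4" and K: "0 < K" for \<delta> K :: real
  proof -
    have "\<forall>\<^sub>F X in sequentially. real X \<ge> 2 \<and> C1 * C2 / ln (real X) \<le> \<delta> \<and>
            real X powr (1/10) * (2 * real X powr (1/4) * ln (real X) ^ 2) \<le> \<delta> * real X"
      using \<delta>(1) by (intro eventually_conj; real_asymp)
    thus ?thesis
    proof eventually_elim
      case (elim X)
      define z where "z = real X powr \<delta>"
      let ?D = "{d. d \<in> {1..X} \<and> primepow d \<and> real (aprimedivisor d) \<le> z}"
      let ?G = "{p. prime p \<and> p \<le> X \<and> smooth_log z (p - 1) > K * \<delta> * ln (real X)}"
      have X: "X \<ge> 2" using elim by auto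
      have lnX: "ln (real X) > 0" using X by simp
      have z1: "z \<ge> 1" using X \<delta> by (simp add: z_def ge_one_powr_ge_zero)
      have finD: "finite ?D" by (rule finite_subset[of _ "{1..X}"]) auto
      have finG: "finite ?G" by (rule finite_subset[of _ "{..X}"]) auto
      have "real (card ?G) * (K * \<delta> * ln (real X)) \<le> (\<Sum>d\<in>?D. mangoldt d * real (card {p\<in>?G. d dvd p - 1}))"
      proof (rule smooth_log_markov[OF finG])
        fix p assume p: "p \<in> ?G"
        show "p - 1 \<in> {1..X}" using p prime_gt_1_nat[of p] by auto
        show "K * \<delta> * ln (real X) \<le> smooth_log z (p - 1)" using p by simp
      qed
      also have "\<dots> \<le> (\<Sum>d\<in>?D. mangoldt d * (C1 * real X / (real d * ln (real X)) + real X powr (1/10)))"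
      proof (rule sum_mono)
        fix d assume d: "d \<in> ?D"
        then obtain q k where qk: "prime q" "k > 0" "d = q ^ k" by (auto simp: primepow_def)
        have "{r. prime r \<and> r dvd d} = {q}"
        proof (intro equalityI subsetI)
          fix r assume "r \<in> {r. prime r \<and> r dvd d}"
          hence "prime r" "r dvd q" using qk(3) prime_dvd_power by auto
          thus "r \<in> {q}" using qk(1) primes_dvd_imp_eq by blast
        qed (use qk in auto)
        hence half: "(\<Sum>r | prime r \<and> r dvd d. 1 / real r) \<le> 1 / 2"
          using prime_ge_2_nat[OF qk(1)] by simp
        have "mangoldt d * real (card {p\<in>?G. d dvd p - 1}) \<le> mangoldt d * real (card (primes_AP X d))"
          by (intro mult_left_mono of_nat_mono card_mono finite_primes_upto' mangoldt_nonneg) auto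
        also have "\<dots> \<le> mangoldt d * (C1 * real X / (real d * ln (real X)) + real X powr (1/10))"
          by (intro mult_left_mono bt X half mangoldt_nonneg) (use d in auto)
        finally show "mangoldt d * real (card {p\<in>?G. d dvd p - 1}) \<le>
            mangoldt d * (C1 * real X / (real d * ln (real X)) + real X powr (1/10))" .
      qed
      also have "\<dots> = C1 * real X / ln (real X) * (\<Sum>d\<in>?D. mangoldt d / real d) + real X powr (1/10) * (\<Sum>d\<in>?D. mangoldt d)"
        by (simp add: sum_distrib_left distrib_left sum.distrib mult_ac)
      also have "\<dots> \<le> C1 * real X / ln (real X) * (\<delta> * ln (real X) + C2) + real X powr (1/10) * (2 * real X powr (1/4) * ln (real X) ^ 2)"
      proof (intro add_mono mult_left_mono)
        have "(\<Sum>d\<in>?D. mangoldt d / real d) \<le> smooth_mangoldt_sum z X"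
          by (rule sum_mono2) (auto intro!: divide_nonneg_nonneg mangoldt_nonneg)
        also have "\<dots> \<le> ln z + C2" by (rule C2(2)[OF z1])
        also have "ln z = \<delta> * ln (real X)" using X by (simp add: z_def ln_powr)
        finally show "(\<Sum>d\<in>?D. mangoldt d / real d) \<le> \<delta> * ln (real X) + C2" .
        have "(\<Sum>d\<in>?D. mangoldt d) \<le> 2 * z * ln (real X) ^ 2"
          by (rule mangoldt_smooth_sum_trivial[OF X z1])
        also have "z \<le> real X powr (1/4)" unfolding z_def using \<delta> X by (intro powr_mono) auto
        finally show "(\<Sum>d\<in>?D. mangoldt d) \<le> 2 * real X powr (1/4) * ln (real X) ^ 2" by (simp add: mult_right_mono)
      qed (use C1 lnX in auto)
      also have "\<dots> \<le> (C1 + 2) * \<delta> * real X"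
      proof -
        have "C1 * real X / ln (real X) * (\<delta> * ln (real X) + C2) = C1 * \<delta> * real X + real X * (C1 * C2 / ln (real X))"
          using lnX by (simp add: field_simps)
        also have "real X * (C1 * C2 / ln (real X)) \<le> real X * \<delta>" using elim by (intro mult_left_mono) auto
        finally show ?thesis using elim by (simp add: algebra_simps)
      qed
      finally have "(real (card ?G) * (K * ln (real X))) * \<delta> \<le> ((C1 + 2) * real X) * \<delta>" by (simp add: mult_ac)
      hence "real (card ?G) * (K * ln (real X)) \<le> (C1 + 2) * real X" using \<delta>(1) by (rule mult_right_le_imp_le)
      hence "real (card ?G) \<le> (C1 + 2) * real X / (K * ln (real X))" using K lnX by (simp add: pos_le_divide_eq)
      thus ?case by (simp add: z_def)
    qed
  qed
  thus ?thesis using C1 by (intro exI[of _ "C1 + 2"]) auto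
qed

text \<open>Remove an element with the largest value again and again: the k smallest values have at
  most the average share. The induction runs downwards from B itself.\<close>

lemma exists_subset_small_sum:
  fixes g :: "'a \<Rightarrow> real"
  assumes "finite B" "k \<le> card B"
  shows "\<exists>A\<subseteq>B. card A = k \<and> real (card B) * sum g A \<le> real k * sum g B"
  using assms(2)
proof (induction k rule: inc_induct)
  case (step k)
  then obtain A where A: "A \<subseteq> B" "card A = Suc k" "real (card B) * sum g A \<le> real (Suc k) * sum g B" by blast
  have finA: "finite A" using A(1) assms(1) by (rule finite_subset)
  have "A \<noteq> {}" using A(2) by auto
  then obtain a where a: "a \<in> A" "\<And>x. x \<in> A \<Longrightarrow> g x \<le> g a"
    using finA Max_in[of "g ` A"] Max_ge[of "g ` A"] by (metis (no_types, lifting) finite_imageI image_iff image_is_empty)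
  have "sum g A \<le> (\<Sum>x\<in>A. g a)" by (rule sum_mono) (rule a(2))
  hence 1: "sum g A \<le> real (Suc k) * g a" using A(2) by simp
  have 2: "sum g (A - {a}) = sum g A - g a" using finA a(1) by (simp add: sum_diff1)
  have "real (Suc k) * sum g (A - {a}) \<le> real k * sum g A"
    using 1 unfolding 2 by (simp add: algebra_simps)
  hence "real (card B) * (real (Suc k) * sum g (A - {a})) \<le> real (card B) * (real k * sum g A)"
    by (rule mult_left_mono) simp
  also have "\<dots> = real k * (real (card B) * sum g A)" by simp
  also have "\<dots> \<le> real k * (real (Suc k) * sum g B)" by (intro mult_left_mono A(3)) simp
  finally have "real (Suc k) * (real (card B) * sum g (A - {a})) \<le> real (Suc k) * (real k * sum g B)"
    by (simp only: mult_ac)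
  hence "real (card B) * sum g (A - {a}) \<le> real k * sum g B"
    by (rule mult_left_le_imp_le) simp
  moreover have "card (A - {a}) = k" using A(2) a(1) finA by simp
  ultimately show ?case using A(1) by blast
qed (use assms in blast)

lemma sum_Pow_power_card:
  assumes "finite A"
  shows "(\<Sum>B\<in>Pow A. c ^ card B) = (1 + c :: real) ^ card A"
  using prod_add[OF assms, of "\<lambda>_. c" "\<lambda>_. 1"] by (simp add: add.commute)

text \<open>The value 43/200 is enough because 49/40 * 43/200 > 1/4 + 1/100, where 49/40 = 7/8 *
  7/5. At 1/64 the quadratic lower bound for ln loses little, and (65/64)^14 \<le> 5/4.\<close>

lemma ln_five_fourths_ge: "ln (5/4 :: real) \<ge> 43/200"
proof -
  have "(1/64::real) - (1/64)\<^sup>2 \<le> ln (1 + 1/64)" by (rule ln_one_plus_pos_lower_bound) auto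
  hence "43/200 \<le> 14 * ln (65/64 :: real)" by (simp add: power2_eq_square)
  also have "\<dots> = ln ((65/64) ^ 14)" by (subst ln_realpow) auto
  also have "\<dots> \<le> ln (5/4)" by (intro ln_mono) (auto simp: field_simps)
  finally show ?thesis .
qed

abbreviation many_factor_primes :: "real \<Rightarrow> nat \<Rightarrow> nat set" where
  "many_factor_primes \<delta> X \<equiv>
     {p. prime p \<and> p \<le> X \<and> real (card {q\<in>rough_primes \<delta> X. q dvd p - 1}) > 7/5 * ln (1 / \<delta>)}"

text \<open>
  The exponent is positive because \<open>7/8 * 7/5 * ln (5/4) > 1/4\<close>: the factor \<open>7/8\<close> is the price for
  using only divisors up to \<open>X powr (7/8)\<close>, which still contain all subsets of the smallest
  \<open>7/8\<close> of the rough prime factors.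
\<close>

lemma primes_many_rough_factors:
  "\<exists>C\<ge>1. \<forall>\<delta>. 0 < \<delta> \<longrightarrow> \<delta> < 1 \<longrightarrow>
     (sparse (many_factor_primes \<delta>) (C * \<delta> powr (1/100)))"
proof -
  obtain C1 where C1: "C1 \<ge> 1" and bt: "\<And>\<delta>. 0 < \<delta> \<Longrightarrow> \<delta> < 1 \<Longrightarrow>
     rough_sieve_bound \<delta> C1"
    using card_primes_rough_divisor by blast
  obtain C2 where C2: "C2 \<ge> 0" "\<And>\<delta>. 0 < \<delta> \<Longrightarrow> \<delta> < 1 \<Longrightarrow>
     (\<forall>\<^sub>F X in sequentially. rough_recip \<delta> X \<le> ln (1 / \<delta>) + C2)"
    using rough_reciprocal_sum by blast
  define C where "C = 2 * C1 * exp C2"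
  have "sparse (many_factor_primes \<delta>) (C * \<delta> powr (1/100))" if \<delta>: "0 < \<delta>" "\<delta> < 1" for \<delta> :: real
  proof -
    have "\<forall>\<^sub>F X in sequentially. real X \<ge> 2" by real_asymp
    with bt[OF \<delta>] C2(2)[OF \<delta>] show ?thesis
    proof eventually_elim
      case (elim X)
      let ?P = "rough_primes \<delta> X"
      define c where "c = ln (5/4 :: real)"
      have c: "c \<ge> 43/200" "exp c = 5/4" using ln_five_fourths_ge by (simp_all only: c_def exp_ln)
      define L where "L = ln (1 / \<delta>)"
      define R where "R = {A. A \<subseteq> ?P \<and> real (\<Prod>A) \<le> real X powr (7/8)}"
      let ?G = "{p. prime p \<and> p \<le> X \<and> real (card {q\<in>?P. q dvd p - 1}) > 7/5 * L}"
      have X: "X \<ge> 2" using elim by simp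
      have lnX: "ln (real X) > 0" using X by simp
      have L0: "L > 0" using \<delta> by (simp add: L_def)
      have finR: "finite R" unfolding R_def by (rule finite_subset[of _ "Pow ?P"]) auto
      have finG: "finite ?G" by (rule finite_subset[of _ "{..X}"]) auto
      \<comment> \<open>The weights (1/4)^card A over all subsets of a k-element set add up to
        (5/4)^k. The weight is close to the optimal 49/40 - 1. The factor 4/5 pays for rounding k
        down, since k + 1 > 49/40 L.\<close>
      have "real (card ?G) * ((4/5) * exp ((49/40 * L) * c)) \<le> (\<Sum>A\<in>R. (1/4) ^ card A * real (card {p\<in>?G. \<Prod>A dvd p - 1}))"
      proof (rule card_mult_le_double_count[OF finG finR])
        fix p assume p: "p \<in> ?G"
        have p1: "p - 1 > 0" "p \<le> X" using p prime_gt_1_nat[of p] by auto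
        define B where "B = {q\<in>?P. q dvd p - 1}"
        define W where "W = card B"
        have BP: "B \<subseteq> ?P" by (auto simp: B_def)
        note RB = rough_subset[OF BP]
        have W: "real W > 7/5 * L" using p by (simp add: W_def B_def)
        hence W0: "real W > 0" using L0 by linarith
        define k where "k = nat \<lfloor>7/8 * real W\<rfloor>"
        have k: "real k \<le> 7/8 * real W" "real k > 7/8 * real W - 1" using W0 unfolding k_def by linarith+
        have "k \<le> card B" using k(1) W0 unfolding W_def by linarith
        then obtain A where A: "A \<subseteq> B" "card A = k" "real W * (\<Sum>q\<in>A. ln (real q)) \<le> real k * (\<Sum>q\<in>B. ln (real q))"
          using exists_subset_small_sum[OF RB(1), of k "\<lambda>q. ln (real q)"] unfolding W_def by auto
        have AP: "A \<subseteq> ?P" using A(1) BP by auto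
        note RA = rough_subset[OF AP]
        have "\<Prod>B dvd p - 1" using prod_primes_dvd_iff[OF RB(1,2)] by (auto simp: B_def)
        hence "\<Prod>B \<le> X" using p1 dvd_imp_le[of "\<Prod>B" "p - 1"] by linarith
        hence "ln (real (\<Prod>B)) \<le> ln (real X)" using RB(4) by (intro ln_mono of_nat_mono)
        hence "(\<Sum>q\<in>B. ln (real q)) \<le> ln (real X)" by (simp only: RB(6))
        hence "real k * (\<Sum>q\<in>B. ln (real q)) \<le> (7/8 * real W) * ln (real X)"
          using k(1) lnX W0 by (intro mult_mono) (auto intro!: sum_nonneg ln_ge_zero simp: Suc_le_eq prime_gt_0_nat RB(2))
        hence "real W * (\<Sum>q\<in>A. ln (real q)) \<le> real W * (7/8 * ln (real X))" using A(3) by simp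
        hence "(\<Sum>q\<in>A. ln (real q)) \<le> 7/8 * ln (real X)" using W0 by (rule mult_left_le_imp_le)
        hence "ln (real (\<Prod>A)) \<le> ln (real X powr (7/8))" using X by (simp only: RA(6)) (simp add: ln_powr)
        hence Ale: "real (\<Prod>A) \<le> real X powr (7/8)" using RA(4) X by (subst (asm) ln_le_cancel_iff) auto
        have sub: "Pow A \<subseteq> {S\<in>R. \<Prod>S dvd p - 1}"
        proof
          fix S assume S: "S \<in> Pow A"
          have "\<Prod>S \<le> \<Prod>A" using S RA(1,3) by (intro dvd_imp_le prod_dvd_prod_subset) auto
          hence "real (\<Prod>S) \<le> real (\<Prod>A)" by (rule of_nat_mono)
          moreover have "\<Prod>S dvd p - 1"
            using S A(1) rough_subset(1,2)[of S \<delta> X] AP prod_primes_dvd_iff[of S "p - 1"] by (auto simp: B_def)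
          ultimately show "S \<in> {S\<in>R. \<Prod>S dvd p - 1}" using S AP Ale unfolding R_def by (auto simp del: of_nat_prod)
        qed
        have "(4/5) * exp ((49/40 * L) * c) \<le> (4/5) * exp (real (Suc k) * c)"
          using W k c(1) by (intro mult_left_mono) (auto intro!: mult_right_mono)
        also have "exp (real (Suc k) * c) = (5/4) ^ Suc k" by (simp only: exp_of_nat_mult c(2))
        also have "(4/5) * (5/4::real) ^ Suc k = (5/4) ^ k" by simp
        also have "\<dots> = (\<Sum>S\<in>Pow A. (1/4) ^ card S)"
          using sum_Pow_power_card[OF RA(1), of "1/4"] A(2) by simp
        also have "\<dots> \<le> (\<Sum>S\<in>{S\<in>R. \<Prod>S dvd p - 1}. (1/4) ^ card S)"
          by (rule sum_mono2[OF _ sub]) (use finR in auto)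
        finally show "(4/5) * exp ((49/40 * L) * c) \<le> (\<Sum>S\<in>{S\<in>R. \<Prod>S dvd p - 1}. (1/4) ^ card S)" .
      qed
      also have "\<dots> \<le> (\<Sum>A\<in>R. (1/4) ^ card A * (C1 * real X / (real (\<Prod>A) * ln (real X))))"
      proof (rule sum_mono)
        fix A assume A: "A \<in> R"
        have "(1/4) ^ card A * real (card {p\<in>?G. \<Prod>A dvd p - 1}) \<le> (1/4) ^ card A * real (card (primes_AP X (\<Prod>A)))"
          by (intro mult_left_mono of_nat_mono card_mono finite_primes_upto') auto
        also have "\<dots> \<le> (1/4) ^ card A * (C1 * real X / (real (\<Prod>A) * ln (real X)))"
          using elim A by (intro mult_left_mono) (auto simp: R_def simp del: of_nat_prod)
        finally show "(1/4) ^ card A * real (card {p\<in>?G. \<Prod>A dvd p - 1}) \<le> (1/4) ^ card A * (C1 * real X / (real (\<Prod>A) * ln (real X)))" .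
      qed
      also have "\<dots> = C1 * (real X / ln (real X)) * (\<Sum>A\<in>R. (1/4) ^ card A / real (\<Prod>A))"
        unfolding sum_distrib_left by (intro sum.cong refl) (simp add: mult_ac del: of_nat_prod)
      also have "\<dots> \<le> C1 * (real X / ln (real X)) * (\<Sum>A\<in>Pow ?P. (1/4) ^ card A / real (\<Prod>A))"
        using C1 lnX by (intro mult_left_mono sum_mono2) (auto simp: R_def simp del: of_nat_prod)
      also have "\<dots> \<le> C1 * (real X / ln (real X)) * exp (1/4 * (\<Sum>q\<in>?P. 1 / real q))"
        using C1 lnX by (intro mult_left_mono rough_weight_sum_le) auto
      also have "\<dots> \<le> C1 * (real X / ln (real X)) * exp (1/4 * (L + C2))"
        using C1 lnX elim by (intro mult_left_mono) (auto simp: L_def)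
      finally have main: "real (card ?G) * ((4/5) * exp ((49/40 * L) * c)) \<le> C1 * (real X / ln (real X)) * exp (1/4 * (L + C2))" .
      have "exp (1/4 * (L + C2)) \<le> exp (C2 + (- L / 100 + (49/40 * L) * c))"
      proof -
        have "(49/40 * L) * (43/200) \<le> (49/40 * L) * c"
          using c(1) L0 by (intro mult_left_mono) auto
        hence "1/4 * L \<le> - L / 100 + (49/40 * L) * c" using L0 by linarith
        moreover have "1/4 * C2 \<le> C2" using C2(1) by simp
        ultimately have "1/4 * L + 1/4 * C2 \<le> (- L / 100 + (49/40 * L) * c) + C2" by (rule add_mono)
        thus ?thesis by (simp add: add.commute distrib_left)
      qed
      also have "\<dots> = exp C2 * \<delta> powr (1/100) * exp ((49/40 * L) * c)"
        using \<delta> unfolding exp_add by (simp add: powr_def L_def ln_div)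
      finally have "C1 * (real X / ln (real X)) * exp (1/4 * (L + C2)) \<le>
          C1 * (real X / ln (real X)) * (exp C2 * \<delta> powr (1/100) * exp ((49/40 * L) * c))"
        using C1 lnX by (intro mult_left_mono) auto
      hence "(real (card ?G) * (4/5)) * exp ((49/40 * L) * c) \<le>
             (C1 * (real X / ln (real X)) * exp C2 * \<delta> powr (1/100)) * exp ((49/40 * L) * c)"
        using main by (simp only: mult_ac)
      hence "real (card ?G) * (4/5) \<le> C1 * (real X / ln (real X)) * exp C2 * \<delta> powr (1/100)"
        by (rule mult_right_le_imp_le) simp
      moreover define T where "T = C1 * (real X / ln (real X)) * exp C2 * \<delta> powr (1/100)"
      moreover have "0 \<le> T" using C1 lnX by (simp add: T_def)
      ultimately have "real (card ?G) \<le> 2 * T" by linarith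
      thus ?case by (simp add: C_def L_def T_def mult_ac)
    qed
  qed
  moreover have "C \<ge> 1"
  proof -
    have "1 * 1 \<le> C1 * exp C2" using C1 C2(1) by (intro mult_mono) auto
    thus ?thesis by (simp add: C_def)
  qed
  ultimately show ?thesis by blast
qed

text \<open>Writing \<open>ln (\<Prod>A)\<close> as a sum over the members of \<open>A\<close> and summing over one member first gains the factor \<open>ln lo\<close>.\<close>

lemma rough_weight_window:
  "\<exists>C\<ge>0. \<forall>\<delta> X lo hi \<mu>. 1 \<le> lo \<longrightarrow> lo \<le> hi \<longrightarrow> 0 \<le> \<mu> \<longrightarrow>
     ln lo * (\<Sum>A | A \<subseteq> rough_primes \<delta> X \<and> lo \<le> real (\<Prod>A) \<and> real (\<Prod>A) \<le> hi. \<mu> ^ card A / real (\<Prod>A))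
       \<le> \<mu> * (ln (hi / lo) + C) * exp (\<mu> * rough_recip \<delta> X)"
proof -
  obtain C where C: "C \<ge> 0" "\<And>a b::real. 0 < a \<Longrightarrow> a \<le> b \<Longrightarrow>
     window_sum a b \<le> ln (b / a) + C"
    using mertens_window by blast
  have "ln lo * (\<Sum>A | A \<subseteq> rough_primes \<delta> X \<and> lo \<le> real (\<Prod>A) \<and> real (\<Prod>A) \<le> hi. \<mu> ^ card A / real (\<Prod>A))
       \<le> \<mu> * (ln (hi / lo) + C) * exp (\<mu> * rough_recip \<delta> X)"
    if lohi: "1 \<le> lo" "lo \<le> hi" and \<mu>: "0 \<le> \<mu>" for \<delta> lo hi \<mu> :: real and X :: nat
  proof -
    let ?P = "rough_primes \<delta> X"
    define w where "w A = \<mu> ^ card A / real (\<Prod>A)" for A :: "nat set"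
    define R where "R = {A. A \<subseteq> ?P \<and> lo \<le> real (\<Prod>A) \<and> real (\<Prod>A) \<le> hi}"
    define Q where "Q B = {q. prime q \<and> lo / real (\<Prod>B) \<le> real q \<and> real q \<le> hi / real (\<Prod>B)}" for B
    have finR: "finite R" unfolding R_def by (rule finite_subset[of _ "Pow ?P"]) auto
    have finQ: "finite (Q B)" for B
      unfolding Q_def by (rule finite_subset[of _ "{..nat \<lfloor>hi / real (\<Prod>B)\<rfloor>}"]) (auto simp: le_nat_floor simp del: of_nat_prod)
    have w0: "w A \<ge> 0" for A using \<mu> by (simp add: w_def prod_nonneg)
    have "ln lo * (\<Sum>A\<in>R. w A) \<le> (\<Sum>A\<in>R. \<Sum>q\<in>A. w A * ln (real q))"
      unfolding sum_distrib_left
    proof (rule sum_mono)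
      fix A assume A: "A \<in> R"
      hence AP: "A \<subseteq> ?P" by (simp add: R_def)
      have "ln lo \<le> ln (real (\<Prod>A))" using A lohi by (intro ln_mono) (auto simp: R_def simp del: of_nat_prod)
      hence "ln lo \<le> (\<Sum>q\<in>A. ln (real q))" by (simp only: rough_subset(6)[OF AP])
      hence "w A * ln lo \<le> w A * (\<Sum>q\<in>A. ln (real q))" using w0 by (intro mult_left_mono) auto
      thus "ln lo * w A \<le> (\<Sum>q\<in>A. w A * ln (real q))" by (simp only: sum_distrib_left mult.commute)
    qed
    also have "\<dots> = (\<Sum>(A, q)\<in>Sigma R (\<lambda>A. A). w A * ln (real q))"
      by (rule sum.Sigma) (use finR rough_subset(1) in \<open>auto simp: R_def\<close>)
    \<comment> \<open>Taking q out of A leaves an unrestricted set B and confines q to an interval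
      with endpoint ratio hi / lo. This ratio does not depend on B, so Mertens' bound for the sum
      over q is the same for all B.\<close>
    also have "\<dots> \<le> (\<Sum>(B, q)\<in>Sigma (Pow ?P) Q. w B * (\<mu> * (ln (real q) / real q)))"
    proof (rule sum_le_included[where i = "\<lambda>(B, q). (insert q B, q)"])
      show "\<forall>x\<in>Sigma R (\<lambda>A. A). \<exists>y\<in>Sigma (Pow ?P) Q. (case y of (B, q) \<Rightarrow> (insert q B, q)) = x \<and>
              (case x of (A, q) \<Rightarrow> w A * ln (real q)) \<le> (case y of (B, q) \<Rightarrow> w B * (\<mu> * (ln (real q) / real q)))"
      proof
        fix x assume "x \<in> Sigma R (\<lambda>A. A)"
        then obtain A q where x: "x = (A, q)" "A \<in> R" "q \<in> A" by auto
        hence AP: "A \<subseteq> ?P" by (simp add: R_def)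
        define B where "B = A - {q}"
        have BP: "B \<subseteq> ?P" using AP by (auto simp: B_def)
        have ins: "insert q B = A" "q \<notin> B" "finite B" using x rough_subset(1)[OF AP] by (auto simp: B_def)
        have prod: "real (\<Prod>A) = real q * real (\<Prod>B)" using ins by (metis of_nat_mult prod.insert)
        have q0: "real q > 0" "prime q" using rough_subset(2)[OF AP x(3)] prime_gt_0_nat by auto
        have Bpos: "real (\<Prod>B) > 0" by (rule rough_subset(4)[OF BP])
        have "q \<in> Q B"
          using x(2) q0 Bpos unfolding Q_def R_def prod mem_Collect_eq
          by (simp add: pos_divide_le_eq pos_le_divide_eq del: of_nat_prod)
        moreover have "w A * ln (real q) = w B * (\<mu> * (ln (real q) / real q))"
        proof -
          have "card A = Suc (card B)" using ins by (metis card_insert_disjoint)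
          thus ?thesis unfolding w_def prod using q0 Bpos by (simp add: field_simps del: of_nat_prod)
        qed
        ultimately show "\<exists>y\<in>Sigma (Pow ?P) Q. (case y of (B, q) \<Rightarrow> (insert q B, q)) = x \<and>
              (case x of (A, q) \<Rightarrow> w A * ln (real q)) \<le> (case y of (B, q) \<Rightarrow> w B * (\<mu> * (ln (real q) / real q)))"
          using ins BP x(1) by (intro bexI[of _ "(B, q)"]) auto
      qed
      show "finite (Sigma R (\<lambda>A. A))"
        by (rule finite_SigmaI) (use finR rough_subset(1) in \<open>auto simp: R_def\<close>)
    qed (use finQ w0 \<mu> in \<open>auto simp: Q_def intro!: mult_nonneg_nonneg divide_nonneg_nonneg ln_ge_zero simp: Suc_le_eq prime_gt_0_nat\<close>)
    also have "\<dots> = (\<Sum>B\<in>Pow ?P. \<Sum>q\<in>Q B. w B * (\<mu> * (ln (real q) / real q)))"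
      by (rule sum.Sigma[symmetric]) (use finQ in auto)
    also have "\<dots> \<le> (\<Sum>B\<in>Pow ?P. w B * (\<mu> * (ln (hi / lo) + C)))"
    proof (rule sum_mono)
      fix B assume "B \<in> Pow ?P"
      hence Bpos: "real (\<Prod>B) > 0" using rough_subset(4) by auto
      have "(\<Sum>q\<in>Q B. ln (real q) / real q) \<le> ln ((hi / real (\<Prod>B)) / (lo / real (\<Prod>B))) + C"
        unfolding Q_def by (rule C(2)) (use Bpos lohi in \<open>auto intro: divide_right_mono simp del: of_nat_prod\<close>)
      also have "(hi / real (\<Prod>B)) / (lo / real (\<Prod>B)) = hi / lo" using Bpos by (simp del: of_nat_prod)
      finally have "w B * (\<mu> * (\<Sum>q\<in>Q B. ln (real q) / real q)) \<le> w B * (\<mu> * (ln (hi / lo) + C))"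
        using w0 \<mu> by (intro mult_left_mono)
      thus "(\<Sum>q\<in>Q B. w B * (\<mu> * (ln (real q) / real q))) \<le> w B * (\<mu> * (ln (hi / lo) + C))"
        by (simp only: sum_distrib_left)
    qed
    also have "\<dots> = \<mu> * (ln (hi / lo) + C) * (\<Sum>B\<in>Pow ?P. w B)"
      by (subst sum_distrib_right[symmetric]) (rule mult.commute)
    also have "\<dots> \<le> \<mu> * (ln (hi / lo) + C) * exp (\<mu> * (\<Sum>q\<in>?P. 1 / real q))"
    proof (rule mult_left_mono)
      show "(\<Sum>B\<in>Pow ?P. w B) \<le> exp (\<mu> * (\<Sum>q\<in>?P. 1 / real q))"
        unfolding w_def by (rule rough_weight_sum_le[OF \<mu>])
      have "ln (hi / lo) \<ge> 0" using lohi by simp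
      thus "0 \<le> \<mu> * (ln (hi / lo) + C)" using \<mu> C(1) by simp
    qed
    finally show ?thesis by (simp only: w_def R_def)
  qed
  thus ?thesis using C(1) by blast
qed


text \<open>Used as 7/10 * ln 2 \<le> 49/100, just below 1/2. The quadratic Taylor bound for exp is
  taken at 7/40 and raised to the fourth power for accuracy.\<close>

lemma ln_2_le_7_10: "ln (2::real) \<le> 7/10"
proof -
  have "(2::real) \<le> (1 + 7/40 + (7/40)\<^sup>2 / 2) ^ 4" by (simp add: power2_eq_square power4_eq_xxxx)
  also have "\<dots> \<le> exp (7/40) ^ 4" by (intro power_mono exp_lower_Taylor_quadratic) auto
  also have "\<dots> = exp (7/10)" by (simp flip: exp_of_nat_mult)
  finally have "ln 2 \<le> ln (exp (7/10::real))" by (intro ln_mono) auto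
  thus ?thesis by simp
qed

abbreviation middle_divisor_primes :: "real \<Rightarrow> real \<Rightarrow> nat \<Rightarrow> nat set" where
  "middle_divisor_primes \<delta> K X \<equiv> {p. prime p \<and> p \<le> X \<and> (\<exists>A\<subseteq>rough_primes \<delta> X.
     real X powr (1/2 - (K + 3) * \<delta>) \<le> real (\<Prod>A) \<and> real (\<Prod>A) \<le> real X powr (1/2 + \<delta>) \<and>
     real (card A) \<le> 7/10 * ln (1 / \<delta>) \<and> \<Prod>A dvd p - 1)}"

text \<open>Here the exponent is positive because \<open>7/10 * ln 2 < 1/2\<close>.\<close>

lemma primes_middle_divisor:
  "\<exists>C\<ge>1. \<forall>\<delta> K. 0 < \<delta> \<longrightarrow> 1 \<le> K \<longrightarrow> (K + 3) * \<delta> \<le> 1/4 \<longrightarrow>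
     (sparse (middle_divisor_primes \<delta> K) (C * (K + 5) * \<delta> powr (1/100)))"
proof -
  obtain C1 where C1: "C1 \<ge> 1" and bt: "\<And>\<delta>. 0 < \<delta> \<Longrightarrow> \<delta> < 1 \<Longrightarrow>
     rough_sieve_bound \<delta> C1"
    using card_primes_rough_divisor by blast
  obtain C2 where C2: "C2 \<ge> 0" "\<And>\<delta>. 0 < \<delta> \<Longrightarrow> \<delta> < 1 \<Longrightarrow>
     (\<forall>\<^sub>F X in sequentially. rough_recip \<delta> X \<le> ln (1 / \<delta>) + C2)"
    using rough_reciprocal_sum by blast
  obtain C3 where C3: "C3 \<ge> 0" "\<And>\<delta> X lo hi \<mu>. 1 \<le> lo \<Longrightarrow> lo \<le> hi \<Longrightarrow> 0 \<le> \<mu> \<Longrightarrow>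
     ln lo * (\<Sum>A | A \<subseteq> rough_primes \<delta> X \<and> lo \<le> real (\<Prod>A) \<and> real (\<Prod>A) \<le> hi. \<mu> ^ card A / real (\<Prod>A))
       \<le> \<mu> * (ln (hi / lo) + C3) * exp (\<mu> * rough_recip \<delta> X)"
    using rough_weight_window by blast
  define C where "C = 2 * C1 * exp C2"
  have "sparse (middle_divisor_primes \<delta> K) (C * (K + 5) * \<delta> powr (1/100))"
    if \<delta>: "0 < \<delta>" and K: "1 \<le> K" and K\<delta>: "(K + 3) * \<delta> \<le> 1/4" for \<delta> K :: real
  proof -
    have "4 * \<delta> \<le> (K + 3) * \<delta>" using K \<delta> by (intro mult_right_mono) auto
    hence \<delta>16: "\<delta> \<le> 1/16" using K\<delta> by linarith
    hence \<delta>1: "\<delta> < 1" by linarith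
    have "\<forall>\<^sub>F X in sequentially. real X \<ge> 2 \<and> C3 \<le> \<delta> * ln (real X)" using \<delta> by (intro eventually_conj; real_asymp)
    with bt[OF \<delta> \<delta>1] C2(2)[OF \<delta> \<delta>1] show ?thesis
    proof eventually_elim
      case (elim X)
      let ?P = "rough_primes \<delta> X"
      define L where "L = ln (1 / \<delta>)"
      define lo where "lo = real X powr (1/2 - (K + 3) * \<delta>)"
      define hi where "hi = real X powr (1/2 + \<delta>)"
      define R where "R = {A. A \<subseteq> ?P \<and> lo \<le> real (\<Prod>A) \<and> real (\<Prod>A) \<le> hi}"
      let ?G = "{p. prime p \<and> p \<le> X \<and> (\<exists>A\<subseteq>?P. lo \<le> real (\<Prod>A) \<and> real (\<Prod>A) \<le> hi \<and> real (card A) \<le> 7/10 * L \<and> \<Prod>A dvd p - 1)}"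
      have X: "X \<ge> 2" using elim by simp
      have lnX: "ln (real X) > 0" using X by simp
      have L0: "L > 0" using \<delta> \<delta>1 by (simp add: L_def)
      have finR: "finite R" unfolding R_def by (rule finite_subset[of _ "Pow ?P"]) auto
      \<comment> \<open>The condition on (K + 3) \<delta> gives lo \<ge> X^(1/4), so dividing by ln
        lo costs only a factor 4 against ln X, and hi stays below the level X^(7/8) of the sieve
        bound.\<close>
      have lohi: "1 \<le> lo" "lo \<le> hi" "hi \<le> real X powr (7/8)"
        using X K K\<delta> \<delta> \<delta>16 unfolding lo_def hi_def
        by (auto intro!: ge_one_powr_ge_zero powr_mono) (smt (verit) mult_nonneg_nonneg)
      have lnlo: "ln lo \<ge> 1/4 * ln (real X)"
      proof -
        have "ln lo = (1/2 - (K + 3) * \<delta>) * ln (real X)" using X by (simp add: lo_def ln_powr)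
        also have "\<dots> \<ge> 1/4 * ln (real X)" using lnX K\<delta> by (intro mult_right_mono) auto
        finally show ?thesis .
      qed
      have lnhl: "ln (hi / lo) = (K + 4) * \<delta> * ln (real X)"
      proof -
        have "hi / lo = real X powr ((K + 4) * \<delta>)" unfolding hi_def lo_def by (simp add: algebra_simps flip: powr_diff)
        thus ?thesis using X by (simp add: ln_powr)
      qed
      have "real (card ?G) \<le> (\<Sum>A\<in>{A\<in>R. real (card A) \<le> 7/10 * L}. real (card (primes_AP X (\<Prod>A))))"
        by (rule real_card_le_sum)
          (use finR finite_primes_upto' in \<open>auto simp: R_def simp del: of_nat_prod\<close>)
      also have "\<dots> \<le> (\<Sum>A\<in>{A\<in>R. real (card A) \<le> 7/10 * L}.
          C1 * (real X / ln (real X)) * exp (7/10 * L * ln 2) * ((1/2) ^ card A / real (\<Prod>A)))"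
      proof (rule sum_mono)
        fix A assume A: "A \<in> {A\<in>R. real (card A) \<le> 7/10 * L}"
        hence AP: "A \<subseteq> ?P" and Ahi: "real (\<Prod>A) \<le> real X powr (7/8)"
          using lohi(3) unfolding R_def by (auto simp del: of_nat_prod)
        have Apos: "real (\<Prod>A) > 0" by (rule rough_subset(4)[OF AP])
        have "real (card (primes_AP X (\<Prod>A))) \<le> C1 * real X / (real (\<Prod>A) * ln (real X))"
          using elim AP Ahi by blast
        also have "\<dots> = C1 * (real X / ln (real X)) * (1 / real (\<Prod>A))" by (simp del: of_nat_prod)
        \<comment> \<open>Rankin's trick: if \<open>card A\<close> is at most 7/10 L, then 2^(7/10 L
          - card A) is at least 1. This trades the restriction on \<open>card A\<close> for the
          weight \<mu> = 1/2, to which the window estimate applies.\<close>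
        also have "\<dots> \<le> C1 * (real X / ln (real X)) * (exp (7/10 * L * ln 2) * ((1/2) ^ card A / real (\<Prod>A)))"
        proof (rule mult_left_mono)
          have "(2::real) ^ card A = exp (real (card A) * ln 2)" by (simp add: exp_of_nat_mult)
          also have "\<dots> \<le> exp (7/10 * L * ln 2)" using A by (auto intro!: mult_right_mono)
          finally have "1 \<le> exp (7/10 * L * ln 2) * (1/2) ^ card A"
            by (simp add: power_one_over divide_simps)
          hence "1 / real (\<Prod>A) \<le> (exp (7/10 * L * ln 2) * (1/2) ^ card A) / real (\<Prod>A)"
            using Apos by (intro divide_right_mono) auto
          thus "1 / real (\<Prod>A) \<le> exp (7/10 * L * ln 2) * ((1/2) ^ card A / real (\<Prod>A))" by simp
        qed (use C1 lnX in auto)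
        finally show "real (card (primes_AP X (\<Prod>A))) \<le>
           C1 * (real X / ln (real X)) * exp (7/10 * L * ln 2) * ((1/2) ^ card A / real (\<Prod>A))" by (simp only: mult.assoc)
      qed
      also have "\<dots> \<le> (\<Sum>A\<in>R. C1 * (real X / ln (real X)) * exp (7/10 * L * ln 2) * ((1/2) ^ card A / real (\<Prod>A)))"
        by (rule sum_mono2[OF finR]) (use C1 lnX in \<open>auto simp del: of_nat_prod\<close>)
      also have "\<dots> = C1 * (real X / ln (real X)) * exp (7/10 * L * ln 2) * (\<Sum>A\<in>R. (1/2) ^ card A / real (\<Prod>A))"
        by (simp only: sum_distrib_left)
      also have "\<dots> \<le> C1 * (real X / ln (real X)) * exp (7/10 * L * ln 2) * (2 * (K + 5) * \<delta> * exp (1/2 * (L + C2)))"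
      proof (rule mult_left_mono)
        have S0: "(\<Sum>A\<in>R. (1/2) ^ card A / real (\<Prod>A)) \<ge> 0" by (intro sum_nonneg) (simp del: of_nat_prod)
        have "1/4 * ln (real X) * (\<Sum>A\<in>R. (1/2) ^ card A / real (\<Prod>A)) \<le> ln lo * (\<Sum>A\<in>R. (1/2) ^ card A / real (\<Prod>A))"
          by (rule mult_right_mono[OF lnlo S0])
        also have "\<dots> \<le> 1/2 * (ln (hi / lo) + C3) * exp (1/2 * (\<Sum>q\<in>?P. 1 / real q))"
          unfolding R_def by (rule C3(2)[OF lohi(1,2)]) simp
        also have "\<dots> \<le> 1/2 * ((K + 5) * \<delta> * ln (real X)) * exp (1/2 * (L + C2))"
        proof (rule mult_mono)
          have "ln (hi / lo) + C3 \<le> (K + 4) * \<delta> * ln (real X) + \<delta> * ln (real X)" using lnhl elim by linarith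
          also have "\<dots> = (K + 5) * \<delta> * ln (real X)" by (simp add: algebra_simps)
          finally show "1/2 * (ln (hi / lo) + C3) \<le> 1/2 * ((K + 5) * \<delta> * ln (real X))" by simp
          show "exp (1/2 * (\<Sum>q\<in>?P. 1 / real q)) \<le> exp (1/2 * (L + C2))" using elim by (simp add: L_def)
        qed (use K \<delta> lnX in auto)
        also have "\<dots> = 1/4 * ln (real X) * (2 * (K + 5) * \<delta> * exp (1/2 * (L + C2)))" by simp
        finally show "(\<Sum>A\<in>R. (1/2) ^ card A / real (\<Prod>A)) \<le> 2 * (K + 5) * \<delta> * exp (1/2 * (L + C2))"
          by (rule mult_left_le_imp_le) (use lnX in simp)
      qed (use C1 lnX in auto)
      also have "\<dots> = 2 * C1 * (K + 5) * (real X / ln (real X)) * (exp (7/10 * L * ln 2) * (\<delta> * exp (1/2 * (L + C2))))"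
        by (simp only: mult_ac)
      finally have G: "real (card ?G) \<le> 2 * C1 * (K + 5) * (real X / ln (real X)) * (exp (7/10 * L * ln 2) * (\<delta> * exp (1/2 * (L + C2))))" .
      \<comment> \<open>Balance of the powers of \<delta>: at least - 49/100 from Rankin's factor, 1
        from the width of the window, - 1/2 from the total weight. What remains is at least
        1/100.\<close>
      have "exp (7/10 * L * ln 2) * (\<delta> * exp (1/2 * (L + C2))) = exp (7/10 * L * ln 2 + (- L + 1/2 * (L + C2)))"
      proof -
        have "\<delta> = exp (- L)" using \<delta> by (simp add: L_def ln_div)
        thus ?thesis by (simp only: exp_add)
      qed
      also have "\<dots> \<le> exp (C2 + (- L / 100))"
      proof -
        have "7/10 * L * ln 2 \<le> 7/10 * L * (7/10)" using L0 ln_2_le_7_10 by (intro mult_left_mono) auto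
        hence "7/10 * L * ln 2 \<le> 49/100 * L" by simp
        moreover have "u + (- L + 1/2 * (L + C2)) \<le> C2 + (- L / 100)" if "u \<le> 49/100 * L" for u
          using that C2(1) by (simp add: field_simps)
        ultimately have "7/10 * L * ln 2 + (- L + 1/2 * (L + C2)) \<le> C2 + (- L / 100)" by blast
        thus ?thesis by simp
      qed
      also have "\<dots> = exp C2 * \<delta> powr (1/100)"
        using \<delta> unfolding exp_add by (simp add: powr_def L_def ln_div)
      finally have "2 * C1 * (K + 5) * (real X / ln (real X)) * (exp (7/10 * L * ln 2) * (\<delta> * exp (1/2 * (L + C2))))
          \<le> 2 * C1 * (K + 5) * (real X / ln (real X)) * (exp C2 * \<delta> powr (1/100))"
        using C1 K lnX by (intro mult_left_mono mult_nonneg_nonneg) auto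
      with G have "real (card ?G) \<le> 2 * C1 * (K + 5) * (real X / ln (real X)) * (exp C2 * \<delta> powr (1/100))"
        by (rule order_trans)
      also have "\<dots> = C * (K + 5) * \<delta> powr (1/100) * (real X / ln (real X))" by (simp add: C_def)
      finally show ?case unfolding lo_def hi_def L_def .
    qed
  qed
  moreover have "C \<ge> 1"
  proof -
    have "1 * 1 \<le> C1 * exp C2" using C1 C2(1) by (intro mult_mono) auto
    thus ?thesis by (simp add: C_def)
  qed
  ultimately show ?thesis by blast
qed

section \<open>Primes of small order\<close>

lemma card_prime_divisors_le:
  assumes "0 < m" "m < 2 ^ c"
  shows "card {p::nat. prime p \<and> p dvd m} \<le> c"
proof -
  let ?B = "{p::nat. prime p \<and> p dvd m}"
  have fin: "finite ?B" by (rule finite_subset[of _ "{d. d dvd m}"]) (use assms in auto)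
  have "\<Prod>?B dvd m" using prod_primes_dvd_iff[OF fin] by auto
  hence "\<Prod>?B \<le> m" using assms by (intro dvd_imp_le) auto
  moreover have "(2::nat) ^ card ?B = (\<Prod>p\<in>?B. 2)" by simp
  moreover have "(\<Prod>p\<in>?B. 2) \<le> \<Prod>?B" by (rule prod_mono) (auto simp: prime_ge_2_nat)
  ultimately have "(2::nat) ^ card ?B < 2 ^ c" using assms by linarith
  thus ?thesis by simp
qed

abbreviation primes_ord_le :: "nat \<Rightarrow> real \<Rightarrow> nat set" where
  "primes_ord_le e y \<equiv> {p. prime p \<and> \<not> p dvd e \<and> real (ord p e) \<le> y}"

text \<open>Each k \<le> y contributes at most e k primes, by e < 2^e, hence the square. The count
  beats X only for y below X^(1/2): this is where the exponent 1/2 comes from.\<close>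

lemma card_primes_order_le:
  assumes e: "e > 1" and y: "y \<ge> 0"
  shows "finite (primes_ord_le e y)"
    and "real (card (primes_ord_le e y)) \<le> real e * y ^ 2"
proof -
  define Y where "Y = nat \<lfloor>y\<rfloor>"
  let ?B = "\<lambda>k. {p::nat. prime p \<and> p dvd e ^ k - 1}"
  have pos: "e ^ k - 1 > 0" if "k \<ge> 1" for k using one_less_power[OF e, of k] that by simp
  have finB: "finite (?B k)" if "k \<in> {1..Y}" for k
    by (rule finite_subset[of _ "{d. d dvd e ^ k - 1}"]) (use pos[of k] that in auto)
  have sub: "(primes_ord_le e y) \<subseteq> (\<Union>k\<in>{1..Y}. ?B k)"
  proof
    fix p assume "p \<in> (primes_ord_le e y)"
    hence p: "prime p" "\<not> p dvd e" "real (ord p e) \<le> y" by auto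
    have "coprime p e" using p by (intro prime_imp_coprime) auto
    hence "ord p e \<ge> 1" using ord_gt_0_iff[of p e] by linarith
    moreover have "ord p e \<le> Y" using p(3) by (simp add: Y_def le_nat_floor)
    moreover have "p dvd e ^ ord p e - 1"
      by (rule cong_to_1_nat) (rule ord)
    ultimately show "p \<in> (\<Union>k\<in>{1..Y}. ?B k)" using p(1) by auto
  qed
  have finU: "finite (\<Union>k\<in>{1..Y}. ?B k)" using finB by blast
  show "finite (primes_ord_le e y)" by (rule finite_subset[OF sub finU])
  have "card (primes_ord_le e y) \<le> card (\<Union>k\<in>{1..Y}. ?B k)"
    by (rule card_mono[OF finU sub])
  also have "\<dots> \<le> (\<Sum>k\<in>{1..Y}. card (?B k))" by (rule card_UN_le) simp
  also have "\<dots> \<le> (\<Sum>k\<in>{1..Y}. e * Y)"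
  proof (rule sum_mono)
    fix k assume k: "k \<in> {1..Y}"
    have "e ^ k > 0" using e by simp
    hence "e ^ k - 1 < e ^ k" by simp
    also have "\<dots> \<le> (2 ^ e) ^ k" by (intro power_mono less_imp_le[OF less_exp]) simp
    finally have "e ^ k - 1 < 2 ^ (e * k)" by (simp add: power_mult)
    hence "card (?B k) \<le> e * k" using pos[of k] k by (intro card_prime_divisors_le) auto
    also have "\<dots> \<le> e * Y" using k by simp
    finally show "card (?B k) \<le> e * Y" .
  qed
  also have "\<dots> = e * Y ^ 2" by (simp add: power2_eq_square)
  finally have "real (card (primes_ord_le e y)) \<le> real (e * Y ^ 2)" by (rule of_nat_mono)
  also have "\<dots> = real e * real Y ^ 2" by simp
  also have "\<dots> \<le> real e * y ^ 2" using y by (intro mult_left_mono power_mono) (auto simp: Y_def)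
  finally show "real (card (primes_ord_le e y)) \<le> real e * y ^ 2" .
qed

lemma card_square_divisible_le:
  fixes S :: "nat set"
  assumes z: "z \<ge> 1" and S: "S \<subseteq> {1..N}"
  shows "real (card {n\<in>S. \<exists>q. real q > z \<and> q ^ 2 dvd n}) \<le> 2 * real N / z"
proof -
  define Z where "Z = nat \<lfloor>z\<rfloor>"
  have Z: "Z \<ge> 1" "real Z \<ge> z / 2"
  proof -
    show Z1: "Z \<ge> 1" using z unfolding Z_def by linarith
    have "z < real Z + 1" using z unfolding Z_def by linarith
    thus "real Z \<ge> z / 2" using of_nat_mono[OF Z1, where ?'a = real] by linarith
  qed
  have "real (card {n\<in>S. \<exists>q. real q > z \<and> q ^ 2 dvd n}) \<le> (\<Sum>q\<in>{Z<..N}. real (card (multiples N (q ^ 2))))"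
  proof (rule real_card_le_sum, goal_cases)
    case 3
    show ?case
    proof
    fix n assume "n \<in> {n\<in>S. \<exists>q. real q > z \<and> q ^ 2 dvd n}"
    then obtain q where q: "n \<in> S" "real q > z" "q ^ 2 dvd n" by blast
    have n: "0 < n" "n \<le> N" using q(1) S by auto
    have "q \<le> q ^ 2" by (simp add: power2_nat_le_imp_le power2_eq_square)
    also have "q ^ 2 \<le> n" using q n by (intro dvd_imp_le)
    finally have "q \<le> N" using n by linarith
    moreover have "Z < q" using q(2) z unfolding Z_def by linarith
    ultimately show "n \<in> (\<Union>q\<in>{Z<..N}. (multiples N (q ^ 2)))" using q n by auto
  qed
  qed (auto intro: finite_subset[of _ "{..N}"])
  also have "\<dots> \<le> (\<Sum>q\<in>{Z<..N}. real N * (1 / real q ^ 2))"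
  proof (rule sum_mono)
    fix q assume "q \<in> {Z<..N}"
    thus "real (card (multiples N (q ^ 2))) \<le> real N * (1 / real q ^ 2)"
      using card_multiples_le[of "q ^ 2" N] by simp
  qed
  also have "\<dots> = real N * (\<Sum>q\<in>{Z<..N}. 1 / real q ^ 2)" by (simp only: sum_distrib_left)
  also have "\<dots> \<le> real N * (1 / real Z)" by (intro mult_left_mono sum_inverse_squares_tail_le Z) simp
  also have "\<dots> \<le> real N * (1 / (z / 2))" using Z z by (intro mult_left_mono divide_left_mono) auto
  also have "\<dots> = 2 * real N / z" by simp
  finally show ?thesis .
qed

lemma ord_dvd_prime_minus_1:
  assumes "prime p" "\<not> p dvd e"
  shows "ord p e dvd p - 1" and "ord p e > 0"
proof -
  have cop: "coprime p e" using assms by (intro prime_imp_coprime) auto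
  show "ord p e dvd p - 1"
    using order_divides_totient[OF cop] assms(1) by (simp add: totient_prime)
  show "ord p e > 0" using cop by simp
qed

text \<open>Write p - 1 = l b with l the order. No rough prime divides both factors, as its square
  would divide p - 1, so their numbers of rough primes add up to at most 7/5 L. Of the K + 3 in the
  exponent, 3 is needed for the cofactor b and K for replacing a factor by its rough part.\<close>

lemma middle_divisor_of_order:
  fixes \<delta> K :: real and X p e :: nat
  assumes X: "X \<ge> 2" "real X powr \<delta> \<ge> 2" and \<delta>: "\<delta> > 0" and p: "prime p" "p \<le> X" "real p > real X powr (1 - \<delta>)" "\<not> p dvd e"
    and ord: "real (ord p e) > real X powr (1/2 - \<delta>)" "real (ord p e) \<le> real X powr (1/2 + \<delta>)"
    and sqf: "\<And>q. real q > real X powr \<delta> \<Longrightarrow> \<not> q ^ 2 dvd p - 1"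
    and smooth: "smooth_log (real X powr \<delta>) (p - 1) \<le> K * \<delta> * ln (real X)"
    and omega: "real (card {q\<in>rough_primes \<delta> X. q dvd p - 1}) \<le> 7/5 * L"
  shows "\<exists>A\<subseteq>rough_primes \<delta> X. real X powr (1/2 - (K + 3) * \<delta>) \<le> real (\<Prod>A) \<and> real (\<Prod>A) \<le> real X powr (1/2 + \<delta>) \<and>
            real (card A) \<le> 7/10 * L \<and> \<Prod>A dvd p - 1"
proof -
  define z where "z = real X powr \<delta>"
  define l where "l = ord p e"
  obtain b where b: "p - 1 = l * b" using ord_dvd_prime_minus_1(1)[OF p(1,4)] unfolding l_def by blast
  have p1: "p - 1 > 0" using prime_gt_1_nat[OF p(1)] by simp
  have pos: "l > 0" "b > 0" using b p1 by (auto intro!: Nat.gr0I)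
  define A where "A m = {q\<in>rough_primes \<delta> X. q dvd m}" for m
  have AP: "A m \<subseteq> rough_primes \<delta> X" for m by (auto simp: A_def)
  have window: "real X powr (1/2 - (K + 3) * \<delta>) \<le> real (\<Prod>(A m)) \<and> real (\<Prod>(A m)) \<le> real X powr (1/2 + \<delta>) \<and> \<Prod>(A m) dvd p - 1"
    if m: "m dvd p - 1" "m > 0" "real X powr (1/2 - 3 * \<delta>) \<le> real m" "real m \<le> real X powr (1/2 + \<delta>)" for m
  proof -
    note R = rough_subset[OF AP[of m]]
    have dvd: "\<Prod>(A m) dvd m" using prod_primes_dvd_iff[OF R(1,2)] by (auto simp: A_def)
    have "m \<le> p - 1" using m p1 by (intro dvd_imp_le) auto
    hence mX: "m \<le> X" using p(2) by linarith
    have Aeq: "A m = {q. prime q \<and> real q > z \<and> q dvd m}"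
    proof -
      have "q \<le> X" if "q dvd m" for q using dvd_imp_le[OF that m(2)] mX by linarith
      thus ?thesis by (auto simp: A_def rough_primes_def z_def)
    qed
    have "\<not> q ^ 2 dvd m" if "real q > z" for q using sqf[of q] that m(1) dvd_trans unfolding z_def by blast
    hence "ln (real m) = smooth_log z m + (\<Sum>q\<in>A m. ln (real q))"
      unfolding Aeq using m(2) by (intro ln_eq_smooth_log_plus)
    hence "ln (real m) = smooth_log z m + ln (real (\<Prod>(A m)))" by (simp only: R(6))
    moreover have "smooth_log z m \<le> K * \<delta> * ln (real X)"
      using smooth_log_mono[OF m(1) p1, of z] smooth unfolding z_def by linarith
    moreover have "(1/2 - 3 * \<delta>) * ln (real X) \<le> ln (real m)"
    proof -
      have "ln (real X powr (1/2 - 3 * \<delta>)) \<le> ln (real m)" using m X by (intro ln_mono) auto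
      thus ?thesis using X by (simp add: ln_powr)
    qed
    ultimately have "(1/2 - 3 * \<delta>) * ln (real X) - K * \<delta> * ln (real X) \<le> ln (real (\<Prod>(A m)))" by linarith
    hence "ln (real X powr (1/2 - (K + 3) * \<delta>)) \<le> ln (real (\<Prod>(A m)))"
      using X by (simp add: ln_powr algebra_simps del: of_nat_prod)
    hence "real X powr (1/2 - (K + 3) * \<delta>) \<le> real (\<Prod>(A m))"
      using X R(4) by (subst (asm) ln_le_cancel_iff) auto
    moreover have "real (\<Prod>(A m)) \<le> real m" using dvd m(2) by (intro of_nat_mono dvd_imp_le)
    ultimately show ?thesis using m(1,4) dvd dvd_trans by (meson order_trans)
  qed
  have powr_le: "real X powr a \<le> real X powr c" if "a \<le> c" for a c using that X by (intro powr_mono) auto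
  have wl: "real X powr (1/2 - 3 * \<delta>) \<le> real l" "real l \<le> real X powr (1/2 + \<delta>)"
    using ord powr_le[of "1/2 - 3 * \<delta>" "1/2 - \<delta>"] \<delta> unfolding l_def by auto
  have lb: "real (p - 1) = real l * real b" using b by (metis of_nat_mult)
  have wb1: "real b \<le> real X powr (1/2 + \<delta>)"
  proof -
    have "real X powr (1/2 - \<delta>) * real b \<le> real l * real b" using ord unfolding l_def by (intro mult_right_mono) auto
    also have "\<dots> \<le> real X" using lb p(2) by simp
    also have "\<dots> = real X powr (1/2 - \<delta>) * real X powr (1/2 + \<delta>)" using X by (simp flip: powr_add)
    finally show ?thesis using X by simp
  qed
  \<comment> \<open>From p - 1 \<ge> X^(1 - \<delta>) / 2 and l \<le> X^(1/2 + \<delta>) one gets b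
    \<ge> X^(1/2 - 2 \<delta>) / 2; a third \<delta> absorbs the factor 2.\<close>
  have wb2: "real X powr (1/2 - 3 * \<delta>) \<le> real b"
  proof -
    have "real X powr (1/2 + \<delta>) * real X powr (1/2 - 3 * \<delta>) * real X powr \<delta> = real X powr (1 - \<delta>)"
      by (simp flip: powr_add)
    also have "\<dots> \<le> 2 * real (p - 1)" using p(3) prime_ge_2_nat[OF p(1)] by (simp add: of_nat_diff)
    also have "\<dots> \<le> real (p - 1) * real X powr \<delta>" using X mult_left_mono[OF X(2), of "real (p - 1)"] by simp
    finally have "real X powr (1/2 + \<delta>) * real X powr (1/2 - 3 * \<delta>) \<le> real (p - 1)"
      using X by (simp add: mult_le_cancel_right)
    also have "\<dots> \<le> real X powr (1/2 + \<delta>) * real b" unfolding lb using wl by (intro mult_right_mono) auto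
    finally show ?thesis using X by (simp add: mult_le_cancel_left)
  qed
  have "card (A l) + card (A b) = card (A l \<union> A b)"
  proof (rule card_Un_disjoint[symmetric])
    show "A l \<inter> A b = {}"
    proof (rule ccontr)
      assume "A l \<inter> A b \<noteq> {}"
      then obtain q where q: "q \<in> rough_primes \<delta> X" "q dvd l" "q dvd b" by (auto simp: A_def)
      hence "q ^ 2 dvd p - 1" unfolding b power2_eq_square by (intro mult_dvd_mono)
      thus False using sqf[of q] q(1) by (auto simp: rough_primes_def)
    qed
  qed (use rough_subset(1)[OF AP] in auto)
  also have "\<dots> \<le> card {q\<in>rough_primes \<delta> X. q dvd p - 1}"
    by (rule card_mono) (auto simp: A_def b simp del: One_nat_def)
  finally have "real (card (A l)) + real (card (A b)) \<le> 7/5 * L" using omega by linarith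
  hence "real (card (A l)) \<le> 7/10 * L \<or> real (card (A b)) \<le> 7/10 * L" by linarith
  thus ?thesis
  proof
    assume "real (card (A l)) \<le> 7/10 * L"
    thus ?thesis using window[of l] wl pos b AP by (intro exI[of _ "A l"]) simp
  next
    assume "real (card (A b)) \<le> 7/10 * L"
    thus ?thesis using window[of b] wb1 wb2 pos b AP by (intro exI[of _ "A b"]) simp
  qed
qed

abbreviation low_order_primes :: "nat \<Rightarrow> real \<Rightarrow> nat \<Rightarrow> nat set" where
  "low_order_primes e \<delta> X \<equiv>
     {p. prime p \<and> p \<le> X \<and> \<not> p dvd e \<and> real (ord p e) \<le> real X powr (1/2 + \<delta>)}"

text \<open>K is fixed in terms of \<eta> through the bound Ca / K, and then \<delta> is made so
  small that \<delta>^(1/100) also beats the factor K + 5. Six exceptional sets, each with a share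
  of at most \<eta> / 8, cover the primes of small order.\<close>

theorem small_order_primes:
  fixes e :: nat and \<eta> :: real
  assumes e: "e > 1" and \<eta>: "\<eta> > 0"
  shows "\<exists>\<delta>>0. sparse (low_order_primes e \<delta>) \<eta>"
proof -
  obtain Ca where Ca: "Ca \<ge> 1" "\<And>\<delta> K. 0 < \<delta> \<Longrightarrow> \<delta> \<le> 1/4 \<Longrightarrow> 0 < K \<Longrightarrow>
     (sparse (smooth_shift_primes \<delta> K) (Ca / K))"
    using primes_smooth_shift by blast
  obtain Cb where Cb: "Cb \<ge> 1" "\<And>\<delta>. 0 < \<delta> \<Longrightarrow> \<delta> < 1 \<Longrightarrow>
     (sparse (many_factor_primes \<delta>) (Cb * \<delta> powr (1/100)))"
    using primes_many_rough_factors by blast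
  obtain Cc where Cc: "Cc \<ge> 1" "\<And>\<delta> K. 0 < \<delta> \<Longrightarrow> 1 \<le> K \<Longrightarrow> (K + 3) * \<delta> \<le> 1/4 \<Longrightarrow>
     (sparse (middle_divisor_primes \<delta> K) (Cc * (K + 5) * \<delta> powr (1/100)))"
    using primes_middle_divisor by blast
  define K where "K = 1 + 8 * Ca / \<eta>"
  have K: "K \<ge> 1" "Ca / K \<le> \<eta> / 8"
  proof -
    show "K \<ge> 1" using Ca(1) \<eta> by (simp add: K_def)
    have "Ca / K \<le> Ca / (8 * Ca / \<eta>)" using Ca(1) \<eta> by (intro divide_left_mono) (auto simp: K_def add_pos_pos)
    also have "\<dots> = \<eta> / 8" using Ca(1) by simp
    finally show "Ca / K \<le> \<eta> / 8" .
  qed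
  have "\<forall>\<^sub>F \<delta> in at_right (0::real). Cb * \<delta> powr (1/100) \<le> \<eta> / 8 \<and> Cc * (K + 5) * \<delta> powr (1/100) \<le> \<eta> / 8 \<and>
      (K + 3) * \<delta> \<le> 1/4 \<and> \<delta> > 0"
    using \<eta> by (intro eventually_conj; real_asymp)
  then obtain \<delta> :: real where \<delta>: "Cb * \<delta> powr (1/100) \<le> \<eta> / 8" "Cc * (K + 5) * \<delta> powr (1/100) \<le> \<eta> / 8"
      "(K + 3) * \<delta> \<le> 1/4" "\<delta> > 0"
    using eventually_happens'[OF trivial_limit_at_right_real] by blast
  have "4 * \<delta> \<le> (K + 3) * \<delta>" using K \<delta> by (intro mult_right_mono) auto
  hence \<delta>16: "\<delta> \<le> 1/16" using \<delta>(3) by linarith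
  have ev: "\<forall>\<^sub>F X in sequentially. real X \<ge> 2 \<and> real X powr \<delta> \<ge> 2 \<and> real X powr (1 - \<delta>) \<le> \<eta> / 8 * (real X / ln (real X)) \<and>
      real e * (real X powr (1/2 - \<delta>)) ^ 2 \<le> \<eta> / 8 * (real X / ln (real X)) \<and>
      2 * real X / real X powr \<delta> \<le> \<eta> / 8 * (real X / ln (real X))"
    using \<eta> \<delta>(4) by (intro eventually_conj; real_asymp)
  have small: "\<delta> \<le> 1/4" "K > 0" "\<delta> < 1" using \<delta>16 K by auto
  have "sparse (low_order_primes e \<delta>) \<eta>"
    using ev Ca(2)[OF \<delta>(4) small(1,2)] Cb(2)[OF \<delta>(4) small(3)] Cc(2)[OF \<delta>(4) K(1) \<delta>(3)]
  proof eventually_elim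
    case (elim X)
    define U where "U = real X / ln (real X)"
    define z where "z = real X powr \<delta>"
    have X: "X \<ge> 2" "z \<ge> 2" using elim(1) by (auto simp: z_def)
    have U0: "U \<ge> 0" using X by (simp add: U_def)
    let ?G = "(low_order_primes e \<delta> X)"
    define S0 where "S0 = {p. prime p \<and> p \<le> X \<and> real p \<le> real X powr (1 - \<delta>)}"
    define S1 where "S1 = {p. prime p \<and> \<not> p dvd e \<and> real (ord p e) \<le> real X powr (1/2 - \<delta>)}"
    define S2 where "S2 = {p. prime p \<and> p \<le> X \<and> (\<exists>q. real q > z \<and> q ^ 2 dvd p - 1)}"
    define S3 where "S3 = {p. prime p \<and> p \<le> X \<and> smooth_log z (p - 1) > K * \<delta> * ln (real X)}"
    define S4 where "S4 = (many_factor_primes \<delta> X)"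
    define S5 where "S5 = (middle_divisor_primes \<delta> K X)"
    have c0: "real (card S0) \<le> \<eta> / 8 * U"
    proof -
      have "real (card S0) \<le> real X powr (1 - \<delta>)"
        by (rule card_le_real) (auto simp: S0_def prime_gt_0_nat)
      also have "\<dots> \<le> \<eta> / 8 * U" using elim(1) unfolding U_def by blast
      finally show ?thesis .
    qed
    have c1: "real (card S1) \<le> \<eta> / 8 * U"
    proof -
      have "real (card S1) \<le> real e * (real X powr (1/2 - \<delta>)) ^ 2"
        unfolding S1_def by (rule card_primes_order_le(2)[OF e]) simp
      also have "\<dots> \<le> \<eta> / 8 * U" using elim(1) unfolding U_def by blast
      finally show ?thesis .
    qed
    have c2: "real (card S2) \<le> \<eta> / 8 * U"
    proof -
      have "card S2 \<le> card {n\<in>{1..X}. \<exists>q. real q > z \<and> q ^ 2 dvd n}"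
      proof (rule card_inj_on_le)
        show "inj_on (\<lambda>p. p - 1) S2" by (rule inj_on_pred_primes) (simp add: S2_def)
        show "(\<lambda>p. p - 1) ` S2 \<subseteq> {n\<in>{1..X}. \<exists>q. real q > z \<and> q ^ 2 dvd n}"
        proof (rule image_subsetI)
          fix p assume "p \<in> S2"
          thus "p - 1 \<in> {n\<in>{1..X}. \<exists>q. real q > z \<and> q ^ 2 dvd n}"
            using prime_gt_1_nat[of p] by (auto simp: S2_def)
        qed
      qed simp
      also have "real (card {n\<in>{1..X}. \<exists>q. real q > z \<and> q ^ 2 dvd n}) \<le> 2 * real X / z"
        by (rule card_square_divisible_le) (use X in auto)
      also have "\<dots> \<le> \<eta> / 8 * U" using elim(1) unfolding U_def z_def by blast
      finally show ?thesis by simp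
    qed
    have c3: "real (card S3) \<le> \<eta> / 8 * U"
      using elim(2) mult_right_mono[OF K(2) U0] unfolding S3_def z_def U_def by linarith
    have c4: "real (card S4) \<le> \<eta> / 8 * U"
      using elim(3) mult_right_mono[OF \<delta>(1) U0] unfolding S4_def U_def by linarith
    have c5: "real (card S5) \<le> \<eta> / 8 * U"
      using elim(4) mult_right_mono[OF \<delta>(2) U0] unfolding S5_def U_def by linarith
    have "?G \<subseteq> S0 \<union> (S1 \<union> (S2 \<union> (S3 \<union> (S4 \<union> S5))))"
    proof
      fix p assume p: "p \<in> ?G"
      show "p \<in> S0 \<union> (S1 \<union> (S2 \<union> (S3 \<union> (S4 \<union> S5))))"
      proof (rule ccontr)
        assume np: "p \<notin> S0 \<union> (S1 \<union> (S2 \<union> (S3 \<union> (S4 \<union> S5))))"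
        have "\<exists>A\<subseteq>rough_primes \<delta> X. real X powr (1/2 - (K + 3) * \<delta>) \<le> real (\<Prod>A) \<and> real (\<Prod>A) \<le> real X powr (1/2 + \<delta>) \<and>
            real (card A) \<le> 7/10 * ln (1 / \<delta>) \<and> \<Prod>A dvd p - 1"
        proof (rule middle_divisor_of_order[where e = e])
          show "real X powr (1 - \<delta>) < real p" using p np by (auto simp: S0_def)
          show "real X powr (1/2 - \<delta>) < real (ord p e)" using p np by (auto simp: S1_def)
          show "\<not> q ^ 2 dvd p - 1" if "real X powr \<delta> < real q" for q using p np that unfolding S2_def z_def by blast
          show "smooth_log (real X powr \<delta>) (p - 1) \<le> K * \<delta> * ln (real X)"
            using p np unfolding S3_def z_def by force
          show "real (card {q \<in> rough_primes \<delta> X. q dvd p - 1}) \<le> 7/5 * ln (1 / \<delta>)"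
            using p np unfolding S4_def by force
        qed (use p X \<delta>(4) in \<open>auto simp: z_def\<close>)
        thus False using p np unfolding S5_def by blast
      qed
    qed
    moreover have "finite S0" "finite S2" "finite S3" "finite S4" "finite S5"
      unfolding S0_def S2_def S3_def S4_def S5_def by (rule finite_primes_upto')+
    moreover have "finite S1" unfolding S1_def by (rule card_primes_order_le(1)[OF e]) simp
    ultimately have "card ?G \<le> card (S0 \<union> (S1 \<union> (S2 \<union> (S3 \<union> (S4 \<union> S5)))))" by (intro card_mono) auto
    also have "\<dots> \<le> card S0 + (card S1 + (card S2 + (card S3 + (card S4 + card S5))))"
      by (intro order_trans[OF card_Un_le] add_left_mono order_refl)
    finally have "real (card ?G) \<le> real (card S0) + (real (card S1) + (real (card S2) + (real (card S3) + (real (card S4) + real (card S5)))))"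
      by linarith
    also have "\<dots> \<le> 6 * (\<eta> / 8 * U)" using c0 c1 c2 c3 c4 c5 by linarith
    also have "\<dots> \<le> \<eta> * U" using \<eta> U0 by simp
    finally show ?case by (simp add: U_def)
  qed
  thus ?thesis using \<delta>(4) by blast
qed

section \<open>From primes to integers\<close>

text \<open>Dyadic decomposition: a block of primes beyond x^u accounts for at most 2 \<eta> x / (u
  ln x) integers, and there are at most 3 ln x blocks. Partial summation would replace 1 / u by a
  logarithm, but in each application the density is chosen after u.\<close>

lemma card_divisible_by_sparse_primes:
  fixes Q :: "nat set" and \<eta> u :: real
  assumes \<eta>: "\<eta> > 0" and u: "0 < u"
  assumes sparse: "sparse (\<lambda>X. {p\<in>Q. p \<le> X}) \<eta>"
  shows "\<forall>\<^sub>F x in sequentially. real (card {n. 0 < n \<and> n \<le> x \<and> (\<exists>p\<in>Q. real p > real x powr u \<and> p dvd n)})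
           \<le> 6 * \<eta> / u * real x"
proof -
  obtain X0 where X0: "\<And>X. X \<ge> X0 \<Longrightarrow> real (card {p\<in>Q. p \<le> X}) \<le> \<eta> * (real X / ln (real X))"
    using sparse by (auto simp: eventually_sequentially)
  have "\<forall>\<^sub>F x in sequentially. real x \<ge> 3 \<and> real x powr u \<ge> real X0" using u by (intro eventually_conj; real_asymp)
  thus ?thesis
  proof eventually_elim
    case (elim x)
    have x3: "x \<ge> 3" using elim by simp
    have lnx: "ln (real x) \<ge> 1"
    proof -
      have "exp 1 \<le> real x" using exp_le elim by linarith
      thus ?thesis using x3 by (subst ln_ge_iff) auto
    qed
    define J where "J = nat \<lfloor>2 * ln (real x)\<rfloor>"
    \<comment> \<open>A block is kept if its upper end exceeds x^u. The density hypothesis is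
      applied at that upper end, whose logarithm is then at least u ln x.\<close>
    define I where "I = {j\<in>{0..J}. real (2 ^ Suc j) > real x powr u}"
    define M where "M p = (multiples x p)" for p :: nat
    define Qj where "Qj j = {p\<in>Q. 2 ^ j \<le> p \<and> p < 2 ^ Suc j}" for j :: nat
    have finQ: "finite (Qj j)" for j unfolding Qj_def by (rule finite_subset[of _ "{..2 ^ Suc j}"]) auto
    have finM: "finite (M p)" for p unfolding M_def by (rule finite_subset[of _ "{..x}"]) auto
    have finI: "finite I" by (simp add: I_def)
    let ?G = "{n. 0 < n \<and> n \<le> x \<and> (\<exists>p\<in>Q. real p > real x powr u \<and> p dvd n)}"
    have "?G \<subseteq> (\<Union>j\<in>I. \<Union>p\<in>Qj j. M p)"
    proof
      fix n assume "n \<in> ?G"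
      then obtain p where p: "0 < n" "n \<le> x" "p \<in> Q" "real p > real x powr u" "p dvd n" by blast
      have px: "p \<le> x" using p dvd_imp_le[of p n] by linarith
      have "real p > 0" using p(4) powr_ge_zero[of "real x" u] by linarith
      then obtain j where j: "2 ^ j \<le> p" "p < 2 ^ (j + 1)" using ex_power_ivl1[of 2 p] by auto
      have "j \<le> J"
      proof -
        have "real j * (1/2) \<le> real j * ln 2" using half_le_ln_2 by (intro mult_left_mono) auto
        also have "\<dots> = ln (2 ^ j)" by (simp add: ln_realpow)
        also have "\<dots> \<le> ln (real x)"
        proof (rule ln_mono)
          have "(2::nat) ^ j \<le> x" using j px by linarith
          thus "(2::real) ^ j \<le> real x" by (metis of_nat_le_iff of_nat_numeral of_nat_power)
        qed simp
        finally show ?thesis unfolding J_def by (intro le_nat_floor) simp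
      qed
      moreover have "real x powr u < real (2 ^ Suc j)" using p(4) j(2) by (simp del: of_nat_power add: order_less_trans)
      ultimately have "j \<in> I" by (simp add: I_def del: of_nat_power)
      thus "n \<in> (\<Union>j\<in>I. \<Union>p\<in>Qj j. M p)" using j p by (auto simp: Qj_def M_def)
    qed
    hence "real (card ?G) \<le> (\<Sum>j\<in>I. real (card (\<Union>p\<in>Qj j. M p)))"
      by (rule real_card_le_sum[OF finI, rotated]) (use finQ finM in auto)
    also have "\<dots> \<le> (\<Sum>j\<in>I. \<Sum>p\<in>Qj j. real (card (M p)))"
      by (intro sum_mono real_card_le_sum finQ finM order_refl)
    also have "\<dots> \<le> (\<Sum>j\<in>I. 2 * \<eta> * real x / (u * ln (real x)))"
    proof (rule sum_mono)
      fix j assume j: "j \<in> I"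
      have "(\<Sum>p\<in>Qj j. real (card (M p))) \<le> (\<Sum>p\<in>Qj j. real x / 2 ^ j)"
      proof (rule sum_mono)
        fix p assume p: "p \<in> Qj j"
        have p0: "p > 0" "(2::real) ^ j \<le> real p"
        proof -
          have "2 ^ j \<le> p" using p by (simp add: Qj_def)
          thus "(2::real) ^ j \<le> real p" by (metis of_nat_le_iff of_nat_numeral of_nat_power)
          thus "p > 0" using zero_less_power[of "2::real" j] by linarith
        qed
        have "real (card (M p)) \<le> real x / real p" unfolding M_def by (rule card_multiples_le[OF p0(1)])
        also have "\<dots> \<le> real x / 2 ^ j" using p0 by (intro divide_left_mono) auto
        finally show "real (card (M p)) \<le> real x / 2 ^ j" .
      qed
      also have "\<dots> = real (card (Qj j)) * (real x / 2 ^ j)" by simp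
      also have "\<dots> \<le> \<eta> * (real (2 ^ Suc j) / ln (real (2 ^ Suc j))) * (real x / 2 ^ j)"
      proof (rule mult_right_mono)
        have "real X0 < real (2 ^ Suc j)" using elim j by (simp add: I_def del: of_nat_power)
        hence "X0 < 2 ^ Suc j" by (simp only: of_nat_less_iff)
        hence "real (card {p\<in>Q. p \<le> 2 ^ Suc j}) \<le> \<eta> * (real (2 ^ Suc j) / ln (real (2 ^ Suc j)))"
          by (intro X0 less_imp_le)
        moreover have "card (Qj j) \<le> card {p\<in>Q. p \<le> 2 ^ Suc j}"
          by (rule card_mono) (auto simp: Qj_def intro: finite_subset[of _ "{..2 ^ Suc j}"])
        ultimately show "real (card (Qj j)) \<le> \<eta> * (real (2 ^ Suc j) / ln (real (2 ^ Suc j)))" by linarith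
      qed simp
      also have "\<dots> = 2 * \<eta> * real x / ln (real (2 ^ Suc j))" by simp
      also have "\<dots> \<le> 2 * \<eta> * real x / (u * ln (real x))"
      proof (rule divide_left_mono)
        have "ln (real x powr u) \<le> ln (real (2 ^ Suc j))" using j x3 by (intro ln_mono) (auto simp: I_def)
        thus le: "u * ln (real x) \<le> ln (real (2 ^ Suc j))" using x3 by (simp add: ln_powr del: of_nat_power)
        have "0 < u * ln (real x)" using lnx u by simp
        thus "0 < ln (real (2 ^ Suc j)) * (u * ln (real x))" using le by (meson mult_pos_pos order_less_le_trans)
      qed (use \<eta> in auto)
      finally show "(\<Sum>p\<in>Qj j. real (card (M p))) \<le> 2 * \<eta> * real x / (u * ln (real x))" .
    qed
    also have "\<dots> = real (card I) * (2 * \<eta> * real x / (u * ln (real x)))" by simp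
    also have "\<dots> \<le> (3 * ln (real x)) * (2 * \<eta> * real x / (u * ln (real x)))"
    proof (rule mult_right_mono)
      have "card I \<le> card {0..J}" by (rule card_mono) (auto simp: I_def)
      hence "real (card I) \<le> real J + 1" by simp
      also have "real J \<le> 2 * ln (real x)" using lnx by (simp add: J_def)
      finally show "real (card I) \<le> 3 * ln (real x)" using lnx by linarith
    qed (use \<eta> u lnx in auto)
    also have "\<dots> = 6 * \<eta> / u * real x" using lnx by simp
    finally show ?case .
  qed
qed

text \<open>The mean of \<open>smooth_log\<close> at level z = x^u over n \<le> x is at most ln z +
  O(1), hence at most 2 u ln x for large x; then Markov's inequality.\<close>

lemma card_large_smooth_part:
  fixes u v :: real
  assumes u: "0 < u" and v: "0 < v"
  shows "\<forall>\<^sub>F x in sequentially. real (card {n. 0 < n \<and> n \<le> x \<and> smooth_log (real x powr u) n > v * ln (real x)}) \<le> 2 * u / v * real x"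
proof -
  obtain C2 where C2: "C2 \<ge> 0" "\<And>(z::real) N. z \<ge> 1 \<Longrightarrow>
      smooth_mangoldt_sum z N \<le> ln z + C2"
    using mangoldt_smooth_sum_le by blast
  have "\<forall>\<^sub>F x in sequentially. real x \<ge> 2 \<and> C2 \<le> u * ln (real x)" using u by (intro eventually_conj; real_asymp)
  thus ?thesis
  proof eventually_elim
    case (elim x)
    define z where "z = real x powr u"
    let ?D = "{d. d \<in> {1..x} \<and> primepow d \<and> real (aprimedivisor d) \<le> z}"
    let ?G = "{n. 0 < n \<and> n \<le> x \<and> smooth_log z n > v * ln (real x)}"
    have x2: "x \<ge> 2" using elim by simp
    have lnx: "ln (real x) > 0" using x2 by simp
    have z1: "z \<ge> 1" using x2 u by (simp add: z_def ge_one_powr_ge_zero)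
    have finD: "finite ?D" by (rule finite_subset[of _ "{1..x}"]) auto
    have finG: "finite ?G" by (rule finite_subset[of _ "{..x}"]) auto
    have "real (card ?G) * (v * ln (real x)) \<le> (\<Sum>d\<in>?D. mangoldt d * real (card {n\<in>?G. d dvd n}))"
      by (rule smooth_log_markov[OF finG]) auto
    also have "\<dots> \<le> (\<Sum>d\<in>?D. real x * (mangoldt d / real d))"
    proof (rule sum_mono)
      fix d assume d: "d \<in> ?D"
      have "mangoldt d * real (card {n\<in>?G. d dvd n}) \<le> mangoldt d * real (card (multiples x d))"
        by (intro mult_left_mono of_nat_mono card_mono mangoldt_nonneg) (auto intro: finite_subset[of _ "{..x}"])
      also have "\<dots> \<le> mangoldt d * (real x / real d)"
        by (intro mult_left_mono card_multiples_le mangoldt_nonneg) (use d in auto)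
      finally show "mangoldt d * real (card {n\<in>?G. d dvd n}) \<le> real x * (mangoldt d / real d)" by (simp add: mult.commute)
    qed
    also have "\<dots> \<le> (\<Sum>d | d \<in> {1..x} \<and> real (aprimedivisor d) \<le> z. real x * (mangoldt d / real d))"
      by (rule sum_mono2) (auto intro!: mult_nonneg_nonneg divide_nonneg_nonneg mangoldt_nonneg)
    also have "\<dots> = real x * smooth_mangoldt_sum z x" by (simp only: sum_distrib_left)
    also have "\<dots> \<le> real x * (ln z + C2)" by (intro mult_left_mono C2(2)[OF z1]) simp
    also have "\<dots> \<le> real x * (2 * (u * ln (real x)))" using elim x2 by (intro mult_left_mono) (auto simp: z_def ln_powr)
    finally have "(real (card ?G) * v) * ln (real x) \<le> (2 * u * real x) * ln (real x)" by (simp only: mult_ac)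
    hence "real (card ?G) * v \<le> 2 * u * real x" using lnx by (rule mult_right_le_imp_le)
    hence "real (card ?G) \<le> 2 * u * real x / v" using v by (simp add: pos_le_divide_eq)
    thus ?case by (simp add: z_def)
  qed
qed

section \<open>Common factors of the numbers p - 1\<close>

lemma harmonic_le: "n \<ge> 1 \<Longrightarrow> (\<Sum>k=1..n. 1 / real k) \<le> 1 + ln (real n)"
proof (induction n rule: dec_induct)
  case (step n)
  have "ln (real n) - ln (real (Suc n)) \<le> (real n - real (Suc n)) / real (Suc n)"
    using step by (intro ln_diff_le) auto
  hence "1 / real (Suc n) \<le> ln (real (Suc n)) - ln (real n)" by (simp add: diff_divide_distrib)
  thus ?case using step by simp
qed simp

text \<open>With g the gcd, p = g i + 1 and q = g j + 1, so at most x / (g^2 i j) integers are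
  divisible by p q. Summing over i, j and g > Z gives about x (ln x)^2 / Z, and the cube of ln x
  makes this o(x).\<close>

lemma card_large_shifted_gcd:
  fixes \<eta> :: real
  assumes \<eta>: "\<eta> > 0"
  shows "\<forall>\<^sub>F x in sequentially. real (card {n. 0 < n \<and> n \<le> x \<and> (\<exists>p q. prime p \<and> prime q \<and> p \<noteq> q \<and> p dvd n \<and> q dvd n \<and>
           real (gcd (p - 1) (q - 1)) > ln (real x) ^ 3)}) \<le> \<eta> * real x"
proof -
  have "\<forall>\<^sub>F x in sequentially. real x \<ge> 3 \<and> ln (real x) ^ 3 \<ge> 2 \<and> 2 * (1 + ln (real x)) ^ 2 \<le> \<eta> * ln (real x) ^ 3"
    using \<eta> by (intro eventually_conj; real_asymp)
  thus ?thesis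
  proof eventually_elim
    case (elim x)
    have x3: "x \<ge> 3" using elim by simp
    define Z where "Z = nat \<lfloor>ln (real x) ^ 3\<rfloor>"
    have Z: "Z \<ge> 1" "real Z \<ge> ln (real x) ^ 3 / 2"
    proof -
      show Z1: "Z \<ge> 1" using elim unfolding Z_def by linarith
      have "ln (real x) ^ 3 < real Z + 1" using elim unfolding Z_def by linarith
      thus "real Z \<ge> ln (real x) ^ 3 / 2" using of_nat_mono[OF Z1, where ?'a = real] by linarith
    qed
    let ?G = "{n. 0 < n \<and> n \<le> x \<and> (\<exists>p q. prime p \<and> prime q \<and> p \<noteq> q \<and> p dvd n \<and> q dvd n \<and> real (gcd (p - 1) (q - 1)) > ln (real x) ^ 3)}"
    define T where "T = {Z<..x} \<times> {1..x} \<times> {1..x}"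
    define M where "M t = (case t of (g, i, j) \<Rightarrow> {n. 0 < n \<and> n \<le> x \<and> (g * i + 1) * (g * j + 1) dvd n})" for t :: "nat \<times> nat \<times> nat"
    have finT: "finite T" by (simp add: T_def)
    have finM: "finite (M t)" for t unfolding M_def by (cases t) (auto intro: finite_subset[of _ "{..x}"])
    have "real (card ?G) \<le> (\<Sum>t\<in>T. real (card (M t)))"
    proof (rule real_card_le_sum[OF finT finM], rule subsetI)
      fix n assume "n \<in> ?G"
      then obtain p q where n: "0 < n" "n \<le> x" and pq: "prime p" "prime q" "p \<noteq> q" "p dvd n" "q dvd n"
        "real (gcd (p - 1) (q - 1)) > ln (real x) ^ 3" by blast
      define g where "g = gcd (p - 1) (q - 1)"
      have p1: "p > 1" "q > 1" using pq prime_gt_1_nat by auto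
      have "p \<le> n" "q \<le> n" using pq n dvd_imp_le by auto
      hence px: "p \<le> x" "q \<le> x" using n by auto
      obtain i where i: "p - 1 = g * i" unfolding g_def by (metis dvdE gcd_dvd1)
      obtain j where j: "q - 1 = g * j" unfolding g_def by (metis dvdE gcd_dvd2)
      have ij: "i > 0" "j > 0" "g > 0" using i j p1 by (auto intro!: Nat.gr0I)
      have le: "g \<le> x" "i \<le> x" "j \<le> x"
      proof -
        have "g \<le> g * i" "i \<le> g * i" "j \<le> g * j" using ij by auto
        thus "g \<le> x" "i \<le> x" "j \<le> x" using i j px by linarith+
      qed
      have "Z < g" using pq(6) elim unfolding Z_def g_def by linarith
      hence T: "(g, i, j) \<in> T" using ij le by (simp add: T_def)
      have "p * q dvd n" using pq by (intro divides_mult primes_coprime)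
      moreover have "g * i + 1 = p" "g * j + 1 = q" using i j p1 by linarith+
      ultimately have "n \<in> M (g, i, j)" using n unfolding M_def prod.case mem_Collect_eq by (simp only: simp_thms)
      thus "n \<in> (\<Union>t\<in>T. M t)" using T by blast
    qed
    also have "\<dots> \<le> (\<Sum>(g, i, j)\<in>T. real x * (1 / real g ^ 2) * ((1 / real i) * (1 / real j)))"
    proof (rule sum_mono, clarify)
      fix g i j assume t: "(g, i, j) \<in> T"
      have pos: "g > 0" "i > 0" "j > 0" using t by (auto simp: T_def)
      have "real (card (M (g, i, j))) \<le> real x / real ((g * i + 1) * (g * j + 1))"
        unfolding M_def prod.case by (rule card_multiples_le) simp
      also have "\<dots> \<le> real x / real ((g * i) * (g * j))"
        using pos by (intro divide_left_mono of_nat_mono mult_le_mono) (auto simp del: of_nat_mult)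
      also have "\<dots> = real x * (1 / real g ^ 2) * ((1 / real i) * (1 / real j))" by (simp add: power2_eq_square mult_ac)
      finally show "real (card (M (g, i, j))) \<le> real x * (1 / real g ^ 2) * ((1 / real i) * (1 / real j))" .
    qed
    also have "\<dots> = (\<Sum>g\<in>{Z<..x}. \<Sum>(i, j)\<in>{1..x} \<times> {1..x}. real x * (1 / real g ^ 2) * ((1 / real i) * (1 / real j)))"
      unfolding T_def by (rule sum.cartesian_product[symmetric])
    also have "\<dots> = (\<Sum>g\<in>{Z<..x}. real x * (1 / real g ^ 2) * (\<Sum>i\<in>{1..x}. 1 / real i) ^ 2)"
    proof (rule sum.cong)
      fix g
      have "(\<Sum>(i, j)\<in>{1..x} \<times> {1..x}. real x * (1 / real g ^ 2) * ((1 / real i) * (1 / real j))) =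
            (\<Sum>i\<in>{1..x}. \<Sum>j\<in>{1..x}. real x * (1 / real g ^ 2) * ((1 / real i) * (1 / real j)))"
        by (rule sum.cartesian_product[symmetric])
      also have "\<dots> = real x * (1 / real g ^ 2) * (\<Sum>i\<in>{1..x}. 1 / real i) ^ 2"
        by (simp only: power2_eq_square sum_product) (simp only: sum_distrib_left)
      finally show "(\<Sum>(i, j)\<in>{1..x} \<times> {1..x}. real x * (1 / real g ^ 2) * ((1 / real i) * (1 / real j))) =
          real x * (1 / real g ^ 2) * (\<Sum>i\<in>{1..x}. 1 / real i) ^ 2" .
    qed simp
    also have "\<dots> = real x * (\<Sum>i\<in>{1..x}. 1 / real i) ^ 2 * (\<Sum>g\<in>{Z<..x}. 1 / real g ^ 2)"
      unfolding sum_distrib_left by (intro sum.cong refl) (simp only: mult_ac)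
    also have "\<dots> \<le> real x * (1 + ln (real x)) ^ 2 * (1 / (ln (real x) ^ 3 / 2))"
    proof (intro mult_mono mult_left_mono power_mono)
      show "(\<Sum>i\<in>{1..x}. 1 / real i) \<le> 1 + ln (real x)" using x3 by (intro harmonic_le) auto
      have "(\<Sum>g\<in>{Z<..x}. 1 / real g ^ 2) \<le> 1 / real Z" by (rule sum_inverse_squares_tail_le[OF Z(1)])
      also have "\<dots> \<le> 1 / (ln (real x) ^ 3 / 2)" using Z elim by (intro divide_left_mono mult_pos_pos) linarith+
      finally show "(\<Sum>g\<in>{Z<..x}. 1 / real g ^ 2) \<le> 1 / (ln (real x) ^ 3 / 2)" .
    qed (auto intro!: sum_nonneg)
    also have "\<dots> = real x * (2 * (1 + ln (real x)) ^ 2 / ln (real x) ^ 3)" by simp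
    also have "\<dots> \<le> real x * \<eta>"
    proof (rule mult_left_mono)
      have "ln (real x) ^ 3 > 0" using elim by linarith
      thus "2 * (1 + ln (real x)) ^ 2 / ln (real x) ^ 3 \<le> \<eta>" using elim by (simp add: pos_divide_le_eq)
    qed simp
    finally show ?case by (simp add: mult.commute)
  qed
qed

section \<open>From the orders modulo primes to the order modulo n\<close>

lemma gcd_mult_dvd_mult_gcd: "gcd a (b * c) dvd gcd a b * gcd a (c :: nat)"
proof -
  have "gcd a (b * c) dvd gcd (c * a) (c * b)"
    by (rule gcd_greatest) (auto intro: dvd_mult gcd_dvd1 simp: mult.commute[of c b])
  hence "gcd a (b * c) dvd gcd a b * c" by (simp only: gcd_mult_distrib_nat mult.commute)
  moreover have "gcd a (b * c) dvd gcd a b * a" by (rule dvd_mult) (rule gcd_dvd1)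
  ultimately have "gcd a (b * c) dvd gcd (gcd a b * a) (gcd a b * c)" by (intro gcd_greatest)
  thus ?thesis by (simp only: gcd_mult_distrib_nat)
qed

lemma gcd_prod_dvd_prod_gcd:
  fixes a :: nat
  assumes "finite B"
  shows "gcd a (\<Prod>b\<in>B. f b) dvd (\<Prod>b\<in>B. gcd a (f b))"
  using assms
proof (induction B)
  case (insert b B)
  have "gcd a (f b * prod f B) dvd gcd a (f b) * gcd a (prod f B)" by (rule gcd_mult_dvd_mult_gcd)
  also have "\<dots> dvd gcd a (f b) * (\<Prod>b\<in>B. gcd a (f b))" by (rule mult_dvd_mono[OF dvd_refl insert.IH])
  finally show ?case using insert by simp
qed simp

text \<open>Adding a to B loses gcd (f a) (Lcm), which divides the product of the gcds with the
  single f b and is at most G^card B. These exponents sum to less than the square of the final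
  cardinality, unless both are 0. In the application B has bounded size and G is a power of ln x, so
  the loss is x^o(1).\<close>

lemma prod_le_Lcm_times_power:
  fixes f :: "'a \<Rightarrow> nat"
  assumes "finite B" "G \<ge> 1" "\<And>b. b \<in> B \<Longrightarrow> f b > 0"
    "\<And>b c. b \<in> B \<Longrightarrow> c \<in> B \<Longrightarrow> b \<noteq> c \<Longrightarrow> gcd (f b) (f c) \<le> G"
  shows "(\<Prod>b\<in>B. f b) \<le> Lcm (f ` B) * G ^ (card B ^ 2)"
  using assms
proof (induction B)
  case (insert a B)
  define M where "M = Lcm (f ` B)"
  have IH: "(\<Prod>b\<in>B. f b) \<le> M * G ^ (card B ^ 2)" using insert unfolding M_def by simp
  have "M dvd (\<Prod>b\<in>B. f b)" unfolding M_def
    by (rule Lcm_least) (use insert.hyps in \<open>auto intro: dvd_prodI\<close>)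
  hence "gcd (f a) M dvd gcd (f a) (\<Prod>b\<in>B. f b)" by (intro gcd_greatest gcd_dvd1 dvd_trans[OF gcd_dvd2])
  also have "\<dots> dvd (\<Prod>b\<in>B. gcd (f a) (f b))" by (rule gcd_prod_dvd_prod_gcd[OF insert.hyps(1)])
  finally have "gcd (f a) M \<le> (\<Prod>b\<in>B. gcd (f a) (f b))"
    by (rule dvd_imp_le) (use insert in \<open>auto intro!: prod_pos\<close>)
  also have "\<dots> \<le> (\<Prod>b\<in>B. G)" by (rule prod_mono) (use insert in auto)
  also have "\<dots> = G ^ card B" by simp
  finally have g: "gcd (f a) M \<le> G ^ card B" .
  have "(\<Prod>b\<in>insert a B. f b) = f a * (\<Prod>b\<in>B. f b)" using insert.hyps by simp
  also have "\<dots> \<le> f a * (M * G ^ (card B ^ 2))" by (rule mult_left_mono[OF IH]) simp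
  also have "\<dots> = lcm (f a) M * gcd (f a) M * G ^ (card B ^ 2)"
    using prod_gcd_lcm_nat[of "f a" M] by (simp only: mult.assoc[symmetric] mult.commute[of "lcm _ _"])
  also have "\<dots> \<le> lcm (f a) M * G ^ card B * G ^ (card B ^ 2)"
    by (intro mult_right_mono mult_left_mono g) simp_all
  also have "\<dots> = lcm (f a) M * G ^ (card B + card B ^ 2)" by (simp add: power_add)
  also have "\<dots> \<le> lcm (f a) M * G ^ (card (insert a B) ^ 2)"
    using insert.hyps \<open>G \<ge> 1\<close> by (intro mult_left_mono power_increasing) (auto simp: power2_eq_square)
  finally show ?case by (simp add: M_def)
qed simp

text \<open>If a prime p of n outside e did not divide the coprime part, p times that part would be
  a larger admissible divisor.\<close>

lemma coprime_part_props:
  assumes "n > 0"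
  shows "coprime_part e n dvd n" and "coprime (coprime_part e n) e"
    and "\<And>p. prime p \<Longrightarrow> p dvd n \<Longrightarrow> \<not> p dvd e \<Longrightarrow> p dvd coprime_part e n"
    and "coprime n e \<Longrightarrow> coprime_part e n = n"
proof -
  let ?S = "{d. d dvd n \<and> coprime d e}"
  have fin: "finite ?S" by (rule finite_subset[of _ "{d. d dvd n}"]) (use assms in auto)
  have ne: "1 \<in> ?S" by simp
  have "Max ?S \<in> ?S" by (rule Max_in) (use fin ne in auto)
  thus 1: "coprime_part e n dvd n" "coprime (coprime_part e n) e" by (auto simp: coprime_part_def)
  have max: "d \<le> coprime_part e n" if "d dvd n" "coprime d e" for d
    unfolding coprime_part_def by (rule Max_ge) (use fin that in auto)
  show "p dvd coprime_part e n" if p: "prime p" "p dvd n" "\<not> p dvd e" for p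
  proof (rule ccontr)
    assume np: "\<not> p dvd coprime_part e n"
    have "coprime p (coprime_part e n)" using p(1) np by (rule prime_imp_coprime)
    hence "p * coprime_part e n dvd n" using p(2) 1(1) by (intro divides_mult)
    moreover have "coprime (p * coprime_part e n) e"
      using prime_imp_coprime[OF p(1,3)] 1(2) by simp
    ultimately have "p * coprime_part e n \<le> coprime_part e n" by (rule max)
    moreover have "coprime_part e n > 0" using 1(1) assms by (auto intro!: Nat.gr0I)
    ultimately show False using prime_gt_1_nat[OF p(1)] by simp
  qed
  show "coprime_part e n = n" if "coprime n e"
    using max[of n] that dvd_imp_le[OF 1(1) assms] by simp
qed

lemma ord_dvd_ord_star:
  assumes "n > 0" "prime p" "p dvd n" "\<not> p dvd e"
  shows "ord p e dvd ord_star e n" and "ord_star e n > 0"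
proof -
  note cp = coprime_part_props[OF assms(1), where e = e]
  have "[e ^ ord_star e n = 1] (mod coprime_part e n)" unfolding ord_star_def by (rule ord)
  hence "[e ^ ord_star e n = 1] (mod p)" using cp(3)[OF assms(2-4)] by (rule cong_dvd_modulus_nat)
  thus "ord p e dvd ord_star e n" by (simp only: ord_divides)
  show "ord_star e n > 0" using cp(2) by (simp add: ord_star_def)
qed

text \<open>B consists of the primes of n above x^u; as x^u \<ge> e, none divides e. They carry all
  but 2 v ln x of ln x, and those above x^u' at least half of it. The former have exponent at least
  1/2 - v, the latter 1/2 + \<delta>. Since \<open>card B\<close> is at most 1 / u and G at most (ln
  x)^3, common factors cost at most \<delta> / 8 * ln x.\<close>

lemma ln_ord_star_ge:
  fixes \<delta> v u u' :: real and n x e :: nat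
  defines "B \<equiv> {p. prime p \<and> real p > real x powr u \<and> p dvd n}"
  assumes \<delta>: "0 < \<delta>" "\<delta> \<le> 1" and v: "v = \<delta> / 16" and u: "0 < u" "u \<le> u'" "u' \<le> 1"
    and x: "x \<ge> 3" "real x powr u \<ge> real e" "3 * ln (ln (real x)) / u ^ 2 \<le> \<delta> / 8 * ln (real x)" "ln (real x) \<ge> 1"
    and e: "e > 1"
    and n: "0 < n" "n \<le> x" "real n > real x powr (1 - v)"
    and sqf: "\<And>q. real q > real x powr u \<Longrightarrow> \<not> q ^ 2 dvd n"
    and smooth: "smooth_log (real x powr u) n \<le> v * ln (real x)"
    and smooth': "smooth_log (real x powr u') n \<le> 1/4 * ln (real x)"
    and ordu: "\<And>p. p \<in> B \<Longrightarrow> real (ord p e) > real p powr (1/2 - v)"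
    and ordu': "\<And>p. p \<in> B \<Longrightarrow> real p > real x powr u' \<Longrightarrow> real (ord p e) > real p powr (1/2 + \<delta>)"
    and gcds: "\<And>p q. p \<in> B \<Longrightarrow> q \<in> B \<Longrightarrow> p \<noteq> q \<Longrightarrow> real (gcd (p - 1) (q - 1)) \<le> ln (real x) ^ 3"
  shows "real (ord_star e n) \<ge> real n powr (1/2 + \<delta> / 4)"
proof -
  define B' where "B' = {p. prime p \<and> real p > real x powr u' \<and> p dvd n}"
  define l where "l = ln (real x)"
  define G where "G = nat \<lfloor>l ^ 3\<rfloor>"
  have l1: "l \<ge> 1" using x by (simp add: l_def)
  have fin: "finite B" "finite B'" unfolding B_def B'_def by (rule finite_prime_divisors[OF n(1)])+
  have xpu: "real x powr u \<le> real x powr u'" using x u by (intro powr_mono) auto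
  have sub: "B' \<subseteq> B" using xpu unfolding B_def B'_def by (auto intro: order_le_less_trans)
  have Bp: "prime p" "p dvd n" "\<not> p dvd e" "real p > 1" if "p \<in> B" for p
  proof -
    show p: "prime p" "p dvd n" using that by (auto simp: B_def)
    have "real p > real e" using that x by (auto simp: B_def)
    thus "\<not> p dvd e" using dvd_imp_le[of p e] e by auto
    show "real p > 1" using prime_gt_1_nat[OF p(1)] by simp
  qed
  have nln: "ln (real n) \<ge> (1 - v) * l"
  proof -
    have "ln (real x powr (1 - v)) \<le> ln (real n)" using n x by (intro ln_mono) auto
    thus ?thesis using x by (simp add: ln_powr l_def)
  qed
  have nln': "ln (real n) \<le> l" unfolding l_def using n by (intro ln_mono) auto
  have "ln (real n) = smooth_log (real x powr u) n + (\<Sum>p\<in>B. ln (real p))"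
    unfolding B_def by (rule ln_eq_smooth_log_plus[OF n(1)]) (use sqf in blast)
  hence SB: "(\<Sum>p\<in>B. ln (real p)) \<ge> (1 - 2 * v) * l" "(\<Sum>p\<in>B. ln (real p)) \<le> l"
    using smooth nln nln' smooth_log_nonneg[of "real x powr u" n] unfolding l_def by (simp_all add: algebra_simps)
  have "ln (real n) = smooth_log (real x powr u') n + (\<Sum>p\<in>B'. ln (real p))"
    unfolding B'_def by (rule ln_eq_smooth_log_plus[OF n(1)]) (use sqf xpu in force)
  hence "(\<Sum>p\<in>B'. ln (real p)) \<ge> (3/4 - v) * l"
    using smooth' nln unfolding l_def by (simp add: algebra_simps)
  moreover have "1/2 * l \<le> (3/4 - v) * l" using l1 v \<delta> by (intro mult_right_mono) auto
  ultimately have SB': "(\<Sum>p\<in>B'. ln (real p)) \<ge> 1/2 * l" by linarith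
  have cardB: "real (card B) \<le> 1 / u"
  proof -
    have "real (card B) * (u * l) = (\<Sum>p\<in>B. u * l)" by simp
    also have "\<dots> \<le> (\<Sum>p\<in>B. ln (real p))"
    proof (rule sum_mono)
      fix p assume "p \<in> B"
      hence "ln (real x powr u) \<le> ln (real p)" using x by (intro ln_mono) (auto simp: B_def)
      thus "u * l \<le> ln (real p)" using x by (simp add: l_def ln_powr)
    qed
    also have "\<dots> \<le> 1 * l" using SB by simp
    finally have "(real (card B) * u) * l \<le> 1 * l" by (simp only: mult.assoc)
    hence "real (card B) * u \<le> 1" using l1 by (simp add: mult_le_cancel_right)
    thus ?thesis using u by (simp add: field_simps)
  qed
  have G1: "G \<ge> 1" "real G \<le> l ^ 3"
  proof -
    have "l ^ 3 \<ge> 1" using l1 by (rule one_le_power)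
    thus "G \<ge> 1" "real G \<le> l ^ 3" unfolding G_def by linarith+
  qed
  have "B \<noteq> {}" using SB(1) l1 v \<delta> by (intro notI) (auto simp: mult_le_0_iff)
  then obtain p0 where p0: "p0 \<in> B" by blast
  have star0: "ord_star e n > 0" using ord_dvd_ord_star(2)[OF n(1) Bp(1-3)[OF p0]] .
  have ord0: "ord p e > 0" if "p \<in> B" for p using ord_dvd_prime_minus_1(2)[OF Bp(1,3)[OF that]] .
  have "(\<Prod>p\<in>B. ord p e) \<le> Lcm ((\<lambda>p. ord p e) ` B) * G ^ (card B ^ 2)"
  proof (rule prod_le_Lcm_times_power[OF fin(1) G1(1) ord0])
    fix p q assume pq: "p \<in> B" "q \<in> B" "p \<noteq> q"
    have "gcd (ord p e) (ord q e) dvd gcd (p - 1) (q - 1)"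
      using ord_dvd_prime_minus_1(1)[OF Bp(1,3)[OF pq(1)]] ord_dvd_prime_minus_1(1)[OF Bp(1,3)[OF pq(2)]]
      by (rule gcd_mono)
    hence "gcd (ord p e) (ord q e) \<le> gcd (p - 1) (q - 1)"
      by (rule dvd_imp_le) (use prime_gt_1_nat[OF Bp(1)[OF pq(1)]] in simp)
    also have "\<dots> \<le> G" unfolding G_def using gcds[OF pq] by (simp add: le_nat_floor l_def)
    finally show "gcd (ord p e) (ord q e) \<le> G" .
  qed
  also have "\<dots> \<le> ord_star e n * G ^ (card B ^ 2)"
  proof (rule mult_right_mono)
    show "Lcm ((\<lambda>p. ord p e) ` B) \<le> ord_star e n"
      by (rule dvd_imp_le[OF Lcm_least star0]) (use ord_dvd_ord_star(1)[OF n(1)] Bp in auto)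
  qed simp
  finally have "real (\<Prod>p\<in>B. ord p e) \<le> real (ord_star e n * G ^ (card B ^ 2))" by (rule of_nat_mono)
  hence "ln (real (\<Prod>p\<in>B. ord p e)) \<le> ln (real (ord_star e n * G ^ (card B ^ 2)))"
    using ord0 by (intro ln_mono) (auto intro!: prod_pos)
  also have "\<dots> = ln (real (ord_star e n)) + real (card B) ^ 2 * ln (real G)"
    using star0 G1 by (simp add: ln_mult ln_realpow)
  also have "real (card B) ^ 2 * ln (real G) \<le> (1 / u) ^ 2 * (3 * ln l)"
  proof (rule mult_mono)
    have "ln (real G) \<le> ln (l ^ 3)" using G1 by (intro ln_mono) auto
    thus "ln (real G) \<le> 3 * ln l" using l1 by (simp add: ln_realpow)
  qed (use cardB G1 in \<open>auto intro!: power_mono\<close>)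
  also have "(1 / u) ^ 2 * (3 * ln l) \<le> \<delta> / 8 * l"
    using x(3) by (simp add: l_def power_divide)
  also have "ln (real (\<Prod>p\<in>B. ord p e)) = (\<Sum>p\<in>B. ln (real (ord p e)))"
    unfolding of_nat_prod by (rule ln_prod[OF fin(1)]) (use ord0 in simp)
  finally have upper: "(\<Sum>p\<in>B. ln (real (ord p e))) \<le> ln (real (ord_star e n)) + \<delta> / 8 * l" by simp
  have "(1/2 - v) * (\<Sum>p\<in>B. ln (real p)) + \<delta> * (\<Sum>p\<in>B'. ln (real p)) =
        (\<Sum>p\<in>B. (1/2 - v) * ln (real p) + (if p \<in> B' then \<delta> * ln (real p) else 0))"
  proof -
    have "(\<Sum>p\<in>B. if p \<in> B' then \<delta> * ln (real p) else 0) = (\<Sum>p\<in>B'. \<delta> * ln (real p))"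
      using fin(1) sub by (simp add: sum.If_cases Int_absorb1)
    thus ?thesis by (simp add: sum.distrib sum_distrib_left)
  qed
  also have "\<dots> \<le> (\<Sum>p\<in>B. ln (real (ord p e)))"
  proof (rule sum_mono)
    fix p assume p: "p \<in> B"
    have p1: "real p > 1" using Bp(4)[OF p] .
    show "(1/2 - v) * ln (real p) + (if p \<in> B' then \<delta> * ln (real p) else 0) \<le> ln (real (ord p e))"
    proof (cases "p \<in> B'")
      case True
      have "ln (real p powr (1/2 + \<delta>)) \<le> ln (real (ord p e))"
        using ordu'[OF p] True p1 by (intro ln_mono) (auto simp: B'_def)
      hence "(1/2 + \<delta>) * ln (real p) \<le> ln (real (ord p e))" using p1 by (simp add: ln_powr)
      moreover have "(1/2 - v) * ln (real p) + \<delta> * ln (real p) \<le> (1/2 + \<delta>) * ln (real p)"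
        using p1 v \<delta> by (simp add: algebra_simps)
      ultimately show ?thesis using True by simp
    next
      case False
      have "ln (real p powr (1/2 - v)) \<le> ln (real (ord p e))"
        using ordu[OF p] p1 by (intro ln_mono) auto
      thus ?thesis using p1 False by (simp add: ln_powr)
    qed
  qed
  finally have lower: "(1/2 - v) * (\<Sum>p\<in>B. ln (real p)) + \<delta> * (\<Sum>p\<in>B'. ln (real p)) \<le> ln (real (ord_star e n)) + \<delta> / 8 * l"
    using upper by linarith
  have "(1/2 - v) * ((1 - 2 * v) * l) \<le> (1/2 - v) * (\<Sum>p\<in>B. ln (real p))"
    using SB(1) v \<delta> by (intro mult_left_mono) auto
  moreover have "\<delta> * (1/2 * l) \<le> \<delta> * (\<Sum>p\<in>B'. ln (real p))" using SB' \<delta> by (intro mult_left_mono) auto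
  \<comment> \<open>With v = \<delta> / 16, (1/2 - v) (1 - 2 v) = 1/2 - \<delta> / 8 + 2 v^2, and
    the gain \<delta> / 2 turns this into at least 1/2 + 3/8 \<delta>. Common factors take another
    \<delta> / 8, leaving \<delta> / 4.\<close>
  moreover have "(1/2 + 3/8 * \<delta>) * l \<le> (1/2 - v) * ((1 - 2 * v) * l) + \<delta> * (1/2 * l)"
  proof -
    have "(1/2 + 3/8 * \<delta>) * l \<le> ((1/2 - v) * (1 - 2 * v) + \<delta> * (1/2)) * l"
      using l1 by (intro mult_right_mono) (auto simp: v algebra_simps)
    thus ?thesis by (simp only: distrib_right mult.assoc)
  qed
  ultimately have "(1/2 + 3/8 * \<delta>) * l - \<delta> / 8 * l \<le> ln (real (ord_star e n))" using lower by linarith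
  hence "(1/2 + \<delta> / 4) * l \<le> ln (real (ord_star e n))" by (simp add: algebra_simps)
  moreover have "(1/2 + \<delta> / 4) * ln (real n) \<le> (1/2 + \<delta> / 4) * l" using nln' \<delta> by (intro mult_left_mono) auto
  ultimately have "ln (real n powr (1/2 + \<delta> / 4)) \<le> ln (real (ord_star e n))" using n by (simp add: ln_powr)
  thus ?thesis using n star0 by (subst (asm) ln_le_cancel_iff) auto
qed

section \<open>Exceptional integers and the two final statements\<close>

abbreviation low_ord_star :: "nat \<Rightarrow> real \<Rightarrow> nat \<Rightarrow> nat set" where
  "low_ord_star e \<delta> x \<equiv> {n. 0 < n \<and> n \<le> x \<and> real (ord_star e n) < real n powr (1/2 + \<delta>)}"

theorem small_ord_star_rare:
  fixes e :: nat and \<eta> :: real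
  assumes e: "e > 1" and \<eta>: "\<eta> > 0"
  shows "\<exists>\<delta>>0. \<forall>\<^sub>F x in sequentially.
    real (card (low_ord_star e \<delta> x)) \<le> \<eta> * real x"
proof -
  text \<open>
    Order of choice: \<open>u'\<close>, then \<open>\<delta>\<close>, then \<open>v\<close>, then \<open>u\<close>. The primes above \<open>x powr u'\<close> yield a gain of
    \<open>x powr (\<delta> / 2)\<close>, against which the losses from the other primes and the smooth part are small.
  \<close>
  define u' where "u' = min (\<eta> / 64) (1/2)"
  have u': "u' > 0" "u' \<le> 1" "2 * u' / (1/4) \<le> \<eta> / 8" using \<eta> by (auto simp: u'_def)
  \<comment> \<open>Cancels the loss 6 / u' for integers divisible by a prime of a sparse set,
    leaving \<eta> / 8. Seven exceptional sets of this size stay below \<eta> x.\<close>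
  define \<eta>' where "\<eta>' = \<eta> * u' / 48"
  have \<eta>': "\<eta>' > 0" "6 * \<eta>' / u' = \<eta> / 8" using \<eta> u' by (auto simp: \<eta>'_def)
  obtain \<delta>0 where \<delta>0: "\<delta>0 > 0" "sparse (low_order_primes e \<delta>0) \<eta>'"
    using small_order_primes[OF e \<eta>'(1)] by blast
  define \<delta> where "\<delta> = min \<delta>0 1"
  have \<delta>: "\<delta> > 0" "\<delta> \<le> 1" "\<delta> \<le> \<delta>0" using \<delta>0(1) by (auto simp: \<delta>_def)
  define v where "v = \<delta> / 16"
  have v: "v > 0" "v < 1/2" using \<delta> by (auto simp: v_def)
  define u where "u = min (\<eta> * v / 16) u'"
  have u: "u > 0" "u \<le> u'" "2 * u / v \<le> \<eta> / 8"
  proof -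
    show "u > 0" "u \<le> u'" using \<eta> v u' by (auto simp: u_def)
    have "u \<le> \<eta> * v / 16" by (simp add: u_def)
    thus "2 * u / v \<le> \<eta> / 8" using v by (simp add: field_simps)
  qed
  \<comment> \<open>The order is compared with a power of p itself; since p \<le> X, the resulting
    sets up to X lie inside those defined with powers of X.\<close>
  define Q1 where "Q1 = {p. prime p \<and> \<not> p dvd e \<and> real (ord p e) \<le> real p powr (1/2 + \<delta>)}"
  define Q2 where "Q2 = {p. prime p \<and> \<not> p dvd e \<and> real (ord p e) \<le> real p powr (1/2 - v)}"
  define \<eta>2 where "\<eta>2 = \<eta> * u / 48"
  have \<eta>2: "\<eta>2 > 0" "6 * \<eta>2 / u = \<eta> / 8" using \<eta> u by (auto simp: \<eta>2_def)
  have "\<forall>\<^sub>F X in sequentially. real X \<ge> 1" by real_asymp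
  with \<delta>0(2) have sparse1: "sparse (\<lambda>X. {p\<in>Q1. p \<le> X}) \<eta>'"
  proof eventually_elim
    case (elim X)
    have "card {p\<in>Q1. p \<le> X} \<le> card (low_order_primes e \<delta>0 X)"
    proof (rule card_mono[OF finite_primes_upto'], rule subsetI)
      fix p assume p: "p \<in> {p\<in>Q1. p \<le> X}"
      have "real (ord p e) \<le> real p powr (1/2 + \<delta>)" using p by (simp add: Q1_def)
      also have "\<dots> \<le> real X powr (1/2 + \<delta>)" using p \<delta> by (intro powr_mono2) auto
      also have "\<dots> \<le> real X powr (1/2 + \<delta>0)" using elim \<delta> by (intro powr_mono) auto
      finally show "p \<in> (low_order_primes e \<delta>0 X)"
        using p by (simp add: Q1_def)
    qed
    thus ?case using elim by linarith
  qed
  \<comment> \<open>The elementary count saves X^(2 v), so \<open>Q2\<close> is sparse with every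
    positive constant. This is why u may be chosen after v, although \<open>\<eta>2\<close> depends
    on u.\<close>
  have "\<forall>\<^sub>F X in sequentially. real e * (real X powr (1/2 - v)) ^ 2 \<le> \<eta>2 * (real X / ln (real X))"
    using \<eta>2 v(1) by real_asymp
  hence sparse2: "sparse (\<lambda>X. {p\<in>Q2. p \<le> X}) \<eta>2"
  proof eventually_elim
    case (elim X)
    have "{p\<in>Q2. p \<le> X} \<subseteq> (primes_ord_le e (real X powr (1/2 - v)))"
    proof
      fix p assume p: "p \<in> {p\<in>Q2. p \<le> X}"
      have "real (ord p e) \<le> real p powr (1/2 - v)" using p by (simp add: Q2_def)
      also have "\<dots> \<le> real X powr (1/2 - v)" using p v by (intro powr_mono2) auto
      finally show "p \<in> (primes_ord_le e (real X powr (1/2 - v)))"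
        using p by (simp add: Q2_def)
    qed
    hence "card {p\<in>Q2. p \<le> X} \<le> card (primes_ord_le e (real X powr (1/2 - v)))"
      by (rule card_mono[OF card_primes_order_le(1)[OF e powr_ge_zero]])
    hence "real (card {p\<in>Q2. p \<le> X}) \<le> real e * (real X powr (1/2 - v)) ^ 2"
      using card_primes_order_le(2)[OF e powr_ge_zero, of "real X" "1/2 - v"] by linarith
    thus ?case using elim by linarith
  qed
  have ev: "\<forall>\<^sub>F x in sequentially. real x \<ge> 3 \<and> real x powr u \<ge> real e \<and> ln (real x) \<ge> 1 \<and>
      3 * ln (ln (real x)) / u ^ 2 \<le> \<delta> / 8 * ln (real x) \<and> 2 * real x / real x powr u \<le> \<eta> / 8 * real x \<and>
      real x powr (1 - v) \<le> \<eta> / 8 * real x"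
    using u(1) \<delta>(1) v(1) \<eta> by (intro eventually_conj; real_asymp)
  have \<eta>8: "\<eta> / 8 > 0" and quarter: "(1/4::real) > 0" using \<eta> by simp_all
  have "\<forall>\<^sub>F x in sequentially.
    real (card (low_ord_star e (\<delta> / 4) x)) \<le> \<eta> * real x"
    using ev card_large_smooth_part[OF u'(1) quarter] card_large_smooth_part[OF u(1) v(1)]
      card_divisible_by_sparse_primes[OF \<eta>'(1) u'(1) sparse1] card_divisible_by_sparse_primes[OF \<eta>2(1) u(1) sparse2]
      card_large_shifted_gcd[OF \<eta>8]
  proof eventually_elim
    case (elim x)
    define E1 where "E1 = {n. 0 < n \<and> n \<le> x \<and> smooth_log (real x powr u') n > 1/4 * ln (real x)}"
    define E2 where "E2 = {n. 0 < n \<and> n \<le> x \<and> smooth_log (real x powr u) n > v * ln (real x)}"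
    define E3 where "E3 = {n. 0 < n \<and> n \<le> x \<and> (\<exists>p\<in>Q1. real p > real x powr u' \<and> p dvd n)}"
    define E4 where "E4 = {n. 0 < n \<and> n \<le> x \<and> (\<exists>p\<in>Q2. real p > real x powr u \<and> p dvd n)}"
    define E5 where "E5 = {n. 0 < n \<and> n \<le> x \<and> (\<exists>p q. prime p \<and> prime q \<and> p \<noteq> q \<and> p dvd n \<and> q dvd n \<and>
           real (gcd (p - 1) (q - 1)) > ln (real x) ^ 3)}"
    define E6 where "E6 = {n\<in>{1..x}. \<exists>q. real q > real x powr u \<and> q ^ 2 dvd n}"
    define E7 where "E7 = {n. 0 < n \<and> n \<le> x \<and> real n \<le> real x powr (1 - v)}"
    let ?G = "(low_ord_star e (\<delta> / 4) x)"
    have x3: "x \<ge> 3" using elim(1) by simp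
    have c1: "real (card E1) \<le> \<eta> / 8 * real x"
      using elim(2) mult_right_mono[OF u'(3), of "real x"] unfolding E1_def by simp
    have c2: "real (card E2) \<le> \<eta> / 8 * real x"
      using elim(3) mult_right_mono[OF u(3), of "real x"] unfolding E2_def by simp
    have c3: "real (card E3) \<le> \<eta> / 8 * real x" using elim(4) unfolding E3_def \<eta>'(2) .
    have c4: "real (card E4) \<le> \<eta> / 8 * real x" using elim(5) unfolding E4_def \<eta>2(2) .
    have c5: "real (card E5) \<le> \<eta> / 8 * real x" using elim(6) unfolding E5_def .
    have c6: "real (card E6) \<le> \<eta> / 8 * real x"
    proof -
      have "real (card E6) \<le> 2 * real x / real x powr u" unfolding E6_def
        by (rule card_square_divisible_le) (use x3 u in \<open>auto intro!: ge_one_powr_ge_zero\<close>)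
      thus ?thesis using elim(1) by linarith
    qed
    have c7: "real (card E7) \<le> \<eta> / 8 * real x"
    proof -
      have "real (card E7) \<le> real x powr (1 - v)" by (rule card_le_real) (auto simp: E7_def)
      thus ?thesis using elim(1) by linarith
    qed
    have "?G \<subseteq> E1 \<union> (E2 \<union> (E3 \<union> (E4 \<union> (E5 \<union> (E6 \<union> E7)))))"
    proof
      fix n assume n: "n \<in> ?G"
      show "n \<in> E1 \<union> (E2 \<union> (E3 \<union> (E4 \<union> (E5 \<union> (E6 \<union> E7)))))"
      proof (rule ccontr)
        assume nn: "n \<notin> E1 \<union> (E2 \<union> (E3 \<union> (E4 \<union> (E5 \<union> (E6 \<union> E7)))))"
        have n0: "0 < n" "n \<le> x" using n by auto
        have nope: "\<not> p dvd e" if "prime p" "real p > real x powr u" for p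
        proof
          assume "p dvd e"
          hence "p \<le> e" using e by (intro dvd_imp_le) auto
          thus False using that(2) elim(1) by linarith
        qed
        have xpu: "real x powr u \<le> real x powr u'" using x3 u by (intro powr_mono) auto
        have "real (ord_star e n) \<ge> real n powr (1/2 + \<delta> / 4)"
        proof (rule ln_ord_star_ge[where u = u and u' = u' and x = x and v = v])
          show "real x powr (1 - v) < real n" using nn n0 by (auto simp: E7_def)
          show "\<not> q ^ 2 dvd n" if "real x powr u < real q" for q using nn n0 that by (auto simp: E6_def)
          show "smooth_log (real x powr u) n \<le> v * ln (real x)" using nn n0 by (auto simp: E2_def)
          show "smooth_log (real x powr u') n \<le> 1 / 4 * ln (real x)" using nn n0 by (auto simp: E1_def)
          fix p assume p: "p \<in> {p. prime p \<and> real x powr u < real p \<and> p dvd n}"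
          have p': "prime p" "real x powr u < real p" "p dvd n" "\<not> p dvd e" using p nope by auto
          have "p \<notin> Q2" using nn n0 p' by (auto simp: E4_def)
          thus "real p powr (1 / 2 - v) < real (ord p e)" using p' by (auto simp: Q2_def)
          show "real p powr (1 / 2 + \<delta>) < real (ord p e)" if "real x powr u' < real p"
          proof -
            have "p \<notin> Q1" using nn n0 p' that by (auto simp: E3_def)
            thus ?thesis using p' by (auto simp: Q1_def)
          qed
          fix q assume q: "q \<in> {p. prime p \<and> real x powr u < real p \<and> p dvd n}" "p \<noteq> q"
          show "real (gcd (p - 1) (q - 1)) \<le> ln (real x) ^ 3"
          proof (rule ccontr)
            assume "\<not> real (gcd (p - 1) (q - 1)) \<le> ln (real x) ^ 3"
            hence "n \<in> E5" using p q n0 unfolding E5_def mem_Collect_eq not_le by blast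
            thus False using nn by blast
          qed
        qed (use \<delta> v_def u u' x3 elim(1) e n0 in auto)
        thus False using n by auto
      qed
    qed
    moreover have "finite E1" "finite E2" "finite E3" "finite E4" "finite E5" "finite E6" "finite E7"
      unfolding E1_def E2_def E3_def E4_def E5_def E6_def E7_def by (auto intro: finite_subset[of _ "{..x}"])
    ultimately have "card ?G \<le> card (E1 \<union> (E2 \<union> (E3 \<union> (E4 \<union> (E5 \<union> (E6 \<union> E7))))))" by (intro card_mono) auto
    also have "\<dots> \<le> card E1 + (card E2 + (card E3 + (card E4 + (card E5 + (card E6 + card E7)))))"
      by (intro order_trans[OF card_Un_le] add_left_mono order_refl)
    finally have "real (card ?G) \<le> real (card E1) + (real (card E2) + (real (card E3) + (real (card E4) + (real (card E5) + (real (card E6) + real (card E7))))))"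
      by linarith
    also have "\<dots> \<le> 7 * (\<eta> / 8 * real x)" using c1 c2 c3 c4 c5 c6 c7 by linarith
    also have "\<dots> \<le> \<eta> * real x" using \<eta> by simp
    finally show ?case .
  qed
  moreover have "\<delta> / 4 > 0" using \<delta> by simp
  ultimately show ?thesis by blast
qed

theorem theorem1:
  fixes e :: nat
  assumes "e > 1"
  shows "(\<forall>\<epsilon> :: real \<Rightarrow> real. (\<epsilon> \<longlongrightarrow> 0) at_top \<longrightarrow>
            almost_all (\<lambda>n. real (ord_star e n) \<ge> real n powr (1/2 + \<epsilon> (real n)))) \<and>
         (\<exists>\<gamma>\<^sub>1 > 0. positive_proportion
            (\<lambda>n. gcd e n = 1 \<and> real (ord n e) \<ge> real n powr (1/2 + \<gamma>\<^sub>1)))"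
proof (intro conjI allI impI)
  fix \<epsilon> :: "real \<Rightarrow> real" assume \<epsilon>: "(\<epsilon> \<longlongrightarrow> 0) at_top"
  let ?P = "\<lambda>n. real (ord_star e n) \<ge> real n powr (1/2 + \<epsilon> (real n))"
  show "almost_all ?P"
    unfolding almost_all_def
  proof (rule landau_o.smallI)
    fix c :: real assume c: "c > 0"
    obtain \<delta> where \<delta>: "\<delta> > 0" "\<forall>\<^sub>F x in sequentially.
      real (card (low_ord_star e \<delta> x)) \<le> c / 2 * real x"
      using small_ord_star_rare[OF assms, of "c / 2"] c by auto
    then obtain X0 where X0: "\<And>x. x \<ge> X0 \<Longrightarrow>
      real (card (low_ord_star e \<delta> x)) \<le> c / 2 * real x"
      by (auto simp: eventually_sequentially)
    have "\<forall>\<^sub>F x in at_top. \<epsilon> x < \<delta>" using order_tendstoD(2)[OF \<epsilon> \<delta>(1)] .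
    then obtain y0 where y0: "\<And>x. x \<ge> y0 \<Longrightarrow> \<epsilon> x < \<delta>" by (auto simp: eventually_at_top_linorder)
    \<comment> \<open>Beyond Y the exponent \<epsilon> is below the fixed \<delta>. The speed of
      convergence affects Y alone, and the n \<le> Y fit into c / 2 * x for large x.\<close>
    define Y where "Y = nat \<lceil>y0\<rceil>"
    have "\<forall>\<^sub>F x in at_top. x \<ge> real X0 \<and> real Y \<le> c / 2 * x \<and> x \<ge> 0" using c by (intro eventually_conj; real_asymp)
    thus "\<forall>\<^sub>F x in at_top. norm (real (count_upto (\<lambda>n. \<not> ?P n) x)) \<le> c * norm x"
    proof eventually_elim
      case (elim x)
      define N where "N = nat \<lfloor>x\<rfloor>"
      have N: "N \<ge> X0" "real N \<le> x" using elim unfolding N_def by (auto simp: le_nat_floor)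
      let ?E = "(low_ord_star e \<delta> N)"
      have "{n. 0 < n \<and> real n \<le> x \<and> \<not> ?P n} \<subseteq> {1..Y} \<union> ?E"
      proof
        fix n assume n: "n \<in> {n. 0 < n \<and> real n \<le> x \<and> \<not> ?P n}"
        show "n \<in> {1..Y} \<union> ?E"
        proof (cases "n \<le> Y")
          case False
          hence "\<epsilon> (real n) < \<delta>" unfolding Y_def by (intro y0) linarith
          hence "real n powr (1/2 + \<epsilon> (real n)) \<le> real n powr (1/2 + \<delta>)" using n by (intro powr_mono) auto
          thus ?thesis using n by (auto simp: N_def le_nat_floor)
        qed (use n in auto)
      qed
      hence "card {n. 0 < n \<and> real n \<le> x \<and> \<not> ?P n} \<le> card ({1..Y} \<union> ?E)"
        by (rule card_mono[rotated]) (auto intro: finite_subset[of _ "{..N}"])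
      also have "\<dots> \<le> card {1..Y} + card ?E" by (rule card_Un_le)
      finally have "real (count_upto (\<lambda>n. \<not> ?P n) x) \<le> real Y + real (card ?E)" by (simp add: count_upto_def)
      also have "\<dots> \<le> c / 2 * x + c / 2 * real N" using elim X0[OF N(1)] by linarith
      also have "\<dots> \<le> c / 2 * x + c / 2 * x" using N c by (intro add_left_mono mult_left_mono) auto
      finally show ?case using elim by simp
    qed
  qed
next
  have e0: "real e > 0" using assms by simp
  \<comment> \<open>1 / (2 e) is half the density of the class 1 modulo e, so at least N / (2 e) of
    its members have large order. The further 2 in 1 / (4 e) comes from N \<ge> x / 2.\<close>
  obtain \<delta> where \<delta>: "\<delta> > 0" "\<forall>\<^sub>F x in sequentially.
      real (card (low_ord_star e \<delta> x)) \<le> 1 / (2 * real e) * real x"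
    using small_ord_star_rare[OF assms, of "1 / (2 * real e)"] e0 by auto
  then obtain X0 where X0: "\<And>x. x \<ge> X0 \<Longrightarrow>
      real (card (low_ord_star e \<delta> x)) \<le> 1 / (2 * real e) * real x"
    by (auto simp: eventually_sequentially)
  let ?P = "\<lambda>n. gcd e n = 1 \<and> real (ord n e) \<ge> real n powr (1/2 + \<delta>)"
  have "positive_proportion ?P"
    unfolding positive_proportion_def
  proof (rule landau_omega.bigI)
    show "1 / (4 * real e) > 0" using e0 by simp
    have "\<forall>\<^sub>F x in at_top. x \<ge> real X0 \<and> x \<ge> (2::real)" by (intro eventually_conj; real_asymp)
    thus "\<forall>\<^sub>F x in at_top. norm (real (count_upto ?P x)) \<ge> 1 / (4 * real e) * norm x"
    proof eventually_elim
      case (elim x)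
      define N where "N = nat \<lfloor>x\<rfloor>"
      have N: "N \<ge> X0" "real N \<ge> x / 2" "N \<ge> 1"
      proof -
        show "N \<ge> X0" using elim unfolding N_def by (auto simp: le_nat_floor)
        show "N \<ge> 1" "real N \<ge> x / 2" using elim unfolding N_def by linarith+
      qed
      let ?E = "(low_ord_star e \<delta> N)"
      \<comment> \<open>The integers congruent to 1 modulo e from 1 to N, at least N / e of them.
        Each is coprime to e, hence equal to its coprime part, and \<open>ord_star\<close> becomes
        \<open>ord\<close>.\<close>
      let ?R = "(\<lambda>k. e * k + 1) ` {0..(N - 1) div e}"
      have finE: "finite ?E" by (rule finite_subset[of _ "{..N}"]) auto
      have finP: "finite {n. 0 < n \<and> real n \<le> x \<and> ?P n}"
        by (rule finite_subset[of _ "{..N}"]) (auto simp: N_def le_nat_floor)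
      have "?R \<subseteq> {n. 0 < n \<and> real n \<le> x \<and> ?P n} \<union> ?E"
      proof
        fix n assume "n \<in> ?R"
        then obtain k where "n = e * k + 1" "k \<in> {0..(N - 1) div e}" by blast
        hence k: "n = e * k + 1" "k \<le> (N - 1) div e" by simp_all
        have "k * e \<le> N - 1" using k(2) assms by (simp add: less_eq_div_iff_mult_less_eq)
        hence nN: "n \<le> N" using k(1) N(3) by (simp add: mult.commute)
        have "real N \<le> x" using elim by (simp add: N_def)
        hence nx: "real n \<le> x" using nN by linarith
        have g: "gcd e n = 1"
        proof -
          have "gcd e n dvd e * k + 1 - e * k" unfolding k(1) by (intro dvd_diff_nat gcd_dvd2 dvd_mult2 gcd_dvd1)
          thus ?thesis by simp
        qed
        have n0: "n > 0" using k by simp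
        have "coprime e n" using g by (simp only: coprime_iff_gcd_eq_1)
        hence "coprime n e" by (simp only: coprime_commute)
        hence "ord_star e n = ord n e" using coprime_part_props(4)[OF n0] by (simp add: ord_star_def)
        thus "n \<in> {n. 0 < n \<and> real n \<le> x \<and> ?P n} \<union> ?E" using g n0 nN nx by auto
      qed
      hence "card ?R \<le> card ({n. 0 < n \<and> real n \<le> x \<and> ?P n} \<union> ?E)"
        by (rule card_mono[rotated]) (use finE finP in blast)
      also have "\<dots> \<le> count_upto ?P x + card ?E" unfolding count_upto_def by (rule card_Un_le)
      finally have 1: "real (card ?R) \<le> real (count_upto ?P x) + real (card ?E)" by linarith
      have "card ?R = (N - 1) div e + 1"
        using assms by (subst card_image) (auto intro!: inj_onI)
      moreover have "N \<le> e * ((N - 1) div e + 1)"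
        using dividend_less_div_times[of e "N - 1"] assms N(3) by (simp add: algebra_simps)
      ultimately have "N \<le> e * card ?R" by (simp only:)
      hence "real N \<le> real (e * card ?R)" by (rule of_nat_mono)
      hence "real N \<le> real e * real (card ?R)" by (simp only: of_nat_mult)
      hence "real N / real e \<le> real (card ?R)" using e0 by (simp add: pos_divide_le_eq mult.commute)
      moreover have "real N / real e = 1 / (2 * real e) * real N + 1 / (2 * real e) * real N" using e0 by (simp add: field_simps)
      ultimately have "1 / (2 * real e) * real N \<le> real (count_upto ?P x)" using 1 X0[OF N(1)] by linarith
      moreover have "1 / (2 * real e) * (x / 2) \<le> 1 / (2 * real e) * real N" using N e0 by (intro mult_left_mono) auto
      ultimately show ?case using elim by simp
    qed
  qed
  thus "\<exists>\<gamma>\<^sub>1 > 0. positive_proportion (\<lambda>n. gcd e n = 1 \<and> real (ord n e) \<ge> real n powr (1/2 + \<gamma>\<^sub>1))"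
    using \<delta>(1) by blast
qed

end
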